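(* Let $n$ be a positive integer, let $\alpha<n$ be a real number, let $\zeta\in\mathbb{C}\setminus\{0\}$, and let $A(z)=T(z)+B(z)$, where $$T(z)=H(z)e^{\zeta z^n},$$ $H\not\equiv 0$ is an entire function of order $\rho(H)<\alpha$, and $B$ is an entire function of finite order with the following property: for each $\theta\in[-\pi,\pi)$ there exists $s(\theta)<1/2$ such that $$\log^+|B(re^{i\theta})|\le s(\theta)\max\{\operatorname{Re}(\zeta e^{in\theta}),0\}\,r^n+r^\alpha$$ as $r\to\infty$, i.e. for all $r\ge r_0(\theta)$ (not necessarily uniformly in $\theta$). Suppose that the differential equation $f''+A(z)f=0$ possesses a nontrivial solution $f$ with $\lambda(f)<\alpha$. Then $f$ and $H$ have no zeros, and $$B(z)=-\frac{1}{16}\left(\frac{T'(z)}{T(z)}\right)^2+\frac14\left(\frac{T'(z)}{T(z)}\right)'.$$ Moreover, in this case the equation $f''+A(z)f=0$ admits a zero-free solution base, i.e. two linearly independent solutions neither of which has any zeros.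
   Context: $\rho(g)$ denotes the order of growth of an entire function $g$. $\lambda(f)$ denotes the exponent of convergence of the zeros of $f$ (zeros counted with multiplicity). All solutions of $f''+A(z)f=0$ with $A$ entire are entire; a nontrivial solution is one that is not identically zero. *)

theory Defs
  imports "HOL-Complex_Analysis.Complex_Analysis"
begin

definition log_plus :: "real \<Rightarrow> real" where
  "log_plus x = ln (max 1 x)"

definition max_modulus :: "(complex \<Rightarrow> complex) \<Rightarrow> real \<Rightarrow> real" where
  "max_modulus g r = (SUP z\<in>sphere 0 r. norm (g z))"

text \<open>The order of growth; with the positive parts of both logarithms, every constant function
  (including zero) has order zero.\<close>

definition growth_order :: "(complex \<Rightarrow> complex) \<Rightarrow> ereal" where
  "growth_order g =
     Limsup at_top (\<lambda>r. ereal (log_plus (log_plus (max_modulus g r)) / ln r))"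

text \<open>The exponent of convergence of the zeros of an entire function that is not identically zero:
  the infimum of the \<open>s > 0\<close> for which the sum of \<open>\<bar>z\<bar>\<close> to the power \<open>-s\<close> over all nonzero zeros \<open>z\<close>,
  repeated according to multiplicity, converges; it is \<open>\<infinity>\<close> if there is no such \<open>s\<close>.\<close>

definition zeros_exponent :: "(complex \<Rightarrow> complex) \<Rightarrow> ereal" where
  "zeros_exponent f =
     Inf {ereal s | s. s > 0 \<and>
       (\<lambda>z. real_of_int (zorder f z) * norm z powr (- s)) summable_on {z. z \<noteq> 0 \<and> f z = 0}}"

definition entire_solution :: "(complex \<Rightarrow> complex) \<Rightarrow> (complex \<Rightarrow> complex) \<Rightarrow> bool" where
  "entire_solution A f \<longleftrightarrow>
     f holomorphic_on UNIV \<and> (\<forall>z. deriv (deriv f) z + A z * f z = 0)"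

definition lin_indep :: "(complex \<Rightarrow> complex) \<Rightarrow> (complex \<Rightarrow> complex) \<Rightarrow> bool" where
  "lin_indep f g \<longleftrightarrow>
     (\<forall>a b. (\<forall>z. a * f z + b * g z = 0) \<longrightarrow> a = 0 \<and> b = 0)"

definition zero_free :: "(complex \<Rightarrow> complex) \<Rightarrow> bool" where
  "zero_free f \<longleftrightarrow> (\<forall>z. f z \<noteq> 0)"

end

theory Submission
  imports Defs "HOL-Real_Asymp.Real_Asymp"
begin

text \<open>Put \<open>w = f'/f\<close>, \<open>\<tau> = T'/T\<close> and \<open>U = w + \<tau>/4\<close>. The Riccati equation \<open>w' + w\<^sup>2 + A = 0\<close> becomes
  \<open>Y := U' - \<tau> U/2 = - (U\<^sup>2 + T + C)\<close> with \<open>C = B + \<tau>\<^sup>2/16 - \<tau>'/4\<close>, and differentiating once more gives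
  \<open>Y (2 U - \<tau> + Y'/Y) = \<tau> C - C'\<close>. Where \<open>T\<close> is large, \<open>U\<close> is comparable to the square root of \<open>T\<close>, so up to
  logarithmic derivatives \<open>Y\<close> is as small as \<open>B\<close> over the square root of \<open>T\<close>, which tends to zero because
  \<open>s(\<theta>) < 1/2\<close>; elsewhere \<open>Y\<close> is not much larger than \<open>A\<close>. After clearing the few poles of \<open>Y\<close>, an
  entire function of order \<open>n\<close> remains that is at most \<open>exp (\<epsilon> r^n)\<close> on large circles and at most
  \<open>exp (- \<delta> r^n)\<close> in a sector, hence \<open>Y = 0\<close>. Then \<open>C\<close> is a multiple of \<open>T\<close>, by growth \<open>C = 0\<close>, and
  \<open>U\<^sup>2 = - T\<close>. Comparing residues of \<open>U = f'/f + T'/(4 T)\<close> shows that neither \<open>f\<close> nor \<open>T\<close> has a zero, and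
  \<open>1/(f U)\<close> is a second solution.\<close>

subsection \<open>Growth\<close>

text \<open>The shift by \<tau>/4 is the WKB correction: where \<open>T\<close> dominates, a
  solution should resemble T^(-1/4) times the exponential of a primitive of a square root of -T, so
  that w + \<tau>/4 is nearly that root, and \<open>Y\<close> measures the deviation. The obstacle
  is that \<open>f\<close> may have infinite order, so the logarithmic derivatives of
  \<open>f\<close>, \<open>f'\<close> and \<open>Y\<close> have no useful bounds of their own; only
  the zeros of \<open>f\<close> are known to be sparse. On each large disc \<open>f\<close> is
  therefore multiplied by a zero-free function \<open>u\<close> that removes its wild part. The
  logarithmic derivatives of \<open>f * u\<close> and \<open>f' * u\<close> are tame, and the
  unknown u'/u cancels in w'/w = f''/f' - f'/f. It also cancels in Y'/Y, because (f H)^2 Y is a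
  quadratic form in \<open>f\<close> and \<open>f'\<close>. No other logarithmic derivatives of
  these functions are used. Two further defects are repaired along the way. The bounds on
  \<open>B\<close> hold only ray by ray, which Phragmen-Lindelof interpolation cures. Logarithmic
  derivatives blow up at zeros, so every interval from R to 2R must supply one radius that is good
  for all functions at once.\<close>

lemma cmod_le_max_modulus:
  assumes "F holomorphic_on UNIV"
  shows "cmod (F z) \<le> max_modulus F (cmod z)"
proof -
  have "continuous_on (sphere 0 (cmod z)) (\<lambda>z. cmod (F z))"
    using assms by (intro continuous_intros holomorphic_on_imp_continuous_on)
      (auto intro: holomorphic_on_subset)
  then have "compact ((\<lambda>z. cmod (F z)) ` sphere 0 (cmod z))"
    by (intro compact_continuous_image) auto
  then have "bdd_above ((\<lambda>z. cmod (F z)) ` sphere 0 (cmod z))"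
    by (intro bounded_imp_bdd_above compact_imp_bounded)
  then show ?thesis
    unfolding max_modulus_def by (intro cSUP_upper) auto
qed

lemma entire_bounded_cball:
  assumes "F holomorphic_on UNIV"
  shows "\<exists>C. \<forall>z. cmod (z - a) \<le> r \<longrightarrow> cmod (F z) \<le> C"
proof -
  have "bounded (F ` cball a r)"
    using assms by (intro compact_imp_bounded compact_continuous_image holomorphic_on_imp_continuous_on)
      (auto intro: holomorphic_on_subset)
  then obtain C where "\<forall>z\<in>cball a r. cmod (F z) \<le> C" by (auto simp: bounded_iff)
  then have "\<forall>z. cmod (z - a) \<le> r \<longrightarrow> cmod (F z) \<le> C" by (simp add: dist_norm norm_minus_commute)
  then show ?thesis by blast
qed

lemma growth_order_less_imp:
  assumes hol: "F holomorphic_on UNIV" and ord: "growth_order F < ereal a"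
  shows "\<exists>r0. \<forall>z. cmod z \<ge> r0 \<longrightarrow> cmod (F z) \<le> exp (cmod z powr a)"
proof -
  have "\<forall>\<^sub>F r in at_top. ereal (log_plus (log_plus (max_modulus F r)) / ln r) < ereal a"
    using ord unfolding growth_order_def by (rule Limsup_lessD)
  then obtain r0 where r0: "\<And>r. r \<ge> r0 \<Longrightarrow> log_plus (log_plus (max_modulus F r)) / ln r < a"
    by (auto simp: eventually_at_top_linorder)
  have "cmod (F z) \<le> exp (cmod z powr a)" if z: "cmod z \<ge> max r0 2" for z
  proof -
    define r where "r = cmod z"
    have r: "r \<ge> r0" "r \<ge> 2" using z by (auto simp: r_def)
    have "ln r > 0" using r by simp
    then have "ln (max 1 (log_plus (max_modulus F r))) < a * ln r"
      using r0[OF r(1)] by (simp add: log_plus_def field_simps)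
    then have "max 1 (log_plus (max_modulus F r)) < exp (a * ln r)"
      by (metis exp_less_mono exp_ln less_max_iff_disj zero_less_one)
    then have "ln (max 1 (max_modulus F r)) < r powr a"
      using r by (simp add: powr_def log_plus_def)
    then have "max 1 (max_modulus F r) < exp (r powr a)"
      by (metis exp_less_mono exp_ln less_max_iff_disj zero_less_one)
    then show ?thesis
      using cmod_le_max_modulus[OF hol, of z] by (simp add: r_def)
  qed
  then show ?thesis by blast
qed

lemma powr_less_power:
  assumes "\<beta> < real n" "\<epsilon> > 0"
  shows "\<forall>\<^sub>F r in at_top. r powr \<beta> \<le> \<epsilon> * r ^ n"
proof -
  have "((\<lambda>r. r powr (\<beta> - real n)) \<longlongrightarrow> 0) at_top"
    using assms by (intro tendsto_neg_powr filterlim_ident) auto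
  then have "\<forall>\<^sub>F r in at_top. r powr (\<beta> - real n) < \<epsilon>" using assms by (intro order_tendstoD)
  then show ?thesis using eventually_gt_at_top[of 0]
  proof eventually_elim
    case (elim r)
    then have "r powr \<beta> / r ^ n < \<epsilon>" by (simp add: powr_diff powr_realpow)
    then show ?case using elim by (simp add: divide_simps split: if_splits)
  qed
qed

lemma const_le_power:
  fixes c \<epsilon> :: real
  assumes "n > 0" "\<epsilon> > 0"
  shows "\<forall>\<^sub>F r in at_top. c \<le> \<epsilon> * r ^ n"
proof -
  have "filterlim (\<lambda>r::real. \<epsilon> * r ^ n) at_top at_top"
    using assms by (intro filterlim_tendsto_pos_mult_at_top[OF tendsto_const] filterlim_pow_at_top filterlim_ident) auto
  then show ?thesis unfolding filterlim_at_top by blast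
qed

text \<open>Growth \<open>exp (\<bar>\<xi>\<bar>^O(1))\<close>; the number \<open>2\<close> makes the class visibly closed under sums and products,
  because \<open>2 * x ^ N \<le> x ^ Suc N\<close> for \<open>x \<ge> 2\<close>.\<close>

definition exp_poly_bounded :: "('a \<Rightarrow> real) \<Rightarrow> 'a set \<Rightarrow> ('a \<Rightarrow> 'b :: real_normed_algebra_1) \<Rightarrow> bool" where
  "exp_poly_bounded \<xi> S g \<longleftrightarrow> (\<exists>N. \<forall>x\<in>S. norm (g x) \<le> exp ((2 + \<bar>\<xi> x\<bar>) ^ N))"

abbreviation fin_growth :: "(complex \<Rightarrow> complex) \<Rightarrow> bool" where
  "fin_growth \<equiv> exp_poly_bounded cmod UNIV"

lemma fin_growth_def: "fin_growth F \<longleftrightarrow> (\<exists>N. \<forall>z. cmod (F z) \<le> exp ((2 + cmod z) ^ N))"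
  by (simp add: exp_poly_bounded_def)

lemma less_exp: "x < exp x" for x :: real
  using exp_ge_add_one_self[of x] by linarith

lemma exp_power_add_le:
  fixes x a b :: real
  assumes "x \<ge> 2" "a \<le> exp (x ^ M)" "b \<le> exp (x ^ N)"
  shows "a + b \<le> exp (x ^ Suc (max M N))"
proof -
  have "a \<le> exp (x ^ max M N)" "b \<le> exp (x ^ max M N)"
    using assms by (auto intro!: order.trans[OF assms(2)] order.trans[OF assms(3)] power_increasing)
  then have "a + b \<le> 2 * exp (x ^ max M N)" by simp
  also have "\<dots> \<le> exp 1 * exp (x ^ max M N)"
    using exp_ge_add_one_self[of 1] by (intro mult_right_mono) auto
  also have "\<dots> = exp (1 + x ^ max M N)" by (simp add: exp_add)
  also have "1 + x ^ max M N \<le> x * x ^ max M N"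
  proof -
    have "1 \<le> x ^ max M N" using assms by (intro one_le_power) auto
    moreover have "2 * x ^ max M N \<le> x * x ^ max M N"
      using assms by (intro mult_right_mono) auto
    ultimately show ?thesis by linarith
  qed
  finally show ?thesis by simp
qed

lemma exp_power_mult_le:
  fixes x a b :: real
  assumes "x \<ge> 2" "a \<le> exp (x ^ M)" "b \<le> exp (x ^ N)" "0 \<le> a" "0 \<le> b"
  shows "a * b \<le> exp (x ^ Suc (max M N))"
proof -
  have "a \<le> exp (x ^ max M N)" "b \<le> exp (x ^ max M N)"
    using assms by (auto intro!: order.trans[OF assms(2)] order.trans[OF assms(3)] power_increasing)
  then have "a * b \<le> exp (x ^ max M N) * exp (x ^ max M N)"
    using assms by (intro mult_mono) auto
  also have "\<dots> = exp (2 * x ^ max M N)" by (simp flip: exp_add)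
  also have "\<dots> \<le> exp (x * x ^ max M N)" using assms by (auto intro!: mult_right_mono)
  finally show ?thesis by simp
qed

lemma exp_poly_bounded_add:
  assumes "exp_poly_bounded \<xi> S f" "exp_poly_bounded \<xi> S g"
  shows "exp_poly_bounded \<xi> S (\<lambda>x. f x + g x)"
proof -
  obtain M N where MN: "\<forall>x\<in>S. norm (f x) \<le> exp ((2 + \<bar>\<xi> x\<bar>) ^ M)" "\<forall>x\<in>S. norm (g x) \<le> exp ((2 + \<bar>\<xi> x\<bar>) ^ N)"
    using assms unfolding exp_poly_bounded_def by blast
  have "norm (f x + g x) \<le> exp ((2 + \<bar>\<xi> x\<bar>) ^ Suc (max M N))" if "x \<in> S" for x
    using MN that by (intro order_trans[OF norm_triangle_ineq] exp_power_add_le) auto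
  then show ?thesis unfolding exp_poly_bounded_def by blast
qed

lemma exp_poly_bounded_mult:
  assumes "exp_poly_bounded \<xi> S f" "exp_poly_bounded \<xi> S g"
  shows "exp_poly_bounded \<xi> S (\<lambda>x. f x * g x)"
proof -
  obtain M N where MN: "\<forall>x\<in>S. norm (f x) \<le> exp ((2 + \<bar>\<xi> x\<bar>) ^ M)" "\<forall>x\<in>S. norm (g x) \<le> exp ((2 + \<bar>\<xi> x\<bar>) ^ N)"
    using assms unfolding exp_poly_bounded_def by blast
  have "norm (f x * g x) \<le> exp ((2 + \<bar>\<xi> x\<bar>) ^ Suc (max M N))" if "x \<in> S" for x
    using MN that by (intro order_trans[OF norm_mult_ineq] exp_power_mult_le) auto
  then show ?thesis unfolding exp_poly_bounded_def by blast
qed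

lemma exp_poly_bounded_const: "exp_poly_bounded \<xi> S (\<lambda>x. c)"
proof -
  obtain p where p: "norm c < 2 ^ p" using real_arch_pow[of 2 "norm c"] by auto
  have "norm c \<le> exp ((2 + \<bar>\<xi> x\<bar>) ^ p)" for x
    using p power_mono[of 2 "2 + \<bar>\<xi> x\<bar>" p] less_exp[of "(2 + \<bar>\<xi> x\<bar>) ^ p"] by linarith
  then show ?thesis unfolding exp_poly_bounded_def by blast
qed

lemma exp_poly_bounded_diff:
  assumes "exp_poly_bounded \<xi> S f" "exp_poly_bounded \<xi> S g"
  shows "exp_poly_bounded \<xi> S (\<lambda>x. f x - g x)"
  using exp_poly_bounded_add[OF assms(1) exp_poly_bounded_mult[OF exp_poly_bounded_const assms(2), of "- 1"]] by simp

lemma exp_poly_bounded_power: "exp_poly_bounded \<xi> S f \<Longrightarrow> exp_poly_bounded \<xi> S (\<lambda>x. f x ^ k)"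
  by (induction k) (auto intro: exp_poly_bounded_mult exp_poly_bounded_const)

lemmas exp_poly_bounded_intros = exp_poly_bounded_diff exp_poly_bounded_add exp_poly_bounded_mult
  exp_poly_bounded_power exp_poly_bounded_const

text \<open>All constants go into the exponent: \<open>2 ^ p\<close> exceeds \<open>K\<close> and
  the bound on the disc of radius \<open>r\<close>, and 2 + |z| is at least 2.\<close>

lemma fin_growthI:
  assumes hol: "F holomorphic_on UNIV"
    and bd: "\<And>z. cmod z \<ge> r \<Longrightarrow> cmod (F z) \<le> exp (K * (1 + cmod z) ^ N)"
  shows "fin_growth F"
proof -
  obtain C where C: "\<And>z. cmod z \<le> r \<Longrightarrow> cmod (F z) \<le> C"
    using entire_bounded_cball[OF hol, of 0 r] by auto
  obtain p where p: "max (max K C) 0 < 2 ^ p"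
    using real_arch_pow[of 2 "max (max K C) 0"] by auto
  have "cmod (F z) \<le> exp ((2 + cmod z) ^ (p + N))" for z
  proof -
    have 1: "2 ^ p \<le> (2 + cmod z) ^ p" by (intro power_mono) auto
    have 2: "1 \<le> (2 + cmod z) ^ N" by (intro one_le_power) (use norm_ge_zero[of z] in linarith)
    show ?thesis
    proof (cases "cmod z \<ge> r")
      case True
      have "K * (1 + cmod z) ^ N \<le> (2 + cmod z) ^ p * (2 + cmod z) ^ N"
        using p 1 by (intro mult_mono power_mono) auto
      then show ?thesis using bd[OF True] by (simp add: power_add) (meson exp_le_cancel_iff order_trans)
    next
      case False
      have "C \<le> (2 + cmod z) ^ p * 1" using p 1 by simp
      also have "\<dots> \<le> (2 + cmod z) ^ p * (2 + cmod z) ^ N"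
        using 2 by (intro mult_left_mono) auto
      also have "\<dots> \<le> exp ((2 + cmod z) ^ (p + N))"
        using less_exp[of "(2 + cmod z) ^ (p + N)"] by (simp add: power_add)
      finally show ?thesis using C[of z] False by simp
    qed
  qed
  then show ?thesis unfolding fin_growth_def by blast
qed

lemma cmod_exp_le: "cmod (exp z) \<le> exp (cmod z)"
  by (simp add: abs_Re_le_cmod complex_Re_le_cmod)

lemma fin_growth_ident: "fin_growth (\<lambda>z. z)"
proof (rule fin_growthI[where K = 1 and N = 1 and r = 0])
  show "cmod z \<le> exp (1 * (1 + cmod z) ^ 1)" for z
    using exp_ge_add_one_self[of "1 + cmod z"] by simp
qed auto

lemma fin_growth_exp_power: "fin_growth (\<lambda>z. exp (c * z ^ k))"
proof (rule fin_growthI[where K = "cmod c" and N = k and r = 0])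
  show "cmod (exp (c * z ^ k)) \<le> exp (cmod c * (1 + cmod z) ^ k)" for z
  proof -
    have "cmod (c * z ^ k) \<le> cmod c * (1 + cmod z) ^ k"
      by (auto simp: norm_mult norm_power intro!: mult_left_mono power_mono)
    then show ?thesis using cmod_exp_le[of "c * z ^ k"] by (meson exp_le_cancel_iff order_trans)
  qed
qed (intro holomorphic_intros)

lemma cmod_deriv_le:
  assumes "F holomorphic_on cball z 1" "\<And>w. cmod (w - z) \<le> 1 \<Longrightarrow> cmod (F w) \<le> C"
  shows "cmod (deriv F z) \<le> C"
proof -
  have "cmod ((deriv ^^ 1) F z) \<le> fact 1 * C / 1 ^ 1"
    using assms
    by (intro Cauchy_inequality holomorphic_on_imp_continuous_on)
      (auto simp: norm_minus_commute intro: holomorphic_on_subset)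
  then show ?thesis by simp
qed

text \<open>Cauchy's estimate on unit discs. Moving to a neighbour turns 2 + |z| into 3 + |z|, which
  is at most (2 + |z|)^2; hence the doubled exponent.\<close>

lemma fin_growth_deriv:
  assumes hol: "F holomorphic_on UNIV" and "fin_growth F"
  shows "fin_growth (deriv F)"
proof -
  obtain N where N: "\<And>z. cmod (F z) \<le> exp ((2 + cmod z) ^ N)"
    using assms unfolding fin_growth_def by blast
  have "cmod (deriv F z) \<le> exp ((2 + cmod z) ^ (2 * N))" for z
  proof (rule cmod_deriv_le)
    fix w assume "cmod (w - z) \<le> 1"
    then have "cmod w \<le> 1 + cmod z" using norm_triangle_ineq2[of w z] by linarith
    then have "(2 + cmod w) ^ N \<le> (3 + cmod z) ^ N" by (intro power_mono) auto
    also have "\<dots> \<le> ((2 + cmod z) ^ 2) ^ N"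
      by (intro power_mono) (auto simp: power2_eq_square algebra_simps add_nonneg_nonneg)
    finally show "cmod (F w) \<le> exp ((2 + cmod z) ^ (2 * N))"
      using N[of w] by (simp add: power_mult) (meson exp_le_cancel_iff order_trans)
  qed (use hol in \<open>auto intro: holomorphic_on_subset\<close>)
  then show ?thesis unfolding fin_growth_def by blast
qed

lemma fin_growth_growth_order:
  assumes hol: "F holomorphic_on UNIV" and ord: "growth_order F < \<infinity>"
  shows "fin_growth F"
proof -
  obtain k :: nat where k: "growth_order F < ereal (real k)"
    using ord less_PInf_Ex_of_nat[of "growth_order F"] by auto
  obtain r0 where r0: "\<And>z. cmod z \<ge> r0 \<Longrightarrow> cmod (F z) \<le> exp (cmod z powr real k)"
    using growth_order_less_imp[OF hol k] by blast
  show ?thesis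
  proof (rule fin_growthI[OF hol, where K = 1 and N = k and r = "max r0 1"])
    fix z assume z: "max r0 1 \<le> cmod z"
    then have "cmod z powr real k \<le> 1 * (1 + cmod z) ^ k" by (subst powr_realpow) (auto intro!: power_mono)
    then show "cmod (F z) \<le> exp (1 * (1 + cmod z) ^ k)"
      using r0[of z] z by (meson exp_le_cancel_iff max.boundedE order_trans)
  qed
qed

lemma cis_scaled_power: "(of_real \<rho> * cis t) ^ n = of_real (\<rho> ^ n) * cis (real n * t)"
  using Complex.DeMoivre[of t n] by (simp add: power_mult_distrib)

subsection \<open>A Phragmen-Lindelof principle\<close>

text \<open>The maximum principle needs a sector that is visibly closed with a visible interior,
  hence its description by a linear inequality. This is the way back to polar coordinates, with
  equality exactly on the two boundary rays.\<close>

lemma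
  assumes "0 < \<eta>" "\<eta> < pi / 2" "\<bar>Im u\<bar> \<le> tan \<eta> * Re u"
  shows cone_polar1: "\<exists>t. \<bar>t\<bar> \<le> \<eta> \<and> u = of_real (cmod u) * cis t" (is ?A)
    and cone_polar2: "\<bar>Im u\<bar> = tan \<eta> * Re u \<Longrightarrow> \<exists>t\<in>{-\<eta>,\<eta>}. u = of_real (cmod u) * cis t"
proof -
  have tan: "tan \<eta> > 0" using assms by (intro tan_gt_zero)
  have "Re u \<ge> 0" using assms(3) tan abs_ge_zero[of "Im u"]
    by (metis dual_order.trans zero_le_mult_iff not_less)
  have main: "\<exists>t. \<bar>t\<bar> \<le> \<eta> \<and> (\<bar>Im u\<bar> = tan \<eta> * Re u \<longrightarrow> t \<in> {-\<eta>, \<eta>}) \<and> u = of_real (cmod u) * cis t"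
  proof (cases "Re u = 0")
    case True
    then have "u = 0" using assms(3) by (auto simp: complex_eq_iff)
    then show ?thesis using assms by (intro exI[of _ \<eta>]) auto
  next
    case False
    then have Re: "Re u > 0" using \<open>Re u \<ge> 0\<close> by simp
    have "- tan \<eta> \<le> Im u / Re u" "Im u / Re u \<le> tan \<eta>"
      using assms(3) Re by (auto simp: field_simps abs_le_iff)
    then have 1: "- \<eta> \<le> arctan (Im u / Re u)" "arctan (Im u / Re u) \<le> \<eta>"
      using arctan_tan[of \<eta>] assms arctan_monotone'[of "- tan \<eta>" "Im u / Re u"]
        arctan_monotone'[of "Im u / Re u" "tan \<eta>"]
      by (auto simp: arctan_minus)
    have 2: "arctan (Im u / Re u) \<in> {-\<eta>,\<eta>}" if "\<bar>Im u\<bar> = tan \<eta> * Re u"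
    proof -
      have "Im u / Re u = tan \<eta> \<or> Im u / Re u = - tan \<eta>"
        using that Re by (auto simp: abs_if field_simps split: if_splits)
      then show ?thesis using arctan_tan[of \<eta>] assms by (auto simp: arctan_minus)
    qed
    have "u = of_real (cmod u) * cis (arctan (Im u / Re u))"
      using arg_conv_arctan[OF Re] rcis_cmod_Arg[of u] by (simp add: rcis_def)
    then show ?thesis using 1 2 by (intro exI[of _ "arctan (Im u / Re u)"]) auto
  qed
  then show ?A by blast
  show "\<bar>Im u\<bar> = tan \<eta> * Re u \<Longrightarrow> \<exists>t\<in>{-\<eta>,\<eta>}. u = of_real (cmod u) * cis t"
    using main by blast
qed

text \<open>The factor exp (- \<epsilon> u^(N+1)) beats any growth of order \<open>N\<close> in the
  cone: the aperture condition keeps the argument of u^(N+1) below a right angle, so its real part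
  is at least c |u|^(N+1) with c > 0. Then \<epsilon> tends to 0.\<close>

lemma phragmen_lindelof_cone:
  assumes hol: "F holomorphic_on UNIV" and N: "\<And>z. cmod (F z) \<le> exp (K * (1 + cmod z) ^ N)"
    and eta: "0 < \<eta>" "real (Suc N) * \<eta> < pi / 2"
    and Mpos: "M > 0"
    and M: "\<And>\<rho>. \<rho> \<ge> 0 \<Longrightarrow> cmod (F (of_real \<rho> * cis \<eta>)) \<le> M"
           "\<And>\<rho>. \<rho> \<ge> 0 \<Longrightarrow> cmod (F (of_real \<rho> * cis (- \<eta>))) \<le> M"
    and t: "\<bar>t\<bar> \<le> \<eta>" and rho: "\<rho> \<ge> 0"
  shows "cmod (F (of_real \<rho> * cis t)) \<le> M"
proof -
  define u0 where "u0 = of_real \<rho> * cis t"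
  define c where "c = cos (real (Suc N) * \<eta>)"
  have c: "c > 0"
  proof -
    have "0 < real (Suc N) * \<eta>" using eta by simp
    then show ?thesis unfolding c_def using eta(2) by (intro cos_gt_zero_pi) linarith+
  qed
  have "\<eta> * 1 \<le> \<eta> * real (Suc N)" using eta by (intro mult_left_mono) auto
  then have eta2: "\<eta> < pi / 2" using eta by (metis le_less_trans mult.commute mult.right_neutral)
  have tan: "tan \<eta> > 0" using eta eta2 by (intro tan_gt_zero)
  have Re_ge: "Re (u ^ Suc N) \<ge> c * cmod u ^ Suc N" if ucone: "\<bar>Im u\<bar> \<le> tan \<eta> * Re u" for u
  proof -
    obtain s where s: "\<bar>s\<bar> \<le> \<eta>" "u = of_real (cmod u) * cis s"
      using cone_polar1[OF eta(1) eta2 ucone] by auto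
    have "real (Suc N) * \<bar>s\<bar> \<le> real (Suc N) * \<eta>" using s by (intro mult_left_mono) auto
    then have 1: "\<bar>real (Suc N) * s\<bar> \<le> real (Suc N) * \<eta>" by (simp only: abs_mult abs_of_nat)
    have 2: "real (Suc N) * \<eta> \<le> pi" using eta(2) pi_gt_zero by linarith
    have "cos (real (Suc N) * \<eta>) \<le> cos \<bar>real (Suc N) * s\<bar>"
      using 1 2 by (intro cos_monotone_0_pi_le) simp_all
    then have "c \<le> cos (real (Suc N) * s)" by (simp add: c_def)
    moreover have "u ^ Suc N = of_real (cmod u ^ Suc N) * cis (real (Suc N) * s)"
      using cis_scaled_power[of "cmod u" s "Suc N"] s(2) by metis
    then have "Re (u ^ Suc N) = cmod u ^ Suc N * cos (real (Suc N) * s)" by simp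
    ultimately show ?thesis
      using mult_right_mono[of c "cos (real (Suc N) * s)" "cmod u ^ Suc N"] by (simp only: mult.commute norm_ge_zero zero_le_power)
  qed
  have key: "cmod (F u0) * exp (- \<epsilon> * Re (u0 ^ Suc N)) \<le> M" if eps: "\<epsilon> > 0" for \<epsilon>
  proof -
    define Fe where "Fe = (\<lambda>u. F u * exp (- of_real \<epsilon> * u ^ Suc N))"
    have Fe: "cmod (Fe u) = cmod (F u) * exp (- \<epsilon> * Re (u ^ Suc N))" for u
      unfolding Fe_def by (simp add: norm_mult)
    have ev: "\<forall>\<^sub>F R in at_top. exp (K * (1 + R) ^ N) * exp (- \<epsilon> * (c * R ^ Suc N)) \<le> M"
    proof -
      have "((\<lambda>R::real. K * (1 / R + 1) ^ N * (1 / R)) \<longlongrightarrow> K * (0 + 1) ^ N * 0) at_top"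
        by (intro tendsto_intros tendsto_divide_0[OF tendsto_const] filterlim_at_top_imp_at_infinity filterlim_ident)
      then have "((\<lambda>R::real. K * (1 / R + 1) ^ N * (1 / R)) \<longlongrightarrow> 0) at_top" by simp
      then have 1: "\<forall>\<^sub>F R::real in at_top. K * (1 / R + 1) ^ N * (1 / R) < \<epsilon> * c / 2"
        using eps c by (intro order_tendstoD(2)) auto
      have "filterlim (\<lambda>R::real. (\<epsilon> * c / 2) * R) at_top at_top"
        using eps c by (intro filterlim_tendsto_pos_mult_at_top[OF tendsto_const] filterlim_ident) auto
      then have 2: "\<forall>\<^sub>F R in at_top. (\<epsilon> * c / 2) * R \<ge> - ln M" unfolding filterlim_at_top by blast
      show ?thesis using 1 2 eventually_gt_at_top[of 1]
      proof eventually_elim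
        case (elim R)
        have "1 / R + 1 = (1 + R) / R" using elim by (simp add: field_simps)
        then have "K * (1 + R) ^ N / R ^ Suc N < \<epsilon> * c / 2"
          using elim by (simp add: power_divide mult_ac)
        then have "K * (1 + R) ^ N \<le> \<epsilon> * c / 2 * R ^ Suc N"
          using elim by (simp add: divide_simps split: if_splits)
        moreover have "(\<epsilon> * c / 2) * R \<le> \<epsilon> * c / 2 * R ^ Suc N"
          using elim eps c self_le_power[of R "Suc N"] by (intro mult_left_mono) auto
        moreover have "- \<epsilon> * (c * R ^ Suc N) = - 2 * (\<epsilon> * c / 2 * R ^ Suc N)" by simp
        ultimately have "K * (1 + R) ^ N + (- \<epsilon> * (c * R ^ Suc N)) \<le> ln M" using elim(2) by linarith
        then have "exp (K * (1 + R) ^ N + (- \<epsilon> * (c * R ^ Suc N))) \<le> exp (ln M)"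
          by (simp only: exp_le_cancel_iff)
        then show ?case using Mpos by (simp only: exp_add exp_ln)
      qed
    qed
    obtain R where R: "R > \<rho>" "exp (K * (1 + R) ^ N) * exp (- \<epsilon> * (c * R ^ Suc N)) \<le> M"
      using eventually_happens[OF eventually_conj[OF ev eventually_gt_at_top[of \<rho>]]] by auto
    \<comment> \<open>A frontier point of this truncated cone lies on the arc, where the choice of
      \<open>R\<close> gives the bound \<open>M\<close>, or on one of the two rays, where
      \<open>M\<close> is assumed.\<close>
    define S where "S = {u. cmod u \<le> R \<and> \<bar>Im u\<bar> \<le> tan \<eta> * Re u}"
    have "closed S" unfolding S_def by (intro closed_Collect_conj closed_Collect_le continuous_intros)
    have "bounded S" by (rule bounded_subset[of "cball 0 R"]) (auto simp: S_def)
    have int: "{u. cmod u < R \<and> \<bar>Im u\<bar> < tan \<eta> * Re u} \<subseteq> interior S"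
      by (rule interior_maximal) (auto simp: S_def intro!: open_Collect_conj open_Collect_less continuous_intros)
    have holFe: "Fe holomorphic_on X" for X
      unfolding Fe_def by (intro holomorphic_intros holomorphic_on_subset[OF hol]) auto
    have "cmod (Fe u0) \<le> M"
    proof (rule maximum_modulus_frontier[where S = S and f = Fe and \<xi> = u0 and B = M])
      show "Fe holomorphic_on interior S" "continuous_on (closure S) Fe"
        using holFe holomorphic_on_imp_continuous_on by blast+
      fix u assume "u \<in> frontier S"
      then have uS: "u \<in> S" and "u \<notin> interior S"
        using \<open>closed S\<close> by (auto simp: frontier_def)
      then consider "cmod u = R" | "\<bar>Im u\<bar> = tan \<eta> * Re u"
        using int by (force simp: S_def)
      then show "cmod (Fe u) \<le> M"
      proof cases
        case 1
        have "cmod (Fe u) \<le> exp (K * (1 + R) ^ N) * exp (- \<epsilon> * (c * R ^ Suc N))"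
          using N[of u] Re_ge[of u] uS 1 eps unfolding Fe S_def by (intro mult_mono) auto
        then show ?thesis using R by simp
      next
        case 2
        have "Re (u ^ Suc N) \<ge> 0"
        proof -
          have "0 \<le> c * cmod u ^ Suc N" using c by (intro mult_nonneg_nonneg) auto
          also have "\<dots> \<le> Re (u ^ Suc N)" using uS by (intro Re_ge) (auto simp: S_def)
          finally show ?thesis .
        qed
        then have "exp (- \<epsilon> * Re (u ^ Suc N)) \<le> 1"
          using eps mult_nonneg_nonneg[of \<epsilon> "Re (u ^ Suc N)"] by (simp del: power_Suc)
        moreover have "cmod (F u) \<le> M"
          using cone_polar2[OF eta(1) eta2 _ 2] 2 M[of "cmod u"] by (metis insertE norm_ge_zero order_refl singletonD)
        ultimately show ?thesis unfolding Fe using mult_mono[of "cmod (F u)" M _ 1] Mpos by simp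
      qed
    next
      have "\<bar>sin t\<bar> \<le> tan \<eta> * cos t"
      proof -
        have cos: "cos t > 0" "cos \<eta> > 0" using t eta eta2 by (auto intro!: cos_gt_zero_pi)
        have "sin (\<eta> - t) \<ge> 0" "sin (\<eta> + t) \<ge> 0" using t eta2 by (auto intro!: sin_ge_zero)
        then have "sin t * cos \<eta> \<le> sin \<eta> * cos t" "- sin t * cos \<eta> \<le> sin \<eta> * cos t"
          by (auto simp: sin_diff sin_add mult.commute)
        then show ?thesis using cos by (simp add: tan_def field_simps abs_le_iff)
      qed
      then have "\<rho> * \<bar>sin t\<bar> \<le> \<rho> * (tan \<eta> * cos t)" using rho by (rule mult_left_mono)
      then show "u0 \<in> S" using R rho by (auto simp: S_def u0_def norm_mult abs_mult mult_ac)
    qed fact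
    then show ?thesis by (simp add: Fe)
  qed
  \<comment> \<open>The truncation radius depended on \<epsilon>, but \<open>key\<close> no longer
    mentions it; at the fixed point \<open>u0\<close> the limit can be taken.\<close>
  have "((\<lambda>\<epsilon>. cmod (F u0) * exp (- \<epsilon> * Re (u0 ^ Suc N))) \<longlongrightarrow> cmod (F u0) * exp (- 0 * Re (u0 ^ Suc N))) (at_right 0)"
    by (intro tendsto_intros)
  then have "((\<lambda>\<epsilon>. cmod (F u0) * exp (- \<epsilon> * Re (u0 ^ Suc N))) \<longlongrightarrow> cmod (F u0)) (at_right 0)" by simp
  then have "cmod (F u0) \<le> M"
    by (rule tendsto_upperbound) (use key in \<open>auto simp: eventually_at_right_less eventually_at_filter\<close>)
  then show ?thesis by (simp add: u0_def)
qed

lemma holomorphic_bounded_on_ray: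
  assumes hol: "F holomorphic_on UNIV" and ev: "\<forall>\<^sub>F r in at_top. cmod (F (of_real r * cis \<theta>)) \<le> C"
  shows "\<exists>M>0. \<forall>\<rho>\<ge>0. cmod (F (of_real \<rho> * cis \<theta>)) \<le> M"
proof -
  obtain r where r: "\<And>\<rho>. \<rho> \<ge> r \<Longrightarrow> cmod (F (of_real \<rho> * cis \<theta>)) \<le> C"
    using ev by (auto simp: eventually_at_top_linorder)
  have "continuous_on {0..r} (\<lambda>\<rho>. F (of_real \<rho> * cis \<theta>))"
    by (rule continuous_on_compose2[OF holomorphic_on_imp_continuous_on[OF hol]])
      (auto intro!: continuous_intros)
  then have "compact ((\<lambda>\<rho>. cmod (F (of_real \<rho> * cis \<theta>))) ` {0..r})"
    by (intro compact_continuous_image continuous_on_norm) auto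
  then have "bdd_above ((\<lambda>\<rho>. cmod (F (of_real \<rho> * cis \<theta>))) ` {0..r})"
    by (intro bounded_imp_bdd_above compact_imp_bounded)
  then obtain D where D: "\<forall>\<rho>\<in>{0..r}. cmod (F (of_real \<rho> * cis \<theta>)) \<le> D"
    unfolding bdd_above_def by auto
  have "cmod (F (of_real \<rho> * cis \<theta>)) \<le> max 1 (max C D)" if "\<rho> \<ge> 0" for \<rho>
    using r[of \<rho>] D that by (cases "\<rho> \<ge> r") (auto simp: le_max_iff_disj)
  then show ?thesis by (intro exI[of _ "max 1 (max C D)"]) auto
qed

lemma mult_exp_minus_le_iff: "a * exp (- x) \<le> M \<longleftrightarrow> a \<le> M * exp x" for a x M :: real
  by (simp add: exp_minus field_simps)

text \<open>The majorant exp (Re (c z^n)) is the modulus of a zero-free entire function, so dividing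
  by that function and rotating the bisector to the positive axis leaves a function bounded on both
  rays of a cone. Its growth exponent is max N n, which dictates the aperture.\<close>

lemma phragmen_lindelof_sector:
  assumes hol: "B holomorphic_on UNIV" and N: "\<And>z. cmod (B z) \<le> exp ((2 + cmod z) ^ N)"
    and eta: "0 < \<eta>" "real (Suc (max N n)) * \<eta> < pi / 2"
    and ev: "\<forall>\<^sub>F r in at_top. cmod (B (of_real r * cis (\<phi> + \<eta>))) \<le> exp (Re (c * (of_real r * cis (\<phi> + \<eta>)) ^ n))"
       "\<forall>\<^sub>F r in at_top. cmod (B (of_real r * cis (\<phi> - \<eta>))) \<le> exp (Re (c * (of_real r * cis (\<phi> - \<eta>)) ^ n))"
  shows "\<exists>M>0. \<forall>\<rho>\<ge>0. \<forall>t. \<bar>t - \<phi>\<bar> \<le> \<eta> \<longrightarrow>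
           cmod (B (of_real \<rho> * cis t)) \<le> M * exp (Re (c * (of_real \<rho> * cis t) ^ n))"
proof -
  define F where "F = (\<lambda>u. B (u * cis \<phi>) * exp (- c * (u * cis \<phi>) ^ n))"
  have holF: "F holomorphic_on UNIV"
    unfolding F_def
    by (intro holomorphic_intros holomorphic_on_compose_gen[OF _ hol, unfolded comp_def]) auto
  have nF: "cmod (F (of_real \<rho> * cis s)) = cmod (B (of_real \<rho> * cis (\<phi> + s))) * exp (- Re (c * (of_real \<rho> * cis (\<phi> + s)) ^ n))" for \<rho> s
    unfolding F_def by (simp add: norm_mult cis_mult mult.assoc add.commute)
  have bdF: "cmod (F u) \<le> exp ((2 ^ N + cmod c) * (1 + cmod u) ^ max N n)" for u
  proof -
    have "(2 + cmod u) ^ N \<le> (2 * (1 + cmod u)) ^ N" by (intro power_mono) auto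
    also have "\<dots> = 2 ^ N * (1 + cmod u) ^ N" by (rule power_mult_distrib)
    also have "\<dots> \<le> 2 ^ N * (1 + cmod u) ^ max N n" by (intro mult_left_mono power_increasing) auto
    finally have 1: "cmod (B (u * cis \<phi>)) \<le> exp (2 ^ N * (1 + cmod u) ^ max N n)"
      using N[of "u * cis \<phi>"] by (simp add: norm_mult) (meson exp_le_cancel_iff order_trans)
    have "cmod (- c * (u * cis \<phi>) ^ n) \<le> cmod c * (1 + cmod u) ^ n"
      by (auto simp: norm_mult norm_power intro!: mult_left_mono power_mono)
    also have "\<dots> \<le> cmod c * (1 + cmod u) ^ max N n" by (intro mult_left_mono power_increasing) auto
    finally have 2: "cmod (exp (- c * (u * cis \<phi>) ^ n)) \<le> exp (cmod c * (1 + cmod u) ^ max N n)"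
      using cmod_exp_le[of "- c * (u * cis \<phi>) ^ n"] by (meson exp_le_cancel_iff order_trans)
    show ?thesis using mult_mono[OF 1 2] by (simp add: F_def norm_mult distrib_right exp_add)
  qed
  have "\<forall>\<^sub>F r in at_top. cmod (F (of_real r * cis \<eta>)) \<le> 1"
    using ev(1) unfolding nF mult_exp_minus_le_iff by simp
  then obtain M1 where M1: "M1 > 0" "\<And>\<rho>. \<rho> \<ge> 0 \<Longrightarrow> cmod (F (of_real \<rho> * cis \<eta>)) \<le> M1"
    using holomorphic_bounded_on_ray[OF holF] by blast
  have "\<forall>\<^sub>F r in at_top. cmod (F (of_real r * cis (-\<eta>))) \<le> 1"
    using ev(2) unfolding nF mult_exp_minus_le_iff by simp
  then obtain M2 where M2: "M2 > 0" "\<And>\<rho>. \<rho> \<ge> 0 \<Longrightarrow> cmod (F (of_real \<rho> * cis (-\<eta>))) \<le> M2"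
    using holomorphic_bounded_on_ray[OF holF] by blast
  have "cmod (B (of_real \<rho> * cis t)) \<le> max M1 M2 * exp (Re (c * (of_real \<rho> * cis t) ^ n))"
    if "\<rho> \<ge> 0" "\<bar>t - \<phi>\<bar> \<le> \<eta>" for \<rho> t
  proof -
    have "cmod (F (of_real \<rho> * cis (t - \<phi>))) \<le> max M1 M2"
    proof (rule phragmen_lindelof_cone[OF holF bdF eta])
      show "cmod (F (of_real \<rho> * cis \<eta>)) \<le> max M1 M2" if "\<rho> \<ge> 0" for \<rho>
        using M1(2)[OF that] by simp
      show "cmod (F (of_real \<rho> * cis (-\<eta>))) \<le> max M1 M2" if "\<rho> \<ge> 0" for \<rho>
        using M2(2)[OF that] by simp
    qed (use M1 that in auto)
    then show ?thesis unfolding nF mult_exp_minus_le_iff by simp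
  qed
  then show ?thesis using M1(1) by (intro exI[of _ "max M1 M2"]) auto
qed

section \<open>Estimates for \<open>B\<close> that are uniform in the direction\<close>

locale ray_bounded =
  fixes n :: nat and \<alpha> :: real and \<zeta> :: complex and B :: "complex \<Rightarrow> complex"
  assumes n: "n > 0" and alpha: "\<alpha> < real n" and zeta: "\<zeta> \<noteq> 0"
    and holB: "B holomorphic_on UNIV" and finB: "fin_growth B"
    and rays: "\<And>\<theta>. \<theta> \<in> {-pi..<pi} \<Longrightarrow>
           \<exists>s<1/2. \<forall>\<^sub>F r in at_top.
             log_plus (norm (B (of_real r * cis \<theta>)))
               \<le> s * max (Re (\<zeta> * cis (real n * \<theta>))) 0 * r ^ n + r powr \<alpha>"
begin

text \<open>The Phragmen-Lindelof indicator of exp (\<zeta> z^n).\<close>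

definition cc :: "real \<Rightarrow> real" where "cc \<theta> = Re (\<zeta> * cis (real n * \<theta>))"

lemma Re_cc: "Re (\<zeta> * (of_real r * cis \<theta>) ^ n) = cc \<theta> * r ^ n"
  unfolding cis_scaled_power cc_def by (simp add: algebra_simps)

text \<open>The boundary rays of the sectors below have angles outside the interval from -\<pi> to
  \<pi>; reduction modulo 2 \<pi> makes the hypothesis available for every real angle.\<close>

lemma rays':
  "\<exists>s<1/2. \<forall>\<^sub>F r in at_top. cmod (B (of_real r * cis \<theta>)) \<le> exp (s * max (cc \<theta>) 0 * r ^ n + r powr \<alpha>)"
proof -
  define k where "k = \<lfloor>(\<theta> + pi) / (2 * pi)\<rfloor>"
  define \<theta>' where "\<theta>' = \<theta> - 2 * pi * of_int k"
  have k: "of_int k \<le> (\<theta> + pi) / (2 * pi)" "(\<theta> + pi) / (2 * pi) < of_int k + 1"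
    unfolding k_def by linarith+
  have "of_int k * (2 * pi) \<le> \<theta> + pi" using k(1) by (simp add: field_simps)
  moreover have "\<theta> + pi < (of_int k + 1) * (2 * pi)" using k(2) by (simp add: field_simps)
  ultimately have in': "\<theta>' \<in> {-pi..<pi}" by (auto simp: \<theta>'_def algebra_simps)
  have cis: "cis \<theta>' = cis \<theta>"
    using cis_multiple_2pi[of "of_int k"] by (simp add: \<theta>'_def flip: cis_divide)
  have cisn: "cis (real n * \<theta>') = cis (real n * \<theta>)" by (simp add: cis flip: Complex.DeMoivre)
  obtain s where s: "s < 1/2" "\<forall>\<^sub>F r in at_top.
             log_plus (norm (B (of_real r * cis \<theta>')))
               \<le> s * max (Re (\<zeta> * cis (real n * \<theta>'))) 0 * r ^ n + r powr \<alpha>"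
    using rays[OF in'] by blast
  have "\<forall>\<^sub>F r in at_top. cmod (B (of_real r * cis \<theta>)) \<le> exp (s * max (cc \<theta>) 0 * r ^ n + r powr \<alpha>)"
    using s(2)
  proof eventually_elim
    case (elim r)
    have "max 1 (cmod (B (of_real r * cis \<theta>))) \<le> exp (s * max (cc \<theta>) 0 * r ^ n + r powr \<alpha>)"
      using elim exp_le_cancel_iff[of "ln (max 1 (cmod (B (of_real r * cis \<theta>))))"]
      unfolding log_plus_def cis cisn cc_def by simp
    then show ?case by simp
  qed
  then show ?thesis using s(1) by blast
qed

lemma cc_lipschitz: "\<bar>cc s - cc t\<bar> \<le> cmod \<zeta> * real n * \<bar>s - t\<bar>"
proof -
  have "\<bar>cc s - cc t\<bar> \<le> cmod (\<zeta> * (cis (real n * s) - cis (real n * t)))"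
    using abs_Re_le_cmod[of "\<zeta> * (cis (real n * s) - cis (real n * t))"] by (simp add: cc_def algebra_simps)
  also have "\<dots> = cmod \<zeta> * cmod (cis (real n * s) - cis (real n * t))" by (simp add: norm_mult)
  also have "cmod (cis (real n * s) - cis (real n * t)) \<le> \<bar>real n * s - real n * t\<bar>"
  proof -
    have "cmod (cis a - cis b) \<le> \<bar>a - b\<bar>" for a b
    proof -
      have "cmod (cis a - cis b) = cmod (cis b * (cis (a - b) - 1))"
        by (simp add: algebra_simps cis_mult)
      also have "\<dots> = cmod (cis (a - b) - 1)" by (simp add: norm_mult)
      also have "\<dots> \<le> \<bar>a - b\<bar>"
      proof -
        have "(cmod (cis (a - b) - 1))\<^sup>2 = (2 * sin ((a - b) / 2))\<^sup>2"
        proof -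
          have c: "cos (a - b) = 1 - 2 * (sin ((a - b) / 2))\<^sup>2"
            using cos_double_sin[of "(a - b) / 2"] by (metis nonzero_mult_div_cancel_left times_divide_eq_right zero_neq_numeral)
          have "(cmod (cis (a - b) - 1))\<^sup>2 = (cos (a - b))\<^sup>2 + (sin (a - b))\<^sup>2 + 1 - 2 * cos (a - b)"
            by (simp add: cmod_power2 power2_diff)
          also have "\<dots> = 2 - 2 * cos (a - b)" by simp
          finally show ?thesis unfolding c by (simp add: power_mult_distrib)
        qed
        then have "\<bar>cmod (cis (a - b) - 1)\<bar> = \<bar>2 * sin ((a - b) / 2)\<bar>"
          by (simp only: power2_eq_iff abs_eq_iff)
        then show ?thesis using abs_sin_x_le_abs_x[of "(a - b) / 2"] by simp
      qed
      finally show ?thesis .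
    qed
    then show ?thesis .
  qed
  also have "\<bar>real n * s - real n * t\<bar> = real n * \<bar>s - t\<bar>" by (simp add: abs_mult flip: right_diff_distrib)
  finally show ?thesis by (simp add: mult_left_mono mult.assoc)
qed

lemma cc_le: "\<bar>cc t\<bar> \<le> cmod \<zeta>"
  using abs_Re_le_cmod[of "\<zeta> * cis (real n * t)"] by (simp add: cc_def norm_mult)

text \<open>The bound on \<open>B\<close> is only pointwise in the direction; interpolation between finitely many rays
  makes it uniform.\<close>

lemma uniform_bound:
  assumes e: "\<epsilon> > 0"
  shows "\<exists>r0. \<forall>z. cmod z \<ge> r0 \<longrightarrow> cmod (B z) \<le> exp (max (Re (\<zeta> * z ^ n)) 0 / 2 + \<epsilon> * cmod z ^ n)"
proof -
  obtain N where N: "\<And>z. cmod (B z) \<le> exp ((2 + cmod z) ^ N)"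
    using finB unfolding fin_growth_def by blast
  \<comment> \<open>Three demands on the half-aperture: Phragmen-Lindelof applies, the indicator
    varies by less than \<epsilon>/8 between the bisector and any ray of the sector, and the loss
    factor 1 / cos (n \<eta>) introduced below costs less than \<epsilon>/8.\<close>
  have "\<exists>\<eta>>0. real (Suc (max N n)) * \<eta> < pi / 2 \<and> cmod \<zeta> * real n * \<eta> < \<epsilon> / 8 \<and>
          (cmod \<zeta> + \<epsilon>) * (1 / cos (real n * \<eta>) - 1) < \<epsilon> / 8"
  proof -
    have "((\<lambda>\<eta>. real (Suc (max N n)) * \<eta>) \<longlongrightarrow> real (Suc (max N n)) * 0) (at_right 0)"
      by (intro tendsto_intros)
    then have 1: "\<forall>\<^sub>F \<eta> in at_right 0. real (Suc (max N n)) * \<eta> < pi / 2" by (rule order_tendstoD) auto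
    have "((\<lambda>\<eta>. cmod \<zeta> * real n * \<eta>) \<longlongrightarrow> cmod \<zeta> * real n * 0) (at_right 0)"
      by (intro tendsto_intros)
    then have 2: "\<forall>\<^sub>F \<eta> in at_right 0. cmod \<zeta> * real n * \<eta> < \<epsilon> / 8" by (rule order_tendstoD) (use e in auto)
    have "((\<lambda>\<eta>. (cmod \<zeta> + \<epsilon>) * (1 / cos (real n * \<eta>) - 1)) \<longlongrightarrow> (cmod \<zeta> + \<epsilon>) * (1 / cos (real n * 0) - 1)) (at_right 0)"
      by (intro tendsto_intros) auto
    then have 3: "\<forall>\<^sub>F \<eta> in at_right 0. (cmod \<zeta> + \<epsilon>) * (1 / cos (real n * \<eta>) - 1) < \<epsilon> / 8"
      by (rule order_tendstoD) (use e in auto)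
    have "\<forall>\<^sub>F \<eta> in at_right (0::real). \<eta> > 0" by (simp add: eventually_at_right_less)
    then have "\<forall>\<^sub>F \<eta> in at_right 0. \<eta> > 0 \<and> real (Suc (max N n)) * \<eta> < pi / 2 \<and> cmod \<zeta> * real n * \<eta> < \<epsilon> / 8 \<and>
          (cmod \<zeta> + \<epsilon>) * (1 / cos (real n * \<eta>) - 1) < \<epsilon> / 8"
      using 1 2 3 by eventually_elim blast
    from eventually_happens'[OF trivial_limit_at_right_real this] show ?thesis by blast
  qed
  then obtain \<eta> where eta: "\<eta> > 0" "real (Suc (max N n)) * \<eta> < pi / 2" and eta1: "cmod \<zeta> * real n * \<eta> < \<epsilon> / 8"
    and eta2: "(cmod \<zeta> + \<epsilon>) * (1 / cos (real n * \<eta>) - 1) < \<epsilon> / 8" by blast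
  have "real n * \<eta> < pi / 2"
    using eta by (intro le_less_trans[OF _ eta(2)] mult_right_mono) auto
  moreover have "0 < real n * \<eta>" using n eta by simp
  ultimately have cosn: "cos (real n * \<eta>) > 0" "cos (real n * \<eta>) \<le> 1" by (auto intro!: cos_gt_zero)
  have sector: "\<forall>\<^sub>F r in at_top. \<forall>t. \<bar>t - \<phi>\<bar> \<le> \<eta> \<longrightarrow>
      cmod (B (of_real r * cis t)) \<le> exp (max (cc t * r ^ n) 0 / 2 + \<epsilon> * r ^ n)" for \<phi>
  proof -
    \<comment> \<open>The extra 3 \<epsilon>/8 covers half of the Lipschitz error \<epsilon>/8 and
      the \<epsilon>/4 that absorbs r^\<alpha>.\<close>
    define b where "b = max (cc \<phi>) 0 / 2 + 3 * \<epsilon> / 8"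
    \<comment> \<open>The majorant is exp (Re (b' (z cis (-\<phi>))^n)). On both boundary rays its
      exponent is b' cos (n \<eta>) r^n = b r^n, and inside the sector it is at most b' r^n.\<close>
    define b' where "b' = b / cos (real n * \<eta>)"
    have b: "0 \<le> b" using e by (simp add: b_def)
    have b': "0 \<le> b'" using b cosn by (simp add: b'_def)
    have e4: "\<epsilon> / 4 > 0" using e by simp
    have bnd: "\<forall>\<^sub>F r in at_top. cmod (B (of_real r * cis (\<phi> + \<sigma>))) \<le> exp (Re (of_real b' * cis (- real n * \<phi>) * (of_real r * cis (\<phi> + \<sigma>)) ^ n))"
      if sig: "\<sigma> = \<eta> \<or> \<sigma> = - \<eta>" for \<sigma>
    proof -
      obtain s where s: "s < 1/2" "\<forall>\<^sub>F r in at_top. cmod (B (of_real r * cis (\<phi> + \<sigma>))) \<le> exp (s * max (cc (\<phi> + \<sigma>)) 0 * r ^ n + r powr \<alpha>)"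
        using rays'[of "\<phi> + \<sigma>"] by blast
      show ?thesis
        using s(2) powr_less_power[OF alpha e4] eventually_ge_at_top[of 0]
      proof eventually_elim
        case (elim r)
        have "cc (\<phi> + \<sigma>) \<le> cc \<phi> + \<epsilon> / 8"
          using cc_lipschitz[of "\<phi> + \<sigma>" \<phi>] eta1 eta sig by (auto simp: abs_le_iff)
        then have "max (cc (\<phi> + \<sigma>)) 0 \<le> max (cc \<phi>) 0 + \<epsilon> / 8" using e by linarith
        moreover have "s * max (cc (\<phi> + \<sigma>)) 0 \<le> 1/2 * max (cc (\<phi> + \<sigma>)) 0" using s(1) by (intro mult_right_mono) auto
        ultimately have "s * max (cc (\<phi> + \<sigma>)) 0 + \<epsilon> / 4 \<le> b" unfolding b_def using e by linarith
        then have "(s * max (cc (\<phi> + \<sigma>)) 0 + \<epsilon> / 4) * r ^ n \<le> b * r ^ n" using elim by (intro mult_right_mono) auto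
        then have "s * max (cc (\<phi> + \<sigma>)) 0 * r ^ n + r powr \<alpha> \<le> b * r ^ n"
          using elim(2) e by (simp add: algebra_simps)
        also have "b * r ^ n = Re (of_real b' * cis (- real n * \<phi>) * (of_real r * cis (\<phi> + \<sigma>)) ^ n)"
        proof -
          have "cis (- real n * \<phi>) * cis (real n * (\<phi> + \<sigma>)) = cis (real n * \<sigma>)"
            by (simp add: cis_mult algebra_simps)
          then have "of_real b' * cis (- real n * \<phi>) * (of_real r * cis (\<phi> + \<sigma>)) ^ n = of_real (b' * r ^ n) * cis (real n * \<sigma>)"
            unfolding cis_scaled_power by (simp add: mult_ac)
          then have "Re (of_real b' * cis (- real n * \<phi>) * (of_real r * cis (\<phi> + \<sigma>)) ^ n) = b' * r ^ n * cos (real n * \<sigma>)"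
            by (metis Re_complex_of_real Im_complex_of_real cis.sel(1) diff_zero mult_zero_left times_complex.sel(1))
          moreover have "cos (real n * \<sigma>) = cos (real n * \<eta>)" using sig by auto
          ultimately show ?thesis using cosn by (simp add: b'_def)
        qed
        finally have "exp (s * max (cc (\<phi> + \<sigma>)) 0 * r ^ n + r powr \<alpha>) \<le>
           exp (Re (of_real b' * cis (- real n * \<phi>) * (of_real r * cis (\<phi> + \<sigma>)) ^ n))" by (simp only: exp_le_cancel_iff)
        then show ?case using elim(1) by linarith
      qed
    qed
    obtain M where M: "M > 0" "\<And>\<rho> t. \<rho> \<ge> 0 \<Longrightarrow> \<bar>t - \<phi>\<bar> \<le> \<eta> \<Longrightarrow>
       cmod (B (of_real \<rho> * cis t)) \<le> M * exp (Re (of_real b' * cis (- real n * \<phi>) * (of_real \<rho> * cis t) ^ n))"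
      using phragmen_lindelof_sector[OF holB N eta bnd[OF disjI1[OF refl]]
          bnd[OF disjI2[OF refl], unfolded add_uminus_conv_diff]] by blast
    have "\<forall>\<^sub>F r in at_top. ln M \<le> (\<epsilon> / 8) * r ^ n" using e n by (intro const_le_power) auto
    then show ?thesis using eventually_ge_at_top[of 0]
    proof eventually_elim
      case (elim r)
      show ?case
      proof (intro allI impI)
        fix t assume t: "\<bar>t - \<phi>\<bar> \<le> \<eta>"
        have "b' - b = b * (1 / cos (real n * \<eta>) - 1)" by (simp add: b'_def field_simps)
        also have "\<dots> \<le> (cmod \<zeta> + \<epsilon>) * (1 / cos (real n * \<eta>) - 1)"
          using cosn cc_le[of \<phi>] e by (intro mult_right_mono) (auto simp: b_def)
        finally have "b' \<le> b + \<epsilon> / 8" using eta2 by linarith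
        moreover have "cmod \<zeta> * real n * \<bar>\<phi> - t\<bar> \<le> cmod \<zeta> * real n * \<eta>"
          using t by (intro mult_left_mono) auto
        then have "cc \<phi> \<le> cc t + \<epsilon> / 8"
          using cc_lipschitz[of \<phi> t] eta1 by linarith
        ultimately have b'le: "b' \<le> max (cc t) 0 / 2 + 5 * \<epsilon> / 8" unfolding b_def using e by linarith
        have "Re (of_real b' * cis (- real n * \<phi>) * (of_real r * cis t) ^ n) \<le> cmod (of_real b' * cis (- real n * \<phi>) * (of_real r * cis t) ^ n)"
          by (rule complex_Re_le_cmod)
        also have "\<dots> = b' * r ^ n" using b' elim by (simp only: norm_mult norm_power norm_of_real norm_cis abs_of_nonneg mult_1_right)
        also have "\<dots> \<le> (max (cc t) 0 / 2 + 5 * \<epsilon> / 8) * r ^ n" using b'le elim by (intro mult_right_mono) auto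
        finally have "ln M + Re (of_real b' * cis (- real n * \<phi>) * (of_real r * cis t) ^ n) \<le> (max (cc t) 0 / 2 + 5 * \<epsilon> / 8 + \<epsilon> / 8) * r ^ n"
          using elim by (simp add: algebra_simps)
        also have "\<dots> \<le> (max (cc t) 0 / 2 + \<epsilon>) * r ^ n" using e elim by (intro mult_right_mono) auto
        also have "\<dots> = max (cc t * r ^ n) 0 / 2 + \<epsilon> * r ^ n"
        proof -
          have "max (cc t) 0 * r ^ n = max (cc t * r ^ n) 0"
            using elim(2) by (simp add: max_mult_distrib_right)
          then show ?thesis by (simp add: distrib_right)
        qed
        finally have "exp (ln M + Re (of_real b' * cis (- real n * \<phi>) * (of_real r * cis t) ^ n)) \<le> exp (max (cc t * r ^ n) 0 / 2 + \<epsilon> * r ^ n)"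
          by (simp only: exp_le_cancel_iff)
        then show "cmod (B (of_real r * cis t)) \<le> exp (max (cc t * r ^ n) 0 / 2 + \<epsilon> * r ^ n)"
          using M(2)[OF elim(2) t] M(1) by (simp add: exp_add)
      qed
    qed
  qed
  \<comment> \<open>The sectors with bisectors 2 j \<eta> and half-aperture \<eta>, for j up to
    \<open>J\<close>, cover a full turn. Being finitely many, they share one threshold
    radius.\<close>
  define J where "J = nat \<lceil>pi / \<eta>\<rceil>"
  have "\<forall>\<^sub>F r in at_top. \<forall>j\<in>{..J}. \<forall>t. \<bar>t - real (2 * j) * \<eta>\<bar> \<le> \<eta> \<longrightarrow>
      cmod (B (of_real r * cis t)) \<le> exp (max (cc t * r ^ n) 0 / 2 + \<epsilon> * r ^ n)"
    using sector by (intro eventually_ball_finite) auto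
  then obtain r0 where r0: "\<And>r j t. r \<ge> r0 \<Longrightarrow> j \<le> J \<Longrightarrow> \<bar>t - real (2 * j) * \<eta>\<bar> \<le> \<eta> \<Longrightarrow>
      cmod (B (of_real r * cis t)) \<le> exp (max (cc t * r ^ n) 0 / 2 + \<epsilon> * r ^ n)"
    by (auto simp: eventually_at_top_linorder)
  have "cmod (B z) \<le> exp (max (Re (\<zeta> * z ^ n)) 0 / 2 + \<epsilon> * cmod z ^ n)" if z: "cmod z \<ge> r0" for z
  proof -
    define t where "t = Arg2pi z"
    have t: "0 \<le> t" "t < 2 * pi" "z = of_real (cmod z) * cis t"
      using Arg2pi[of z] by (auto simp: t_def cis_conv_exp mult.commute is_Arg_def)
    define j where "j = nat \<lfloor>(t + \<eta>) / (2 * \<eta>)\<rfloor>"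
    have fl: "real j \<le> (t + \<eta>) / (2 * \<eta>)" "(t + \<eta>) / (2 * \<eta>) < real j + 1"
      using t eta by (auto simp: j_def)
    have 1: "\<bar>t - real (2 * j) * \<eta>\<bar> \<le> \<eta>"
    proof -
      have "real j * (2 * \<eta>) \<le> t + \<eta>" "t + \<eta> < (real j + 1) * (2 * \<eta>)"
        using fl eta by (simp_all add: field_simps)
      then show ?thesis by (simp add: abs_le_iff algebra_simps)
    qed
    have "real j \<le> pi / \<eta> + 1/2" using fl(1) t eta by (simp add: field_simps)
    then have 2: "j \<le> J" unfolding J_def by linarith
    show ?thesis using r0[OF z 2 1] Re_cc[of "cmod z" t] t(3) by simp
  qed
  then show ?thesis by blast
qed

text \<open>Here the interpolation is applied to \<open>B\<close> times \<open>exp (- \<zeta> z^n / 2)\<close>, which decays on both boundary rays.\<close>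

lemma decay_bound:
  "\<exists>\<theta>0 \<delta> \<eta> r0. \<delta> > 0 \<and> \<eta> > 0 \<and> (\<forall>\<rho> t. \<rho> \<ge> r0 \<longrightarrow> \<bar>t - \<theta>0\<bar> \<le> \<eta> \<longrightarrow>
     \<delta> \<le> cc t \<and> cmod (B (of_real \<rho> * cis t)) \<le> exp ((cc t / 2 - \<delta>) * \<rho> ^ n))"
proof -
  obtain N where N: "\<And>z. cmod (B z) \<le> exp ((2 + cmod z) ^ N)"
    using finB unfolding fin_growth_def by blast
  \<comment> \<open>The direction in which \<zeta> z^n is positive, where the indicator attains its
    maximum |\<zeta>|.\<close>
  define \<theta>0 where "\<theta>0 = - Arg \<zeta> / real n"
  \<comment> \<open>Besides admitting Phragmen-Lindelof, this forces n \<eta> \<le> 1/2. So the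
    indicator stays above |\<zeta>|/2 in the sector, and cos (n (t - \<theta>0)) stays above
    1/2.\<close>
  define \<eta> where "\<eta> = 1 / (2 * real (Suc (max N n)))"
  have eta_le: "real (Suc (max N n)) * \<eta> = 1/2" unfolding \<eta>_def by (simp del: of_nat_Suc)
  have eta: "0 < \<eta>" "real (Suc (max N n)) * \<eta> < pi / 2"
    using pi_gt3 unfolding eta_le by (auto simp: \<eta>_def)
  have neta: "real n * \<eta> \<le> 1/2"
    unfolding eta_le[symmetric] using eta by (intro mult_right_mono) auto
  have cc0: "cc \<theta>0 = cmod \<zeta>"
  proof -
    have "real n * \<theta>0 = - Arg \<zeta>" using n by (simp add: \<theta>0_def)
    then have "\<zeta> * cis (real n * \<theta>0) = of_real (cmod \<zeta>) * (cis (Arg \<zeta>) * cis (- Arg \<zeta>))"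
      using rcis_cmod_Arg[of \<zeta>] unfolding rcis_def by (simp add: mult.assoc)
    then show ?thesis by (simp add: cc_def cis_mult)
  qed
  have z0: "cmod \<zeta> > 0" using zeta by simp
  have cc_ge: "cc t \<ge> cmod \<zeta> / 2" if "\<bar>t - \<theta>0\<bar> \<le> \<eta>" for t
  proof -
    have "\<bar>cc \<theta>0 - cc t\<bar> \<le> cmod \<zeta> * real n * \<bar>\<theta>0 - t\<bar>" by (rule cc_lipschitz)
    also have "\<dots> \<le> cmod \<zeta> * real n * \<eta>" using that by (intro mult_left_mono) auto
    also have "\<dots> \<le> cmod \<zeta> * (1/2)" using neta by (simp only: mult.assoc) (intro mult_left_mono, auto)
    finally show ?thesis using cc0 by linarith
  qed
  obtain s1 where s1: "s1 < 1/2" "\<forall>\<^sub>F r in at_top. cmod (B (of_real r * cis (\<theta>0 + \<eta>))) \<le> exp (s1 * max (cc (\<theta>0 + \<eta>)) 0 * r ^ n + r powr \<alpha>)"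
    using rays' by blast
  obtain s2 where s2: "s2 < 1/2" "\<forall>\<^sub>F r in at_top. cmod (B (of_real r * cis (\<theta>0 - \<eta>))) \<le> exp (s2 * max (cc (\<theta>0 - \<eta>)) 0 * r ^ n + r powr \<alpha>)"
    using rays' by blast
  \<comment> \<open>On the boundary rays the gap between half the indicator and the exponent granted
    by the hypothesis is at least 2 \<delta>: one \<delta> absorbs r^\<alpha>, the other is the
    decay that remains.\<close>
  define \<delta> where "\<delta> = (1/2 - max s1 s2) * cmod \<zeta> / 4"
  have d: "\<delta> > 0" using s1 s2 z0 by (simp add: \<delta>_def)
  \<comment> \<open>Rotating the correction makes it real in direction \<open>\<theta>0\<close>, so
    in direction t it lowers the exponent by \<delta> cos (n (t - \<theta>0)), which is positive
    throughout the sector.\<close>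
  define c where "c = \<zeta> / 2 - of_real \<delta> * cis (- real n * \<theta>0)"
  have Re_c: "Re (c * (of_real r * cis t) ^ n) = (cc t / 2 - \<delta> * cos (real n * (t - \<theta>0))) * r ^ n" for r t
  proof -
    have "cis (- real n * \<theta>0) * cis (real n * t) = cis (real n * (t - \<theta>0))"
      by (simp add: cis_mult algebra_simps)
    then have "c * (of_real r * cis t) ^ n = of_real (r ^ n) * (\<zeta> * cis (real n * t) / 2 - of_real \<delta> * cis (real n * (t - \<theta>0)))"
      unfolding cis_scaled_power c_def by (simp add: algebra_simps)
    then show ?thesis by (simp add: cc_def mult.commute)
  qed
  have bnd: "\<forall>\<^sub>F r in at_top. cmod (B (of_real r * cis t)) \<le> exp (Re (c * (of_real r * cis t) ^ n))"
    if ev: "\<forall>\<^sub>F r in at_top. cmod (B (of_real r * cis t)) \<le> exp (s * max (cc t) 0 * r ^ n + r powr \<alpha>)"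
      and s: "s \<le> max s1 s2" and t: "\<bar>t - \<theta>0\<bar> \<le> \<eta>" for s t
    using ev powr_less_power[OF alpha d] eventually_ge_at_top[of 0]
  proof eventually_elim
    case (elim r)
    have cct: "cc t \<ge> cmod \<zeta> / 2" using cc_ge[OF t] .
    have "2 * \<delta> = (1/2 - max s1 s2) * (cmod \<zeta> / 2)" by (simp add: \<delta>_def)
    also have "\<dots> \<le> (1/2 - s) * cc t" using s s1 s2 cct z0 by (intro mult_mono) auto
    finally have "s * cc t + \<delta> \<le> cc t / 2 - \<delta>" by (simp add: algebra_simps)
    also have "\<dots> \<le> cc t / 2 - \<delta> * cos (real n * (t - \<theta>0))"
      using mult_left_mono[of "cos (real n * (t - \<theta>0))" 1 \<delta>] d by simp
    finally have "(s * cc t + \<delta>) * r ^ n \<le> (cc t / 2 - \<delta> * cos (real n * (t - \<theta>0))) * r ^ n"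
      using elim by (intro mult_right_mono) auto
    moreover have "max (cc t) 0 = cc t" using cct z0 by linarith
    ultimately have "s * max (cc t) 0 * r ^ n + r powr \<alpha> \<le> Re (c * (of_real r * cis t) ^ n)"
      using elim(2) unfolding Re_c by (simp only: distrib_right)
    then show ?case using elim(1) by (meson exp_le_cancel_iff order_trans)
  qed
  obtain M where M: "M > 0" "\<And>\<rho> t. \<rho> \<ge> 0 \<Longrightarrow> \<bar>t - \<theta>0\<bar> \<le> \<eta> \<Longrightarrow>
     cmod (B (of_real \<rho> * cis t)) \<le> M * exp (Re (c * (of_real \<rho> * cis t) ^ n))"
    using phragmen_lindelof_sector[OF holB N eta bnd[OF s1(2)] bnd[OF s2(2)]] eta by auto
  have "\<forall>\<^sub>F r in at_top. ln M \<le> (\<delta> / 4) * r ^ n" using d n by (intro const_le_power) auto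
  then obtain r0 where r0: "\<And>r. r \<ge> r0 \<Longrightarrow> (\<delta> / 4) * r ^ n \<ge> ln M" by (auto simp: eventually_at_top_linorder)
  \<comment> \<open>The cosine leaves \<delta>/2, of which \<delta>/4 swallows ln M. The minimum
    lets the same number bound the indicator from below.\<close>
  define \<delta>' where "\<delta>' = min (\<delta> / 4) (cmod \<zeta> / 2)"
  have "\<delta>' \<le> cc t \<and> cmod (B (of_real \<rho> * cis t)) \<le> exp ((cc t / 2 - \<delta>') * \<rho> ^ n)"
    if rho: "\<rho> \<ge> max r0 0" and t: "\<bar>t - \<theta>0\<bar> \<le> \<eta>" for \<rho> t
  proof
    show "\<delta>' \<le> cc t" using cc_ge[OF t] by (simp add: \<delta>'_def min_le_iff_disj)
    have "\<bar>real n * (t - \<theta>0)\<bar> \<le> real n * \<eta>" using t by (simp add: abs_mult mult_left_mono)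
    also have "\<dots> \<le> pi / 3" using neta pi_gt3 by linarith
    finally have "cos (pi / 3) \<le> cos \<bar>real n * (t - \<theta>0)\<bar>"
      by (intro cos_monotone_0_pi_le) auto
    then have "1/2 \<le> cos (real n * (t - \<theta>0))" by (simp add: cos_60)
    then have "\<delta> * (1/2) \<le> \<delta> * cos (real n * (t - \<theta>0))" using d by (intro mult_left_mono) auto
    then have "(cc t / 2 - \<delta> * cos (real n * (t - \<theta>0))) * \<rho> ^ n \<le> (cc t / 2 - \<delta> / 2) * \<rho> ^ n"
      using rho by (intro mult_right_mono) auto
    then have "ln M + Re (c * (of_real \<rho> * cis t) ^ n) \<le> (cc t / 2 - \<delta> / 2 + \<delta> / 4) * \<rho> ^ n"
      using r0[of \<rho>] rho unfolding Re_c by (simp add: algebra_simps)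
    also have "\<dots> \<le> (cc t / 2 - \<delta>') * \<rho> ^ n"
      using rho by (intro mult_right_mono) (auto simp: \<delta>'_def)
    finally have "exp (ln M + Re (c * (of_real \<rho> * cis t) ^ n)) \<le> exp ((cc t / 2 - \<delta>') * \<rho> ^ n)"
      by (simp only: exp_le_cancel_iff)
    then have "M * exp (Re (c * (of_real \<rho> * cis t) ^ n)) \<le> exp ((cc t / 2 - \<delta>') * \<rho> ^ n)"
      using M(1) by (simp only: exp_add exp_ln)
    moreover have "\<rho> \<ge> 0" using rho by simp
    ultimately show "cmod (B (of_real \<rho> * cis t)) \<le> exp ((cc t / 2 - \<delta>') * \<rho> ^ n)"
      using M(2)[OF _ t, of \<rho>] by linarith
  qed
  moreover have "\<delta>' > 0" using d z0 by (simp add: \<delta>'_def)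
  ultimately show ?thesis using eta(1) by blast
qed

end

subsection \<open>Local factorization\<close>

lemma ln_cmod_le: "w \<noteq> 0 \<Longrightarrow> cmod w \<le> exp L \<Longrightarrow> ln (cmod w) \<le> L"
  by (metis ln_exp ln_le_cancel_iff exp_gt_zero zero_less_norm_iff)

text \<open>Outside the unit disc the factor z^m only enlarges the modulus, and inside it the
  maximum principle takes over. Removing a zero at the origin therefore costs nothing.\<close>

lemma cmod_power_quotient_le:
  assumes "\<rho> > 1" and hol: "G holomorphic_on ball 0 \<rho>"
    and bd: "\<And>z. z \<in> ball 0 \<rho> \<Longrightarrow> cmod (z ^ m * G z) \<le> C" and z: "z \<in> ball 0 \<rho>"
  shows "cmod (G z) \<le> C"
proof -
  have large: "cmod (G z) \<le> C" if "z \<in> ball 0 \<rho>" "cmod z \<ge> 1" for z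
  proof -
    have "1 * cmod (G z) \<le> cmod z ^ m * cmod (G z)" using that by (intro mult_right_mono one_le_power) auto
    also have "\<dots> = cmod (z ^ m * G z)" by (simp add: norm_mult norm_power)
    also have "\<dots> \<le> C" using bd[OF that(1)] .
    finally show ?thesis by simp
  qed
  show ?thesis
  proof (cases "cmod z \<ge> 1")
    case False
    have sub: "cball 0 1 \<subseteq> ball (0::complex) \<rho>" using assms(1) by auto
    show ?thesis
    proof (rule maximum_modulus_frontier[where S = "cball 0 1" and f = G])
      show "G holomorphic_on interior (cball 0 1)"
        using sub interior_subset by (blast intro: holomorphic_on_subset[OF hol])
      show "continuous_on (closure (cball 0 1)) G"
        using holomorphic_on_subset[OF hol sub] by (simp add: holomorphic_on_imp_continuous_on)
      show "cmod (G w) \<le> C" if "w \<in> frontier (cball 0 1)" for w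
        using that sub assms(1) by (intro large) auto
    qed (use False in auto)
  qed (use large z in auto)
qed

text \<open>Borel-Caratheodory, via the Schwarz lemma.\<close>

lemma zero_free_log_bound:
  assumes r: "r > 0" and hol: "G holomorphic_on ball 0 (2 * r)"
    and nz: "\<And>z. z \<in> ball 0 (2 * r) \<Longrightarrow> G z \<noteq> 0"
    and bd: "\<And>z. z \<in> ball 0 (2 * r) \<Longrightarrow> cmod (G z) \<le> exp L"
    and M: "L - ln (cmod (G 0)) < M"
  obtains h where "h holomorphic_on ball 0 (2 * r)" "\<And>z. z \<in> ball 0 (2 * r) \<Longrightarrow> G z = exp (h z)"
    "\<And>z. cmod z \<le> 3/2 * r \<Longrightarrow> cmod (h z - h 0) \<le> 6 * M"
    "\<And>z. cmod z \<le> r \<Longrightarrow> cmod (deriv h z) \<le> 12 * M / r"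
proof -
  have 0: "(0::complex) \<in> ball 0 (2 * r)" using r by simp
  obtain h where h: "h holomorphic_on ball 0 (2 * r)" "\<And>z. z \<in> ball 0 (2 * r) \<Longrightarrow> exp (h z) = G z"
    using holomorphic_logarithm_exists[of "ball 0 (2 * r)" G 0] hol nz 0 by (metis convex_ball open_ball)
  have Re: "Re (h z) = ln (cmod (G z))" if "z \<in> ball 0 (2 * r)" for z
    using h(2)[OF that, symmetric] by simp
  have "ln (cmod (G 0)) \<le> L" using ln_cmod_le nz bd 0 by blast
  then have Mpos: "M > 0" using M by linarith
  define g where "g = (\<lambda>z. h z - h 0)"
  have Reg: "Re (g z) < M" if "z \<in> ball 0 (2 * r)" for z
  proof -
    have "ln (cmod (G z)) \<le> L" using ln_cmod_le nz bd that by blast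
    then show ?thesis using Re[OF that] Re[OF 0] M by (simp add: g_def)
  qed
  have g_lt: "cmod (g z) < cmod (2 * of_real M - g z)" if "z \<in> ball 0 (2 * r)" for z
  proof -
    have "(cmod (2 * of_real M - g z))\<^sup>2 - (cmod (g z))\<^sup>2 = 4 * M * (M - Re (g z))"
      unfolding cmod_power2 by (simp add: power2_eq_square algebra_simps)
    also have "\<dots> > 0" using Mpos Reg[OF that] by simp
    finally show ?thesis by (simp add: power2_less_imp_less)
  qed
  \<comment> \<open>The Moebius map g / (2 M - g) sends the half-plane Re g < M to the unit disc and
    0 to 0. For |w| \<le> 3/4 the Schwarz lemma yields |g| \<le> 3/4 (2 M + |g|), which is |g| \<le>
    6 M. Cauchy's estimate on discs of radius r/2 then turns 6 M into 12 M / r.\<close>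
  define \<phi> where "\<phi> = (\<lambda>w. g (of_real (2 * r) * w) / (2 * of_real M - g (of_real (2 * r) * w)))"
  have inball: "of_real (2 * r) * w \<in> ball 0 (2 * r)" if "cmod w < 1" for w :: complex
    using that r by (simp add: norm_mult)
  have holg: "g holomorphic_on ball 0 (2 * r)" unfolding g_def by (intro holomorphic_intros h)
  have holgs: "(\<lambda>w. g (of_real (2 * r) * w)) holomorphic_on ball 0 1"
    by (rule holomorphic_on_compose_gen[OF _ holg, unfolded comp_def]) (auto intro!: holomorphic_intros inball simp del: of_real_mult)
  have nz2: "2 * of_real M - g (of_real (2 * r) * w) \<noteq> 0" if "cmod w < 1" for w
    using g_lt[OF inball[OF that]] by auto
  have hol\<phi>: "\<phi> holomorphic_on ball 0 1"
    unfolding \<phi>_def using nz2 by (intro holomorphic_intros holgs) auto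
  have \<phi>1: "cmod (\<phi> w) < 1" if "cmod w < 1" for w
    using g_lt[OF inball[OF that]] nz2[OF that] by (simp add: \<phi>_def norm_divide)
  have \<phi>0: "\<phi> 0 = 0" by (simp add: \<phi>_def g_def)
  have gb: "cmod (g z) \<le> 6 * M" if z: "cmod z \<le> 3/2 * r" for z
  proof -
    define w where "w = z / of_real (2 * r)"
    have w: "cmod w \<le> 3/4" "z = of_real (2 * r) * w" using z r by (auto simp: w_def norm_divide field_simps norm_mult)
    have "cmod (\<phi> w) \<le> cmod w"
      using Schwarz_Lemma(1)[OF hol\<phi> \<phi>0 \<phi>1, of w] w by auto
    then have "cmod (\<phi> w) \<le> 3/4" using w(1) by linarith
    then have "cmod (g z) / cmod (2 * of_real M - g z) \<le> 3/4"
      unfolding \<phi>_def norm_divide w(2)[symmetric] .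
    moreover have "cmod (2 * of_real M - g z) > 0" using nz2[of w] w by simp
    ultimately have "cmod (g z) \<le> 3/4 * cmod (2 * of_real M - g z)" by (simp add: divide_simps split: if_splits)
    moreover have "cmod (2 * of_real M - g z) \<le> 2 * M + cmod (g z)"
      using norm_triangle_ineq4[of "2 * of_real M" "g z"] Mpos by (simp add: norm_mult)
    ultimately show ?thesis by linarith
  qed
  have "cmod (deriv h z) \<le> 12 * M / r" if z: "cmod z \<le> r" for z
  proof -
    have sub: "cball z (r / 2) \<subseteq> cball 0 (3/2 * r)"
    proof
      fix w assume "w \<in> cball z (r / 2)"
      then have "cmod (w - z) \<le> r / 2" by (simp add: dist_norm norm_minus_commute)
      then show "w \<in> cball 0 (3/2 * r)" using norm_triangle_ineq2[of w z] z by simp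
    qed
    have sub2: "cball 0 (3/2 * r) \<subseteq> ball (0::complex) (2 * r)" using r by auto
    have "cmod ((deriv ^^ 1) g z) \<le> fact 1 * (6 * M) / (r / 2) ^ 1"
    proof (rule Cauchy_inequality)
      show "g holomorphic_on ball z (r / 2)"
        using sub sub2 ball_subset_cball by (intro holomorphic_on_subset[OF holg]) blast
      show "continuous_on (cball z (r / 2)) g"
        using sub sub2 by (intro holomorphic_on_imp_continuous_on holomorphic_on_subset[OF holg]) blast
      show "cmod (g x) \<le> 6 * M" if "cmod (z - x) = r / 2" for x
        using sub that by (intro gb) (auto simp: dist_norm subset_iff)
    qed (use r in auto)
    moreover have "deriv g z = deriv h z"
    proof -
      have "z \<in> ball 0 (2 * r)" using z r by simp
      then have "h field_differentiable at z" using h(1) holomorphic_on_imp_differentiable_at by blast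
      then show ?thesis unfolding g_def by (subst deriv_diff) auto
    qed
    ultimately show ?thesis by (simp add: mult.commute)
  qed
  then show ?thesis using that[OF h(1)] h(2) gb by (simp add: g_def)
qed

text \<open>A list, so that repetitions can record multiplicities. Every factor is 1 at the origin,
  so splitting factors off never changes the value there.\<close>

definition zprod :: "complex list \<Rightarrow> complex \<Rightarrow> complex" where
  "zprod xs z = (\<Prod>a\<leftarrow>xs. 1 - z / a)"

lemma zprod_simps [simp]: "zprod [] z = 1" "zprod (a # xs) z = (1 - z / a) * zprod xs z"
  by (simp_all add: zprod_def)

lemma zprod_0 [simp]: "zprod xs 0 = 1"
  by (induction xs) auto

lemma holomorphic_zprod [holomorphic_intros]: "zprod xs holomorphic_on S"
proof (induction xs)
  case (Cons a xs)
  have "(\<lambda>z. (1 - z / a) * zprod xs z) holomorphic_on S"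
    by (cases "a = 0") (auto intro!: holomorphic_intros Cons)
  then show ?case by (simp add: zprod_def)
qed (auto simp: zprod_def)

lemma zprod_ge:
  assumes "\<And>a. a \<in> set xs \<Longrightarrow> c \<le> cmod (1 - z / a)" "c \<ge> 0"
  shows "c ^ length xs \<le> cmod (zprod xs z)"
  using assms by (induction xs) (auto simp: norm_mult intro!: mult_mono)

lemma zprod_eq_0_iff: "zprod xs z = 0 \<longleftrightarrow> (\<exists>a\<in>set xs. z / a = 1)"
  by (induction xs) auto

lemma zprod_has_derivative:
  assumes "\<And>a. a \<in> set xs \<Longrightarrow> a \<noteq> 0 \<and> z \<noteq> a"
  shows "(zprod xs has_field_derivative zprod xs z * (\<Sum>a\<leftarrow>xs. 1 / (z - a))) (at z)"
  using assms
proof (induction xs)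
  case (Cons a xs)
  have a: "a \<noteq> 0" "z \<noteq> a" using Cons.prems by auto
  have D: "(zprod xs has_field_derivative zprod xs z * (\<Sum>a\<leftarrow>xs. 1 / (z - a))) (at z)"
    using Cons.prems by (intro Cons.IH) auto
  have "((\<lambda>z. 1 - z / a) has_field_derivative (0 - 1 / a)) (at z)"
    using a by (auto intro!: derivative_eq_intros)
  from DERIV_mult[OF this D] have "((\<lambda>z. (1 - z / a) * zprod xs z) has_field_derivative
      ((0 - 1 / a) * zprod xs z + (zprod xs z * (\<Sum>a\<leftarrow>xs. 1 / (z - a))) * (1 - z / a))) (at z)" .
  moreover have "(0 - 1 / a) * zprod xs z + (zprod xs z * (\<Sum>a\<leftarrow>xs. 1 / (z - a))) * (1 - z / a)
      = ((1 - z / a) * zprod xs z) * (1 / (z - a) + (\<Sum>a\<leftarrow>xs. 1 / (z - a)))"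
  proof -
    have "0 - 1 / a = (1 - z / a) * (1 / (z - a))" using a by (simp add: field_simps)
    then show ?thesis by (simp only: distrib_left mult_ac)
  qed
  moreover have "zprod (a # xs) = (\<lambda>z. (1 - z / a) * zprod xs z)" by (rule ext) simp
  ultimately show ?case by simp
next
  case Nil
  have "zprod [] = (\<lambda>z. 1)" by (rule ext) simp
  then show ?case by simp
qed

text \<open>A substitute for Jensen's formula. If |a| \<le> 2 r and |w| = 6 r, then |1 - w/a| \<ge>
  3 - 1 = 2, so each zero split off halves the bound of the cofactor, whose value at 0 stays fixed;
  this limits the number of zeros. Once no zero is left in the disc of radius 2 r, the cofactor has
  a logarithm. The last conclusion keeps the factorization on the large disc, because a listed zero
  may lie on the boundary of the small one, where double zeros must still be detected.\<close>

lemma local_factor: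
  assumes r: "r > 0" and hol: "F holomorphic_on ball 0 (7 * r)" and F0: "F 0 \<noteq> 0"
    and bd: "\<And>z. z \<in> ball 0 (7 * r) \<Longrightarrow> cmod (F z) \<le> exp L" and M: "L - ln (cmod (F 0)) < M"
  obtains xs h where "h holomorphic_on ball 0 (2 * r)"
    "\<And>z. z \<in> ball 0 (2 * r) \<Longrightarrow> F z = zprod xs z * exp (h z)"
    "\<And>a. a \<in> set xs \<Longrightarrow> a \<noteq> 0 \<and> F a = 0 \<and> cmod a \<le> 2 * r"
    "real (length xs) \<le> 2 * M"
    "\<And>z. cmod z \<le> 3/2 * r \<Longrightarrow> cmod (h z - h 0) \<le> 6 * M"
    "\<And>z. cmod z \<le> r \<Longrightarrow> cmod (deriv h z) \<le> 12 * M / r"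
    "\<exists>G. G holomorphic_on ball 0 (7 * r) \<and> (\<forall>z\<in>ball 0 (7 * r). F z = zprod xs z * G z)"
proof -
  let ?B = "ball (0::complex) (7 * r)"
  define P where "P = (\<lambda>xs G. G holomorphic_on ?B \<and> (\<forall>z\<in>?B. F z = zprod xs z * G z) \<and>
      (\<forall>a\<in>set xs. a \<noteq> 0 \<and> F a = 0 \<and> cmod a \<le> 2 * r))"
  have G_bound: "cmod (G z) \<le> exp L / 2 ^ length xs" if P: "P xs G" and z: "cmod z \<le> 6 * r" for xs G z
  proof (rule maximum_modulus_frontier[where S = "cball 0 (6 * r)" and f = G])
    have sub: "cball 0 (6 * r) \<subseteq> ?B" using r by auto
    show "G holomorphic_on interior (cball 0 (6 * r))"
      using P sub interior_subset unfolding P_def by (blast intro: holomorphic_on_subset)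
    show "continuous_on (closure (cball 0 (6 * r))) G"
    proof -
      have "G holomorphic_on cball 0 (6 * r)" using P sub unfolding P_def by (blast intro: holomorphic_on_subset)
      then show ?thesis by (simp add: holomorphic_on_imp_continuous_on)
    qed
    fix w assume "w \<in> frontier (cball (0::complex) (6 * r))"
    then have w: "cmod w = 6 * r" using r by auto
    then have wB: "w \<in> ?B" using r by auto
    have "2 \<le> cmod (1 - w / a)" if "a \<in> set xs" for a
    proof -
      have a: "cmod a > 0" "cmod a \<le> 2 * r" using P that by (auto simp: P_def)
      have "3 \<le> cmod (w / a)" using a w by (simp add: norm_divide field_simps)
      then show ?thesis using norm_triangle_ineq2[of "w / a" 1] by (simp add: norm_minus_commute)
    qed
    then have "2 ^ length xs \<le> cmod (zprod xs w)" by (intro zprod_ge) auto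
    then have "2 ^ length xs * cmod (G w) \<le> cmod (zprod xs w) * cmod (G w)" by (intro mult_right_mono) auto
    also have "\<dots> = cmod (F w)" using P wB by (simp add: P_def norm_mult)
    also have "\<dots> \<le> exp L" using bd[OF wB] .
    finally show "cmod (G w) \<le> exp L / 2 ^ length xs" by (simp add: field_simps)
  qed (use z in auto)
  have G0: "G 0 = F 0" if "P xs G" for xs G
  proof -
    have "0 \<in> ?B" using r by simp
    then have "F 0 = zprod xs 0 * G 0" using that unfolding P_def by blast
    then show ?thesis by simp
  qed
  have len: "real (length xs) \<le> 2 * M" if P: "P xs G" for xs G
  proof -
    have "cmod (F 0) \<le> exp L / 2 ^ length xs" using G_bound[OF P, of 0] G0[OF P] r by simp
    then have "2 ^ length xs \<le> exp L / cmod (F 0)" using F0 by (simp add: field_simps)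
    then have "ln (2 ^ length xs) \<le> ln (exp L / cmod (F 0))" using F0 by (subst ln_le_cancel_iff) auto
    then have "real (length xs) * ln 2 \<le> L - ln (cmod (F 0))" using F0 by (simp add: ln_realpow ln_div)
    moreover have "real (length xs) * (1/2) \<le> real (length xs) * ln 2"
      using ln2_ge_two_thirds by (intro mult_left_mono) auto
    ultimately show ?thesis using M by linarith
  qed
  have "\<exists>G. P [] G" using hol by (auto simp: P_def)
  moreover have "\<forall>ys. (\<exists>G. P ys G) \<longrightarrow> length ys < Suc (nat \<lfloor>2 * M\<rfloor>)"
    using len le_nat_floor less_Suc_eq_le by blast
  \<comment> \<open>A longest admissible list exists because lengths are bounded. A remaining zero
    of its cofactor could be prepended, so there is none.\<close>
  ultimately have "\<exists>xs. (\<exists>G. P xs G) \<and> (\<forall>ys. (\<exists>G. P ys G) \<longrightarrow> length ys \<le> length xs)"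
    by (rule ex_has_greatest_nat[of "\<lambda>ys. \<exists>G. P ys G" "[]" length])
  then obtain xs where xs: "\<exists>G. P xs G" "\<And>ys. \<exists>G. P ys G \<Longrightarrow> length ys \<le> length xs"
    by auto
  obtain G where P: "P xs G" using xs(1) by blast
  have holG: "G holomorphic_on ?B" and FG: "\<And>z. z \<in> ?B \<Longrightarrow> F z = zprod xs z * G z"
    and xs_zero: "\<And>a. a \<in> set xs \<Longrightarrow> a \<noteq> 0 \<and> F a = 0 \<and> cmod a \<le> 2 * r"
    using P unfolding P_def by blast+
  have nz: "G a \<noteq> 0" if a: "cmod a \<le> 2 * r" for a
  proof
    assume Ga: "G a = 0"
    have a0: "a \<noteq> 0" using G0[OF P] F0 Ga by auto
    have aB: "a \<in> ?B" using a r by simp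
    \<comment> \<open>The derivative fills in the removable singularity at \<open>a\<close>, and the
      factor -a converts z - a into 1 - z/a.\<close>
    define G' where "G' = (\<lambda>z. - a * (if z = a then deriv G a else (G z - G a) / (z - a)))"
    have "G' holomorphic_on ?B"
      unfolding G'_def by (intro holomorphic_intros pole_lemma_open holG) auto
    moreover have "F z = zprod (a # xs) z * G' z" if "z \<in> ?B" for z
    proof -
      have "(1 - z / a) * G' z = G z"
      proof (cases "z = a")
        case False
        then show ?thesis using a0 Ga by (simp add: G'_def divide_simps) (simp add: algebra_simps)
      qed (use a0 Ga in auto)
      then show ?thesis using FG[OF that] by (simp add: mult_ac)
    qed
    moreover have "F a = 0" using FG[OF aB] Ga by simp
    ultimately have "P (a # xs) G'" using xs_zero a a0 by (simp add: P_def)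
    then show False using xs(2)[of "a # xs"] by auto
  qed
  have holG2: "G holomorphic_on ball 0 (2 * r)" using r by (intro holomorphic_on_subset[OF holG]) auto
  obtain h where h: "h holomorphic_on ball 0 (2 * r)" "\<And>z. z \<in> ball 0 (2 * r) \<Longrightarrow> G z = exp (h z)"
    "\<And>z. cmod z \<le> 3/2 * r \<Longrightarrow> cmod (h z - h 0) \<le> 6 * M"
    "\<And>z. cmod z \<le> r \<Longrightarrow> cmod (deriv h z) \<le> 12 * M / r"
  proof (rule zero_free_log_bound[OF r holG2, of L M])
    show "cmod (G z) \<le> exp L" if "z \<in> ball 0 (2 * r)" for z
    proof -
      have "cmod (G z) \<le> exp L / 2 ^ length xs" using that r by (intro G_bound[OF P]) auto
      also have "\<dots> \<le> exp L" by (simp add: divide_le_eq)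
      finally show ?thesis .
    qed
  qed (use nz M G0[OF P] in auto)
  show ?thesis
  proof (rule that[OF h(1) _ xs_zero len[OF P] h(3) h(4)])
    show "\<exists>G. G holomorphic_on ?B \<and> (\<forall>z\<in>?B. F z = zprod xs z * G z)" using holG FG by blast
  next
    show "F z = zprod xs z * exp (h z)" if "z \<in> ball 0 (2 * r)" for z
      using FG[of z] h(2)[OF that] that r by auto
  qed
qed

section \<open>Circles that stay away from zeros\<close>

lemma good_radius:
  fixes xs :: "real list"
  assumes "R > 0"
  obtains r where "R \<le> r" "r \<le> 2 * R" "\<And>x. x \<in> set xs \<Longrightarrow> R / (2 * (real (length xs) + 1)) \<le> \<bar>r - x\<bar>"
proof -
  define k where "k = length xs"
  define d where "d = R / (2 * (real k + 1))"
  \<comment> \<open>Pigeonhole: the k + 1 candidates are 2 d apart, so each of the at most k entries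
    is closer than d to at most one of them.\<close>
  define rr where "rr = (\<lambda>j::nat. R + real (2 * j) * d)"
  have d: "d > 0" using assms by (simp add: d_def)
  have dk: "2 * (real k + 1) * d = R" by (simp add: d_def)
  have "\<exists>j\<le>k. \<forall>x\<in>set xs. d \<le> \<bar>rr j - x\<bar>"
  proof (rule ccontr)
    assume "\<not> ?thesis"
    then have "\<forall>j\<in>{..k}. \<exists>x\<in>set xs. \<bar>rr j - x\<bar> < d" unfolding not_le[symmetric] by blast
    then obtain g where g: "\<And>j. j \<le> k \<Longrightarrow> g j \<in> set xs \<and> \<bar>rr j - g j\<bar> < d"
      by (metis atMost_iff)
    have "inj_on g {..k}"
    proof
      fix i j assume ij: "i \<in> {..k}" "j \<in> {..k}" "g i = g j"
      have "\<bar>rr i - rr j\<bar> < 2 * d" using g[of i] g[of j] ij by auto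
      then have "\<bar>real i - real j\<bar> * (2 * d) < 1 * (2 * d)"
        using d by (simp add: rr_def abs_mult flip: left_diff_distrib)
      then have "\<bar>real i - real j\<bar> < 1" by (rule mult_right_less_imp_less) (use d in auto)
      then show "i = j" by linarith
    qed
    then have "card {..k} \<le> card (set xs)" using g by (intro card_inj_on_le[of g]) auto
    also have "\<dots> \<le> k" unfolding k_def by (rule card_length)
    finally show False by simp
  qed
  then obtain j where j: "j \<le> k" "\<forall>x\<in>set xs. d \<le> \<bar>rr j - x\<bar>" by blast
  have "real (2 * j) * d \<le> 2 * (real k + 1) * d" using j d by (intro mult_right_mono) auto
  then have "rr j \<le> 2 * R" using dk by (simp add: rr_def)
  moreover have "R \<le> rr j" using d by (simp add: rr_def)
  ultimately show ?thesis using j that[of "rr j"] by (simp add: d_def k_def)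
qed

text \<open>The entries of \<open>xs\<close> are moduli of zeros. The separation is the one that the preceding lemma
  provides when \<open>K\<close> is the length of a list that contains \<open>xs\<close>.\<close>

definition away :: "real \<Rightarrow> real list \<Rightarrow> nat \<Rightarrow> real \<Rightarrow> bool" where
  "away R xs K r \<longleftrightarrow> length xs \<le> K \<and> R \<le> r \<and> r \<le> 2 * R \<and>
     (\<forall>x\<in>set xs. R / (2 * (real K + 1)) \<le> \<bar>r - x\<bar>)"

lemma away_subset: "away R ys K r \<Longrightarrow> set xs \<subseteq> set ys \<Longrightarrow> length xs \<le> length ys \<Longrightarrow> away R xs K r"
  unfolding away_def by auto

text \<open>In the factorization F'/F is the sum of 1/(z - a) plus h'. With d = R / (2 (K + 1)) as
  distance to all zeros, each summand is at most 1/d. Since |a| \<le> 4 R, each factor |1 - z/a| is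
  at least d / (4 R) = 1 / (8 (K + 1)), which bounds F from below. \<open>K\<close> may exceed the
  number of zeros of this F: later it counts the zeros of several functions that share one
  circle.\<close>

lemma good_circle_aux:
  assumes R: "R \<ge> 1" and hol: "F holomorphic_on ball 0 (14 * R)" and F0: "F 0 \<noteq> 0"
    and bd: "\<And>z. z \<in> ball 0 (14 * R) \<Longrightarrow> cmod (F z) \<le> exp L" and M: "L - ln (cmod (F 0)) < M"
  obtains xs :: "real list" where "real (length xs) \<le> 2 * M"
    "\<And>K r z. away R xs K r \<Longrightarrow> cmod z = r \<Longrightarrow>
      F z \<noteq> 0 \<and> cmod (deriv F z / F z) \<le> 2 * (real K + 1)\<^sup>2 + 6 * M \<and>
      cmod (F 0) * exp (- 6 * M) \<le> cmod (F z) * (8 * (real K + 1)) ^ length xs"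
proof -
  \<comment> \<open>With parameter 2 R the bound on h' reaches every radius between R and 2 R. The
    large disc then has radius 7 * 2 R, which is the origin of 14 R from here on.\<close>
  have r: "2 * R > 0" using R by simp
  obtain as h where h: "h holomorphic_on ball 0 (2 * (2 * R))"
    "\<And>z. z \<in> ball 0 (2 * (2 * R)) \<Longrightarrow> F z = zprod as z * exp (h z)"
    "\<And>a. a \<in> set as \<Longrightarrow> a \<noteq> 0 \<and> F a = 0 \<and> cmod a \<le> 2 * (2 * R)"
    "real (length as) \<le> 2 * M"
    "\<And>z. cmod z \<le> 3/2 * (2 * R) \<Longrightarrow> cmod (h z - h 0) \<le> 6 * M"
    "\<And>z. cmod z \<le> 2 * R \<Longrightarrow> cmod (deriv h z) \<le> 12 * M / (2 * R)"
    by (rule local_factor[where r = "2 * R" and F = F and L = L and M = M])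
      (use r F0 M hol bd in \<open>auto simp: mult.assoc\<close>)
  have "ln (cmod (F 0)) \<le> L" using R by (intro ln_cmod_le F0 bd) simp
  then have Mpos: "M > 0" using M by linarith
  show ?thesis
  proof (rule that[of "map cmod as"])
    show "real (length (map cmod as)) \<le> 2 * M" using h(4) by simp
  next
    fix K r z
    assume aw: "away R (map cmod as) K r" and z: "cmod z = r"
    have K: "length (map cmod as) \<le> K" and rR: "R \<le> r" "r \<le> 2 * R"
      and sep: "\<And>x. x \<in> set (map cmod as) \<Longrightarrow> R / (2 * (real K + 1)) \<le> \<bar>r - x\<bar>"
      using aw unfolding away_def by blast+
    define d where "d = R / (2 * (real K + 1))"
    have d: "d > 0" using R by (simp add: d_def)
    have dist: "d \<le> cmod (z - a)" if "a \<in> set as" for a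
    proof -
      have "d \<le> \<bar>r - cmod a\<bar>" unfolding d_def using that by (intro sep) auto
      also have "\<dots> \<le> cmod (z - a)" using norm_triangle_ineq3[of z a] z by simp
      finally show ?thesis .
    qed
    have ne: "a \<noteq> 0 \<and> z \<noteq> a" if "a \<in> set as" for a
      using dist[OF that] d h(3)[OF that] by auto
    have zB: "z \<in> ball 0 (2 * (2 * R))" using z rR R by simp
    have Fz: "F z = zprod as z * exp (h z)" using h(2)[OF zB] .
    have zp: "zprod as z \<noteq> 0" using ne by (auto simp: zprod_eq_0_iff)
    have F_nz: "F z \<noteq> 0" using Fz zp by simp
    have "(h has_field_derivative deriv h z) (at z)" using h(1) zB by (intro holomorphic_derivI[OF h(1)]) auto
    then have "((\<lambda>z. zprod as z * exp (h z)) has_field_derivative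
       (zprod as z * (\<Sum>a\<leftarrow>as. 1 / (z - a)) * exp (h z) + exp (h z) * deriv h z * zprod as z)) (at z)"
      using zprod_has_derivative[of as z] ne by (auto intro!: derivative_eq_intros)
    then have "(F has_field_derivative
       (zprod as z * (\<Sum>a\<leftarrow>as. 1 / (z - a)) * exp (h z) + exp (h z) * deriv h z * zprod as z)) (at z)"
      by (rule has_field_derivative_transform_within_open[where S = "ball 0 (2 * (2 * R))"])
        (use zB h(2) in auto)
    then have "deriv F z = F z * ((\<Sum>a\<leftarrow>as. 1 / (z - a)) + deriv h z)"
      unfolding Fz by (simp add: DERIV_imp_deriv algebra_simps)
    then have quot: "deriv F z / F z = (\<Sum>a\<leftarrow>as. 1 / (z - a)) + deriv h z" using F_nz by simp
    have "cmod (\<Sum>a\<leftarrow>bs. 1 / (z - a)) \<le> real (length bs) * (1 / d)" if "set bs \<subseteq> set as" for bs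
      using that
    proof (induction bs)
      case (Cons a bs)
      have "cmod (1 / (z - a)) \<le> 1 / d"
        using dist[of a] Cons.prems d by (auto simp: norm_divide intro!: divide_left_mono mult_pos_pos)
      then show ?case using Cons norm_triangle_ineq[of "1 / (z - a)" "\<Sum>a\<leftarrow>bs. 1 / (z - a)"]
        by (simp add: algebra_simps add_divide_distrib)
    qed simp
    then have "cmod (\<Sum>a\<leftarrow>as. 1 / (z - a)) \<le> real (length as) * (1 / d)" by blast
    also have "\<dots> \<le> (real K + 1) * (2 * (real K + 1))"
    proof (rule mult_mono)
      show "1 / d \<le> 2 * (real K + 1)" using R by (simp add: d_def divide_simps)
    qed (use K d in auto)
    finally have s1: "cmod (\<Sum>a\<leftarrow>as. 1 / (z - a)) \<le> 2 * (real K + 1)\<^sup>2" by (simp add: power2_eq_square algebra_simps)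
    have "cmod (deriv h z) \<le> 12 * M / (2 * R)" using h(6)[of z] z rR by simp
    also have "\<dots> \<le> 6 * M" using Mpos R by (simp add: divide_simps)
    finally have s2: "cmod (deriv F z / F z) \<le> 2 * (real K + 1)\<^sup>2 + 6 * M"
      unfolding quot using s1 norm_triangle_ineq[of "\<Sum>a\<leftarrow>as. 1 / (z - a)" "deriv h z"] by linarith
    have "1 / (8 * (real K + 1)) \<le> cmod (1 - z / a)" if a: "a \<in> set as" for a
    proof -
      have ca: "cmod a > 0" "cmod a \<le> 4 * R" using h(3)[OF a] by auto
      have "1 / (8 * (real K + 1)) = d / (4 * R)" using R by (simp add: d_def)
      also have "\<dots> \<le> cmod (z - a) / cmod a" using dist[OF a] ca d by (intro frac_le) auto
      also have "\<dots> = cmod (1 - z / a)"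
        using ca by (simp add: norm_divide[symmetric] diff_divide_distrib norm_minus_commute)
      finally show ?thesis .
    qed
    then have zg: "(1 / (8 * (real K + 1))) ^ length as \<le> cmod (zprod as z)" by (intro zprod_ge) auto
    have "F 0 = exp (h 0)" using h(2)[of 0] R by simp
    then have F0e: "cmod (F 0) = exp (Re (h 0))" by simp
    have "Re (h 0) - 6 * M \<le> Re (h z)"
      using h(5)[of z] z rR R abs_Re_le_cmod[of "h z - h 0"] by auto
    then have "cmod (F 0) * exp (- 6 * M) \<le> exp (Re (h z))"
      unfolding F0e by (simp flip: exp_add)
    also have "\<dots> = (1 / (8 * (real K + 1))) ^ length as * exp (Re (h z)) * (8 * (real K + 1)) ^ length as"
      by (simp add: power_one_over field_simps)
    also have "\<dots> \<le> cmod (zprod as z) * exp (Re (h z)) * (8 * (real K + 1)) ^ length as"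
      by (intro mult_right_mono zg) auto
    also have "cmod (zprod as z) * exp (Re (h z)) = cmod (F z)" unfolding Fz by (simp add: norm_mult)
    finally have s3: "cmod (F 0) * exp (- 6 * M) \<le> cmod (F z) * (8 * (real K + 1)) ^ length (map cmod as)" by simp
    show "F z \<noteq> 0 \<and> cmod (deriv F z / F z) \<le> 2 * (real K + 1)\<^sup>2 + 6 * M \<and>
      cmod (F 0) * exp (- 6 * M) \<le> cmod (F z) * (8 * (real K + 1)) ^ length (map cmod as)"
      using F_nz s2 s3 by blast
  qed
qed

text \<open>A zero of order m at the origin is split off, so that G 0 can serve as the
  normalization; it adds m/z to the logarithmic derivative, at most m for |z| \<ge> 1.\<close>

lemma good_circle:
  assumes R: "R \<ge> 1" and hol: "G holomorphic_on ball 0 (14 * R)" and F0: "G 0 \<noteq> 0"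
    and F: "\<And>z. z \<in> ball 0 (14 * R) \<Longrightarrow> F z = z ^ m * G z"
    and bd: "\<And>z. z \<in> ball 0 (14 * R) \<Longrightarrow> cmod (F z) \<le> exp L" and M: "L - ln (cmod (G 0)) < M"
  obtains xs :: "real list" where "real (length xs) \<le> 2 * M"
    "\<And>K r z. away R xs K r \<Longrightarrow> cmod z = r \<Longrightarrow>
      F z \<noteq> 0 \<and> cmod (deriv F z / F z) \<le> real m + 2 * (real K + 1)\<^sup>2 + 6 * M \<and>
      cmod (G 0) * exp (- 6 * M) \<le> cmod (F z) * (8 * (real K + 1)) ^ length xs"
proof -
  have bd1: "cmod (G z) \<le> exp L" if "z \<in> ball 0 (14 * R)" for z
    using cmod_power_quotient_le[OF _ hol _ that, of m "exp L"] bd F R by force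
  obtain xs :: "real list" where xs: "real (length xs) \<le> 2 * M"
    "\<And>K r z. away R xs K r \<Longrightarrow> cmod z = r \<Longrightarrow>
      G z \<noteq> 0 \<and> cmod (deriv G z / G z) \<le> 2 * (real K + 1)\<^sup>2 + 6 * M \<and>
      cmod (G 0) * exp (- 6 * M) \<le> cmod (G z) * (8 * (real K + 1)) ^ length xs"
    using good_circle_aux[OF R hol F0 bd1 M] by blast
  show ?thesis
  proof (rule that[OF xs(1)])
    fix K r z
    assume aw: "away R xs K r" and z: "cmod z = r"
    note G = xs(2)[OF aw z]
    have a: "R \<le> r" "r \<le> 2 * R" using aw by (auto simp: away_def)
    have zB: "z \<in> ball 0 (14 * R)" and z0: "z \<noteq> 0" and z1: "cmod z \<ge> 1" using a z R by auto
    have Fz: "F z = z ^ m * G z" by (rule F[OF zB])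
    have D1: "(G has_field_derivative deriv G z) (at z)" using zB by (intro holomorphic_derivI[OF hol]) auto
    have "((\<lambda>z. z ^ m * G z) has_field_derivative (of_nat m * z ^ (m - 1) * G z + deriv G z * z ^ m)) (at z)"
      by (auto intro!: derivative_eq_intros D1)
    then have "(F has_field_derivative (of_nat m * z ^ (m - 1) * G z + deriv G z * z ^ m)) (at z)"
      by (rule has_field_derivative_transform_within_open[where S = "ball 0 (14 * R)"])
        (use zB F in auto)
    then have "deriv F z = of_nat m * z ^ (m - 1) * G z + deriv G z * z ^ m" by (rule DERIV_imp_deriv)
    also have "\<dots> = F z * (of_nat m / z + deriv G z / G z)"
      using z0 G unfolding Fz by (cases m) (auto simp: field_simps)
    finally have "deriv F z / F z = of_nat m / z + deriv G z / G z" using G z0 Fz by simp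
    moreover have "cmod (of_nat m / z) \<le> real m" using z1 mult_left_mono[of 1 "cmod z" "real m"] by (simp add: norm_divide divide_le_eq)
    ultimately have 1: "cmod (deriv F z / F z) \<le> real m + 2 * (real K + 1)\<^sup>2 + 6 * M"
      unfolding \<open>deriv F z / F z = _\<close>
      using G[THEN conjunct2, THEN conjunct1] norm_triangle_ineq[of "of_nat m / z" "deriv G z / G z"] by linarith
    have "cmod (G z) \<le> cmod (F z)"
      using z1 mult_right_mono[of 1 "cmod z ^ m" "cmod (G z)"] by (simp add: Fz norm_mult norm_power)
    then have "cmod (G z) * (8 * (real K + 1)) ^ length xs \<le> cmod (F z) * (8 * (real K + 1)) ^ length xs"
      by (intro mult_right_mono) auto
    then show "F z \<noteq> 0 \<and> cmod (deriv F z / F z) \<le> real m + 2 * (real K + 1)\<^sup>2 + 6 * M \<and>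
      cmod (G 0) * exp (- 6 * M) \<le> cmod (F z) * (8 * (real K + 1)) ^ length xs"
      using G[THEN conjunct2, THEN conjunct2] G[THEN conjunct1] 1 Fz z0
      by (intro conjI) (simp, assumption, rule order_trans)
  qed
qed

subsection \<open>Solutions of the differential equation\<close>

lemma entire_factor_zero:
  assumes hol: "F holomorphic_on UNIV" and nz: "\<exists>z. F z \<noteq> 0"
  obtains m F1 where "F1 holomorphic_on UNIV" "F1 0 \<noteq> 0" "\<And>z. F z = z ^ m * F1 z"
proof -
  define n where "n = nat (zorder F 0)"
  define g where "g = zor_poly F 0"
  have "\<exists>w\<in>UNIV. F w \<noteq> 0" using nz by blast
  from zorder_exist_zero[OF hol open_UNIV connected_UNIV UNIV_I this, of 0]
  have "\<exists>r>0. g holomorphic_on cball 0 r \<and> (\<forall>w\<in>cball 0 r. F w = g w * (w - 0) ^ n \<and> g w \<noteq> 0)"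
    unfolding n_def g_def by blast
  then obtain r where r: "r > 0" "g holomorphic_on cball 0 r"
    "\<And>w. w \<in> cball 0 r \<Longrightarrow> F w = g w * w ^ n \<and> g w \<noteq> 0" by auto
  define F1 where "F1 = (\<lambda>z. if z = 0 then g 0 else F z / z ^ n)"
  have 1: "F1 holomorphic_on ball 0 r"
  proof (rule holomorphic_transform)
    show "g holomorphic_on ball 0 r" using r(2) ball_subset_cball holomorphic_on_subset by blast
    show "g z = F1 z" if "z \<in> ball 0 r" for z
      using r(3)[of z] that by (auto simp: F1_def)
  qed
  have 2: "F1 holomorphic_on - {0}"
  proof (rule holomorphic_transform)
    show "(\<lambda>z. F z / z ^ n) holomorphic_on - {0}"
      by (intro holomorphic_intros holomorphic_on_subset[OF hol]) auto
  qed (auto simp: F1_def)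
  have "ball 0 r \<union> - {0} = (UNIV :: complex set)" using r(1) by auto
  then have "F1 holomorphic_on UNIV" using holomorphic_on_Un[OF 1 2] by auto
  moreover have "F1 0 \<noteq> 0" using r(3)[of 0] r(1) by (simp add: F1_def)
  moreover have "F z = z ^ n * F1 z" for z
    using r(3)[of 0] r(1) by (cases "z = 0") (auto simp: F1_def)
  ultimately show ?thesis using that by blast
qed

lemma entire_has_derivative:
  assumes "F holomorphic_on UNIV"
  shows "(F has_field_derivative deriv F z) (at z)"
  using holomorphic_derivI[OF assms open_UNIV UNIV_I] .

lemma entire_deriv: "F holomorphic_on UNIV \<Longrightarrow> deriv F holomorphic_on UNIV"
  by (rule holomorphic_deriv) auto

text \<open>Gronwall's inequality for the energy, along segments.\<close>

lemma ode_growth: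
  assumes sol: "entire_solution A f" and C: "\<And>w. cmod (w - a) \<le> \<rho> \<Longrightarrow> cmod (A w) \<le> C"
    and z: "cmod (z - a) \<le> \<rho>"
  shows "(cmod (f z))\<^sup>2 \<le> ((cmod (f a))\<^sup>2 + (cmod (deriv f a))\<^sup>2) * exp ((1 + C) * cmod (z - a))"
proof -
  have hol: "f holomorphic_on UNIV" and eq: "\<And>z. deriv (deriv f) z = - A z * f z"
    using sol by (auto simp: entire_solution_def eq_neg_iff_add_eq_0)
  have rho: "\<rho> \<ge> 0" using z norm_ge_zero order_trans by blast
  have C0: "C \<ge> 0" using order_trans[OF norm_ge_zero C[of a]] rho by simp
  define t where "t = cmod (z - a)"
  define e where "e = cis (Arg (z - a))"
  have ze: "z = a + of_real t * e" using rcis_cmod_Arg[of "z - a"] by (simp add: t_def e_def rcis_def)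
  have e1: "cmod e = 1" by (simp add: e_def)
  define g where "g = (\<lambda>s. f (a + of_real s * e))"
  define k where "k = (\<lambda>s. deriv f (a + of_real s * e))"
  define g' where "g' = (\<lambda>s. deriv f (a + of_real s * e) * e)"
  define k' where "k' = (\<lambda>s. deriv (deriv f) (a + of_real s * e) * e)"
  have lin: "((\<lambda>s. a + of_real s * e) has_vector_derivative e) (at s)" for s
    by (auto intro!: derivative_eq_intros)
  have dg: "(g has_vector_derivative g' s) (at s)" for s
    using field_vector_diff_chain_at[OF lin entire_has_derivative[OF hol], of s]
    by (simp add: g_def g'_def o_def mult.commute)
  have dk: "(k has_vector_derivative k' s) (at s)" for s
    using field_vector_diff_chain_at[OF lin entire_has_derivative[OF entire_deriv[OF hol]], of s]
    by (simp add: k_def k'_def o_def mult.commute)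
  have Re_D: "((\<lambda>s. Re (q s)) has_real_derivative Re q') (at s)"
    and Im_D: "((\<lambda>s. Im (q s)) has_real_derivative Im q') (at s)"
    if "(q has_vector_derivative q') (at s)" for q q' s
    using bounded_linear.has_vector_derivative[OF bounded_linear_Re that]
      bounded_linear.has_vector_derivative[OF bounded_linear_Im that]
    by (auto simp: has_real_derivative_iff_has_vector_derivative)
  define \<phi> where "\<phi> = (\<lambda>s. (cmod (g s))\<^sup>2 + (cmod (k s))\<^sup>2)"
  define \<phi>' where "\<phi>' = (\<lambda>s. 2 * (g s \<bullet> g' s) + 2 * (k s \<bullet> k' s))"
  have d\<phi>: "(\<phi> has_real_derivative \<phi>' s) (at s)" for s
    unfolding \<phi>_def \<phi>'_def cmod_power2 inner_complex_def
    by (rule derivative_eq_intros Re_D[OF dg] Im_D[OF dg] Re_D[OF dk] Im_D[OF dk] refl)+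
      (simp add: algebra_simps)
  have "\<phi> t * exp (- (1 + C) * t) \<le> \<phi> 0 * exp (- (1 + C) * 0)"
  proof (rule DERIV_nonpos_imp_nonincreasing[where f = "\<lambda>s. \<phi> s * exp (- (1 + C) * s)"])
    fix s assume s: "0 \<le> s" "s \<le> t"
    have "cmod (A (a + of_real s * e)) \<le> C" using s z e1 by (intro C) (simp add: norm_mult t_def)
    then have k'_le: "cmod (k' s) \<le> C * cmod (g s)"
      unfolding k'_def g_def eq by (simp add: norm_mult e1 mult_right_mono)
    have g'_le: "cmod (g' s) = cmod (k s)" by (simp add: g'_def k_def norm_mult e1)
    have "g s \<bullet> g' s \<le> cmod (g s) * cmod (k s)" using norm_cauchy_schwarz[of "g s" "g' s"] g'_le by simp
    moreover have "k s \<bullet> k' s \<le> cmod (k s) * (C * cmod (g s))"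
      using norm_cauchy_schwarz[of "k s" "k' s"] k'_le mult_left_mono[of _ _ "cmod (k s)"] by (meson norm_ge_zero order_trans)
    ultimately have "\<phi>' s \<le> (1 + C) * (2 * cmod (g s) * cmod (k s))" unfolding \<phi>'_def by (simp add: algebra_simps)
    also have "\<dots> \<le> (1 + C) * \<phi> s"
      using C0 sum_squares_bound[of "cmod (g s)" "cmod (k s)"] unfolding \<phi>_def by (intro mult_left_mono) auto
    finally have le: "\<phi>' s - (1 + C) * \<phi> s \<le> 0" by simp
    have "((\<lambda>s. \<phi> s * exp (- (1 + C) * s)) has_real_derivative
       (\<phi>' s - (1 + C) * \<phi> s) * exp (- (1 + C) * s)) (at s)"
      by (rule derivative_eq_intros d\<phi> refl)+ (simp add: algebra_simps)
    moreover have "(\<phi>' s - (1 + C) * \<phi> s) * exp (- (1 + C) * s) \<le> 0" using le by (simp add: mult_nonpos_nonneg)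
    ultimately show "\<exists>y. ((\<lambda>s. \<phi> s * exp (- (1 + C) * s)) has_real_derivative y) (at s) \<and> y \<le> 0" by blast
  qed (simp add: t_def)
  then have "\<phi> t * exp (- ((1 + C) * t)) \<le> \<phi> 0"
    by (simp only: mult_minus_left mult_zero_right minus_zero exp_zero mult_1_right)
  then have "\<phi> t \<le> \<phi> 0 * exp ((1 + C) * t)" using mult_exp_minus_le_iff[of "\<phi> t" "(1 + C) * t" "\<phi> 0"] by simp
  moreover have "(cmod (f z))\<^sup>2 \<le> \<phi> t" using ze by (simp add: \<phi>_def g_def)
  ultimately show ?thesis by (simp add: \<phi>_def g_def k_def t_def)
qed

text \<open>Gronwall with vanishing initial data. Consequently, all zeros of a nontrivial solution
  are simple.\<close>

lemma ode_zero_simple: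
  assumes sol: "entire_solution A f" and A: "A holomorphic_on UNIV" and "f a = 0" "deriv f a = 0"
  shows "f z = 0"
proof -
  obtain C where "\<And>w. cmod (w - a) \<le> cmod (z - a) \<Longrightarrow> cmod (A w) \<le> C"
    using entire_bounded_cball[OF A] by blast
  from ode_growth[where a = a and z = z and \<rho> = "cmod (z - a)" and C = C, OF sol this order_refl] assms show ?thesis by simp
qed

section \<open>The zero-free factor of a solution\<close>

lemma ln_add_one_le_powr:
  fixes x s :: real
  assumes "x \<ge> 1/2" "s > 0"
  shows "ln (1 + x) \<le> 3 powr s / s * x powr s"
proof -
  \<comment> \<open>From x \<ge> 1/2 follows 1 + x \<le> 3 x; the logarithm of 3 x is then compared
    with its power of exponent s.\<close>
  have "ln (1 + x) \<le> ln (3 * x)" using assms by (subst ln_le_cancel_iff) auto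
  also have "\<dots> \<le> (3 * x) powr s / s" using assms by (intro ln_powr_bound) auto
  also have "\<dots> = 3 powr s / s * x powr s" using assms by (simp add: powr_mult)
  finally show ?thesis .
qed

text \<open>Only zeros with |a| \<le> 2 \<rho> enter, so \<rho>/|a| \<ge> 1/2 and the logarithm of
  each factor is at most a constant times (\<rho>/|a|)^s. This holds for every s > 0, and the
  convergent series bounds the sum. Distinctness turns the product over the list into one over its
  set.\<close>

lemma zprod_le:
  assumes "distinct xs" "set xs \<subseteq> Z" "\<And>a. a \<in> set xs \<Longrightarrow> a \<noteq> 0 \<and> cmod a \<le> 2 * \<rho>"
    and sm: "(\<lambda>a. cmod a powr (- s)) summable_on Z" and s: "s > 0" and z: "cmod z \<le> \<rho>" and rho: "\<rho> > 0"
  shows "cmod (zprod xs z) \<le> exp (3 powr s / s * \<rho> powr s * infsum (\<lambda>a. cmod a powr (- s)) Z)"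
proof -
  have "cmod (zprod xs z) \<le> (\<Prod>a\<leftarrow>xs. 1 + \<rho> / cmod a)"
    using assms(3)
  proof (induction xs)
    case (Cons a xs)
    have "cmod (1 - z / a) \<le> 1 + cmod z / cmod a"
      using norm_triangle_ineq4[of 1 "z / a"] by (simp add: norm_divide)
    also have "\<dots> \<le> 1 + \<rho> / cmod a" using z by (simp add: divide_right_mono)
    finally have 1: "cmod (1 - z / a) \<le> 1 + \<rho> / cmod a" .
    have "cmod (1 - z / a) * cmod (zprod xs z) \<le> (1 + \<rho> / cmod a) * (\<Prod>a\<leftarrow>xs. 1 + \<rho> / cmod a)"
      using Cons rho by (intro mult_mono 1) (auto intro!: add_nonneg_nonneg)
    then show ?case by (simp add: norm_mult)
  qed simp
  also have "\<dots> = (\<Prod>a\<in>set xs. 1 + \<rho> / cmod a)" using assms(1) by (rule prod.distinct_set_conv_list[symmetric])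
  also have "\<dots> \<le> (\<Prod>a\<in>set xs. exp (3 powr s / s * \<rho> powr s * cmod a powr (- s)))"
  proof (intro prod_mono conjI)
    fix a assume a: "a \<in> set xs"
    have ca: "cmod a > 0" "cmod a \<le> 2 * \<rho>" using assms(3)[OF a] by auto
    show "0 \<le> 1 + \<rho> / cmod a" using rho by (intro add_nonneg_nonneg) auto
    have "ln (1 + \<rho> / cmod a) \<le> 3 powr s / s * (\<rho> / cmod a) powr s"
      using ca rho s by (intro ln_add_one_le_powr) (auto simp: field_simps)
    also have "(\<rho> / cmod a) powr s = \<rho> powr s * cmod a powr (- s)"
      using ca rho by (simp add: powr_divide powr_minus_divide)
    finally have "exp (ln (1 + \<rho> / cmod a)) \<le> exp (3 powr s / s * \<rho> powr s * cmod a powr (- s))"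
      by (simp add: mult.assoc)
    moreover have "1 + \<rho> / cmod a > 0" using divide_pos_pos[OF rho ca(1)] by linarith
    ultimately show "1 + \<rho> / cmod a \<le> exp (3 powr s / s * \<rho> powr s * cmod a powr (- s))" by simp
  qed
  also have "\<dots> = exp (3 powr s / s * \<rho> powr s * (\<Sum>a\<in>set xs. cmod a powr (- s)))"
    by (simp add: exp_sum sum_distrib_left)
  also have "(\<Sum>a\<in>set xs. cmod a powr (- s)) \<le> infsum (\<lambda>a. cmod a powr (- s)) Z"
    using assms(2) sm by (intro finite_sum_le_infsum) auto
  then have "exp (3 powr s / s * \<rho> powr s * (\<Sum>a\<in>set xs. cmod a powr (- s)))
     \<le> exp (3 powr s / s * \<rho> powr s * infsum (\<lambda>a. cmod a powr (- s)) Z)"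
    using s by (intro iffD2[OF exp_le_cancel_iff] mult_left_mono) auto
  finally show ?thesis .
qed

abbreviation rgrowth :: "(real \<Rightarrow> real) \<Rightarrow> bool" where
  "rgrowth \<equiv> exp_poly_bounded (\<lambda>R. R) {1..}"

lemma rgrowth_def: "rgrowth g \<longleftrightarrow> (\<exists>N. \<forall>R\<ge>1. \<bar>g R\<bar> \<le> exp ((2 + R) ^ N))"
  by (simp add: exp_poly_bounded_def Ball_def)

lemma rgrowth_exp:
  assumes "\<And>R. R \<ge> 1 \<Longrightarrow> g R \<le> c * (2 + R) ^ N"
  shows "rgrowth (\<lambda>R. exp (g R))"
proof -
  obtain p where p: "max c 0 < 2 ^ p" using real_arch_pow[of 2 "max c 0"] by auto
  have "\<bar>exp (g R)\<bar> \<le> exp ((2 + R) ^ (p + N))" if "R \<ge> 1" for R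
  proof -
    have "(2::real) ^ p \<le> (2 + R) ^ p" using that by (intro power_mono) auto
    then have "c * (2 + R) ^ N \<le> (2 + R) ^ p * (2 + R) ^ N" using p that by (intro mult_right_mono) auto
    then show ?thesis using assms[OF that] by (simp add: power_add)
  qed
  then show ?thesis unfolding rgrowth_def by blast
qed

lemma rgrowth_mono: "rgrowth g \<Longrightarrow> (\<And>R. R \<ge> 1 \<Longrightarrow> \<bar>f R\<bar> \<le> g R) \<Longrightarrow> rgrowth f"
  unfolding rgrowth_def by (meson abs_ge_self order_trans)

lemma rgrowth_ident: "rgrowth (\<lambda>R. R)"
  by (rule rgrowth_mono[OF rgrowth_exp[of "\<lambda>R. R" 1 1]]) (auto intro: less_imp_le[OF less_exp])

lemma rgrowth_exp_power: "a \<ge> 0 \<Longrightarrow> rgrowth (\<lambda>R. exp ((2 + a * R) ^ N))"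
proof (rule rgrowth_exp[where c = "(1 + a) ^ N" and N = N])
  fix R :: real assume a: "a \<ge> 0" "R \<ge> 1"
  then have "(2 + a * R) ^ N \<le> ((1 + a) * (2 + R)) ^ N"
    by (intro power_mono) (auto simp: algebra_simps)
  then show "(2 + a * R) ^ N \<le> (1 + a) ^ N * (2 + R) ^ N" by (simp add: power_mult_distrib)
qed

lemma powr_le_power_ceiling: "R \<ge> 1 \<Longrightarrow> R powr s \<le> (2 + R) ^ nat \<lceil>s\<rceil>" for R s :: real
proof -
  assume R: "R \<ge> 1"
  have "R powr s \<le> R powr real (nat \<lceil>s\<rceil>)" using R by (intro powr_mono) linarith+
  also have "\<dots> = R ^ nat \<lceil>s\<rceil>" using R by (simp add: powr_realpow)
  also have "\<dots> \<le> (2 + R) ^ nat \<lceil>s\<rceil>" using R by (intro power_mono) auto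
  finally show ?thesis .
qed

lemma rgrowth_exp_powr: "rgrowth (\<lambda>R. exp (C * R powr s))"
proof (rule rgrowth_exp[where c = "\<bar>C\<bar>" and N = "nat \<lceil>s\<rceil>"])
  fix R :: real assume R: "R \<ge> 1"
  have "C * R powr s \<le> \<bar>C\<bar> * R powr s" by (intro mult_right_mono) auto
  also have "\<dots> \<le> \<bar>C\<bar> * (2 + R) ^ nat \<lceil>s\<rceil>" using powr_le_power_ceiling[OF R] by (intro mult_left_mono) auto
  finally show "C * R powr s \<le> \<bar>C\<bar> * (2 + R) ^ nat \<lceil>s\<rceil>" .
qed

lemmas rgrowth_intros = exp_poly_bounded_intros rgrowth_exp_powr rgrowth_exp_power rgrowth_ident

text \<open>After division by a zero-free factor that depends on the radius \<open>R\<close>, the solution (which may have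
  infinite order) and its derivative grow like functions of finite order, and the solution itself
  grows like the canonical product over its zeros.\<close>

lemma solution_unit:
  assumes sol: "entire_solution A f" and A: "A holomorphic_on UNIV" "fin_growth A"
    and fnz: "\<exists>z. f z \<noteq> 0"
    and f1: "f1 holomorphic_on UNIV" "f1 0 \<noteq> 0" "\<And>z. f z = z ^ m * f1 z"
    and sm: "(\<lambda>a. cmod a powr (- s)) summable_on {z. z \<noteq> 0 \<and> f z = 0}" and s: "s > 0"
  shows "\<exists>N C. C \<ge> 0 \<and> (\<forall>R\<ge>1. \<exists>u. u holomorphic_on ball 0 (14 * R) \<and> (\<forall>z\<in>ball 0 (14 * R). u z \<noteq> 0) \<and>
     u 0 = 1 / f1 0 \<and>
     (\<forall>z\<in>ball 0 (14 * R). cmod (f z * u z) \<le> (15 * R) ^ m * exp (C * R powr s) \<and>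
        cmod (deriv f z * u z) \<le> exp ((2 + R) ^ N)))"
proof -
  have hol: "f holomorphic_on UNIV" using sol by (simp add: entire_solution_def)
  obtain N where N: "\<And>z. cmod (A z) \<le> exp ((2 + cmod z) ^ N)"
    using A unfolding fin_growth_def by blast
  define S where "S = infsum (\<lambda>a. cmod a powr (- s)) {z. z \<noteq> 0 \<and> f z = 0}"
  have S: "S \<ge> 0" unfolding S_def by (intro infsum_nonneg) auto
  define C where "C = 3 powr s / s * 15 powr s * S"
  define \<phi>0 where "\<phi>0 = (cmod (f 0))\<^sup>2 + (cmod (deriv f 0))\<^sup>2"
  \<comment> \<open>Gronwall on the disc of radius 105 R. Here 105 = 7 * 15, because the
    factorization is used with parameter 15 R, so that unit discs around points of the ball of
    radius 14 R still fit.\<close>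
  define L where "L = (\<lambda>R. ln (1 + \<phi>0) + (1 + exp ((2 + 105 * R) ^ N)) * (105 * R))"
  define M where "M = (\<lambda>R. L R - ln (cmod (f1 0)) + 1)"
  have phi0: "\<phi>0 \<ge> 0" by (simp add: \<phi>0_def)
  have main: "\<exists>u. u holomorphic_on ball 0 (14 * R) \<and> (\<forall>z\<in>ball 0 (14 * R). u z \<noteq> 0) \<and>
     u 0 = 1 / f1 0 \<and>
     (\<forall>z\<in>ball 0 (14 * R). cmod (f z * u z) \<le> (15 * R) ^ m * exp (C * R powr s) \<and>
        cmod (deriv f z * u z) \<le> (1 + 12 * M R) * ((15 * R) ^ m * exp (C * R powr s)))"
    if R: "R \<ge> 1" for R
  proof -
    have f_le: "cmod (f z) \<le> exp (L R)" if z: "cmod z \<le> 105 * R" for z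
    proof -
      have "(cmod (f z))\<^sup>2 \<le> ((cmod (f 0))\<^sup>2 + (cmod (deriv f 0))\<^sup>2) * exp ((1 + exp ((2 + 105 * R) ^ N)) * cmod (z - 0))"
      proof (rule ode_growth[OF sol])
        show "cmod (A w) \<le> exp ((2 + 105 * R) ^ N)" if "cmod (w - 0) \<le> 105 * R" for w
          using N[of w] that power_mono[of "2 + cmod w" "2 + 105 * R" N] by (simp add: order_trans[OF N])
      qed (use z in auto)
      \<comment> \<open>The spare -1 pays for x \<le> 1 + x^2, which passes from the square of |f|
        to |f| itself.\<close>
      also have "\<dots> \<le> (1 + \<phi>0) * exp ((1 + exp ((2 + 105 * R) ^ N)) * (105 * R)) - 1"
      proof -
        have "exp ((1 + exp ((2 + 105 * R) ^ N)) * cmod (z - 0)) \<le> exp ((1 + exp ((2 + 105 * R) ^ N)) * (105 * R))"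
          using z by (intro iffD2[OF exp_le_cancel_iff] mult_left_mono) (auto intro: add_nonneg_nonneg)
        then have "\<phi>0 * exp ((1 + exp ((2 + 105 * R) ^ N)) * cmod (z - 0)) \<le> \<phi>0 * exp ((1 + exp ((2 + 105 * R) ^ N)) * (105 * R))"
          using phi0 by (intro mult_left_mono)
        moreover have "1 \<le> exp ((1 + exp ((2 + 105 * R) ^ N)) * (105 * R))" using R by (auto intro!: mult_nonneg_nonneg add_nonneg_nonneg)
        ultimately show ?thesis unfolding \<phi>0_def[symmetric] distrib_right mult_1_left by linarith
      qed
      also have "(1 + \<phi>0) * exp ((1 + exp ((2 + 105 * R) ^ N)) * (105 * R)) = exp (L R)"
        using phi0 by (simp add: L_def exp_add)
      finally have "(cmod (f z))\<^sup>2 \<le> exp (L R) - 1" .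
      moreover have "0 \<le> (cmod (f z) - 1)\<^sup>2 + (cmod (f z))\<^sup>2" by simp
      then have "cmod (f z) \<le> 1 + (cmod (f z))\<^sup>2" by (simp add: power2_eq_square algebra_simps)
      ultimately show ?thesis by linarith
    qed
    have f1_le: "cmod (f1 z) \<le> exp (L R)" if "z \<in> ball 0 (7 * (15 * R))" for z
      using cmod_power_quotient_le[OF _ holomorphic_on_subset[OF f1(1) subset_UNIV] _ that, of m "exp (L R)"] f_le f1(3) R
      by force
    have R15: "15 * R > 0" using R by simp
    obtain xs h where h: "h holomorphic_on ball 0 (2 * (15 * R))"
      "\<And>z. z \<in> ball 0 (2 * (15 * R)) \<Longrightarrow> f1 z = zprod xs z * exp (h z)"
      "\<And>a. a \<in> set xs \<Longrightarrow> a \<noteq> 0 \<and> f1 a = 0 \<and> cmod a \<le> 2 * (15 * R)"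
      "\<And>z. cmod z \<le> 15 * R \<Longrightarrow> cmod (deriv h z) \<le> 12 * M R / (15 * R)"
      "\<exists>G. G holomorphic_on ball 0 (7 * (15 * R)) \<and> (\<forall>z\<in>ball 0 (7 * (15 * R)). f1 z = zprod xs z * G z)"
    proof (rule local_factor[where r = "15 * R" and F = f1 and L = "L R" and M = "M R"])
      show "f1 holomorphic_on ball 0 (7 * (15 * R))" by (rule holomorphic_on_subset[OF f1(1)]) auto
      show "L R - ln (cmod (f1 0)) < M R" by (simp add: M_def)
    qed (use f1(2) f1_le R15 in auto)
    have Mpos: "M R > 0"
      using ln_cmod_le[OF f1(2) f1_le] R by (simp add: M_def)
    \<comment> \<open>A repeated entry would be a zero of \<open>f\<close> and of \<open>f'\<close>,
      which uniqueness for the differential equation excludes.\<close>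
    have dist: "distinct xs"
    proof (rule ccontr)
      assume "\<not> distinct xs"
      then obtain as bs cs a where xs: "xs = as @ [a] @ bs @ [a] @ cs" using not_distinct_decomp by blast
      have a: "a \<noteq> 0" "f1 a = 0" "cmod a \<le> 2 * (15 * R)" using h(3)[of a] xs by auto
      obtain G where G: "G holomorphic_on ball 0 (7 * (15 * R))" "\<And>z. z \<in> ball 0 (7 * (15 * R)) \<Longrightarrow> f1 z = zprod xs z * G z"
        using h(5) by blast
      have aB: "a \<in> ball 0 (7 * (15 * R))" using a R by simp
      define K where "K = (\<lambda>z. z ^ m * (zprod (as @ bs @ cs) z * G z))"
      have "K holomorphic_on ball 0 (7 * (15 * R))" unfolding K_def by (intro holomorphic_intros G)
      then have dK: "(K has_field_derivative deriv K a) (at a)" using aB by (intro holomorphic_derivI) auto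
      have fK: "f z = (1 - z / a) ^ 2 * K z" if "z \<in> ball 0 (7 * (15 * R))" for z
        unfolding f1(3) G(2)[OF that] xs K_def by (simp add: zprod_def power2_eq_square)
      have "((\<lambda>z. (1 - z / a) ^ 2 * K z) has_field_derivative 0) (at a)"
        using a(1) by (auto intro!: derivative_eq_intros dK)
      then have "(f has_field_derivative 0) (at a)"
        by (rule has_field_derivative_transform_within_open[where S = "ball 0 (7 * (15 * R))"])
          (use aB fK in auto)
      then have "deriv f a = 0" by (rule DERIV_imp_deriv)
      moreover have "f a = 0" using a f1(3) by simp
      ultimately show False using ode_zero_simple[OF sol A(1)] fnz by blast
    qed
    \<comment> \<open>This removes exactly the zero-free part: f u is z^m times the finite product
      over the zeros, and \<open>u 0\<close> equals 1 / f1 0 for every radius.\<close>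
    define u where "u = (\<lambda>z. exp (- h z))"
    have sub: "ball 0 (14 * R) \<subseteq> ball 0 (2 * (15 * R))" using R by auto
    have fu: "f z * u z = z ^ m * zprod xs z" if "z \<in> ball 0 (2 * (15 * R))" for z
      unfolding f1(3) h(2)[OF that] u_def by (simp add: exp_minus)
    have q_le: "cmod (z ^ m * zprod xs z) \<le> (15 * R) ^ m * exp (C * R powr s)" if z: "cmod z \<le> 15 * R" for z
    proof -
      have "cmod (zprod xs z) \<le> exp (3 powr s / s * (15 * R) powr s * infsum (\<lambda>a. cmod a powr (- s)) {z. z \<noteq> 0 \<and> f z = 0})"
        using h(3) f1(3) z R s by (intro zprod_le dist sm) auto
      also have "3 powr s / s * (15 * R) powr s * infsum (\<lambda>a. cmod a powr (- s)) {z. z \<noteq> 0 \<and> f z = 0} = C * R powr s"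
        using R by (simp add: C_def S_def powr_mult)
      finally have "cmod (zprod xs z) \<le> exp (C * R powr s)" .
      moreover have "cmod z ^ m \<le> (15 * R) ^ m" using z by (intro power_mono) auto
      ultimately show ?thesis using R unfolding norm_mult norm_power by (intro mult_mono) auto
    qed
    \<comment> \<open>With D = f u one has f' u = D' + h' D. The function h may be as large as log
      |f|, but h' enters only as a factor of size M R, which keeps the growth of finite
      order.\<close>
    have p_le: "cmod (deriv f z * u z) \<le> (1 + 12 * M R) * ((15 * R) ^ m * exp (C * R powr s))"
      if z: "z \<in> ball 0 (14 * R)" for z
    proof -
      define D where "D = (\<lambda>z. z ^ m * zprod xs z)"
      have zB: "z \<in> ball 0 (2 * (15 * R))" using z sub by blast
      have dh: "(h has_field_derivative deriv h z) (at z)" using zB by (intro holomorphic_derivI[OF h(1)]) auto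
      have "((\<lambda>z. f z * u z) has_field_derivative (deriv f z * u z + (u z * (- deriv h z)) * f z)) (at z)"
        unfolding u_def by (intro DERIV_mult entire_has_derivative[OF hol]) (auto intro!: derivative_eq_intros dh)
      then have "(D has_field_derivative (deriv f z * u z + (u z * (- deriv h z)) * f z)) (at z)"
        by (rule has_field_derivative_transform_within_open[where S = "ball 0 (2 * (15 * R))"])
          (use zB fu in \<open>auto simp: D_def\<close>)
      then have "deriv D z = deriv f z * u z - deriv h z * D z"
        using fu[OF zB] by (simp add: DERIV_imp_deriv D_def algebra_simps)
      then have p: "deriv f z * u z = deriv D z + deriv h z * D z" by simp
      have 1: "cmod (deriv D z) \<le> (15 * R) ^ m * exp (C * R powr s)"
      proof (rule cmod_deriv_le)
        show "D holomorphic_on cball z 1" unfolding D_def by (intro holomorphic_intros)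
        fix w assume "cmod (w - z) \<le> 1"
        then have "cmod w \<le> 15 * R" using norm_triangle_ineq2[of w z] z R by simp
        then show "cmod (D w) \<le> (15 * R) ^ m * exp (C * R powr s)" unfolding D_def by (rule q_le)
      qed
      have "cmod (deriv h z) \<le> 12 * M R / (15 * R)" using z R by (intro h(4)) auto
      also have "\<dots> \<le> 12 * M R" using Mpos R by (simp add: divide_simps)
      finally have "cmod (deriv h z) * cmod (D z) \<le> (12 * M R) * ((15 * R) ^ m * exp (C * R powr s))"
        using q_le[of z] z R Mpos unfolding D_def by (intro mult_mono) auto
      then show ?thesis unfolding p using 1 norm_triangle_ineq[of "deriv D z" "deriv h z * D z"]
        by (simp add: norm_mult distrib_right)
    qed
    have "u holomorphic_on ball 0 (14 * R)"
      unfolding u_def by (intro holomorphic_intros holomorphic_on_subset[OF h(1)] sub)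
    moreover have "u 0 = 1 / f1 0" using h(2)[of 0] R by (simp add: u_def exp_minus field_simps)
    moreover have "cmod (f z * u z) \<le> (15 * R) ^ m * exp (C * R powr s)" if "z \<in> ball 0 (14 * R)" for z
      using fu[of z] q_le[of z] that R by auto
    ultimately show ?thesis using p_le by (intro exI[of _ u]) (auto simp: u_def)
  qed
  have "\<exists>N'. \<forall>R\<ge>1. (1 + 12 * M R) * ((15 * R) ^ m * exp (C * R powr s)) \<le> exp ((2 + R) ^ N')"
  proof -
    have "rgrowth M" unfolding M_def L_def by (intro rgrowth_intros) simp
    then have M': "rgrowth (\<lambda>R. M R)" by simp
    have "rgrowth (\<lambda>R. (1 + 12 * M R) * ((15 * R) ^ m * exp (C * R powr s)))"
      by (intro rgrowth_intros M')
    then show ?thesis unfolding rgrowth_def by (meson abs_ge_self order_trans)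
  qed
  then obtain N' where N': "\<And>R. R \<ge> 1 \<Longrightarrow> (1 + 12 * M R) * ((15 * R) ^ m * exp (C * R powr s)) \<le> exp ((2 + R) ^ N')" by blast
  have "C \<ge> 0" using s S by (simp add: C_def)
  show ?thesis
  proof (intro exI[of _ N'] exI[of _ C] conjI allI impI \<open>C \<ge> 0\<close>)
    fix R :: real assume R: "R \<ge> 1"
    obtain u where u: "u holomorphic_on ball 0 (14 * R)" "\<forall>z\<in>ball 0 (14 * R). u z \<noteq> 0" "u 0 = 1 / f1 0"
     "\<And>z. z \<in> ball 0 (14 * R) \<Longrightarrow> cmod (f z * u z) \<le> (15 * R) ^ m * exp (C * R powr s)"
     "\<And>z. z \<in> ball 0 (14 * R) \<Longrightarrow> cmod (deriv f z * u z) \<le> (1 + 12 * M R) * ((15 * R) ^ m * exp (C * R powr s))"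
      using main[OF R] by blast
    show "\<exists>u. u holomorphic_on ball 0 (14 * R) \<and> (\<forall>z\<in>ball 0 (14 * R). u z \<noteq> 0) \<and>
     u 0 = 1 / f1 0 \<and>
     (\<forall>z\<in>ball 0 (14 * R). cmod (f z * u z) \<le> (15 * R) ^ m * exp (C * R powr s) \<and>
        cmod (deriv f z * u z) \<le> exp ((2 + R) ^ N'))"
      by (intro exI[of _ u] conjI ballI u order_trans[OF u(5) N'[OF R]])
  qed
qed

subsection \<open>Estimates on circles that avoid zeros\<close>

text \<open>At most order n and minimal type: the functions negligible against exp (\<zeta> z^n) up
  to factors exp (\<epsilon> r^n). Since \<alpha> < n, \<open>H\<close> belongs to this class, and
  so do the numerators of \<tau> and its derivative.\<close>

definition min_type :: "nat \<Rightarrow> (complex \<Rightarrow> complex) \<Rightarrow> bool" where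
  "min_type n g \<longleftrightarrow> (\<forall>\<epsilon>>0. \<exists>C. \<forall>z. cmod (g z) \<le> C * exp (\<epsilon> * cmod z ^ n))"

lemma min_type_add: "min_type n F \<Longrightarrow> min_type n G \<Longrightarrow> min_type n (\<lambda>z. F z + G z)"
  unfolding min_type_def
proof (intro allI impI)
  fix \<epsilon> :: real assume e: "\<epsilon> > 0" and F: "\<forall>\<epsilon>>0. \<exists>C. \<forall>z. cmod (F z) \<le> C * exp (\<epsilon> * cmod z ^ n)"
    and G: "\<forall>\<epsilon>>0. \<exists>C. \<forall>z. cmod (G z) \<le> C * exp (\<epsilon> * cmod z ^ n)"
  obtain C D where "\<And>z. cmod (F z) \<le> C * exp (\<epsilon> * cmod z ^ n)" "\<And>z. cmod (G z) \<le> D * exp (\<epsilon> * cmod z ^ n)"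
    using F G e by meson
  then have "cmod (F z + G z) \<le> (C + D) * exp (\<epsilon> * cmod z ^ n)" for z
    using norm_triangle_ineq[of "F z" "G z"] by (smt (verit) distrib_right)
  then show "\<exists>C. \<forall>z. cmod (F z + G z) \<le> C * exp (\<epsilon> * cmod z ^ n)" by blast
qed

lemma min_type_mult: "min_type n F \<Longrightarrow> min_type n G \<Longrightarrow> min_type n (\<lambda>z. F z * G z)"
  unfolding min_type_def
proof (intro allI impI)
  fix \<epsilon> :: real assume e: "\<epsilon> > 0" and F: "\<forall>\<epsilon>>0. \<exists>C. \<forall>z. cmod (F z) \<le> C * exp (\<epsilon> * cmod z ^ n)"
    and G: "\<forall>\<epsilon>>0. \<exists>C. \<forall>z. cmod (G z) \<le> C * exp (\<epsilon> * cmod z ^ n)"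
  have e2: "\<epsilon> / 2 > 0" using e by simp
  obtain C D where C: "\<And>z. cmod (F z) \<le> C * exp (\<epsilon> / 2 * cmod z ^ n)" and D: "\<And>z. cmod (G z) \<le> D * exp (\<epsilon> / 2 * cmod z ^ n)"
    using F G e2 by meson
  have "cmod (F z * G z) \<le> (C * D) * exp (\<epsilon> * cmod z ^ n)" for z
  proof -
    have "cmod (F z) * cmod (G z) \<le> (C * exp (\<epsilon> / 2 * cmod z ^ n)) * (D * exp (\<epsilon> / 2 * cmod z ^ n))"
      by (intro mult_mono C D order_trans[OF norm_ge_zero C]) auto
    also have "\<dots> = C * D * (exp (\<epsilon> / 2 * cmod z ^ n) * exp (\<epsilon> / 2 * cmod z ^ n))" by (simp only: mult_ac)
    also have "exp (\<epsilon> / 2 * cmod z ^ n) * exp (\<epsilon> / 2 * cmod z ^ n) = exp (\<epsilon> * cmod z ^ n)" by (simp flip: exp_add)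
    finally show ?thesis by (simp add: norm_mult)
  qed
  then show "\<exists>C. \<forall>z. cmod (F z * G z) \<le> C * exp (\<epsilon> * cmod z ^ n)" by blast
qed

lemma min_type_const: "min_type n (\<lambda>z. c)"
  unfolding min_type_def
proof (intro allI impI)
  fix \<epsilon> :: real assume "\<epsilon> > 0"
  then have "cmod c \<le> cmod c * exp (\<epsilon> * cmod z ^ n)" for z
    using mult_left_mono[of 1 "exp (\<epsilon> * cmod z ^ n)" "cmod c"] by simp
  then show "\<exists>C. \<forall>z::complex. cmod c \<le> C * exp (\<epsilon> * cmod z ^ n)" by blast
qed

lemma min_type_ident: "n > 0 \<Longrightarrow> min_type n (\<lambda>z. z)"
  unfolding min_type_def
proof (intro allI impI)
  fix \<epsilon> :: real assume e: "\<epsilon> > 0" and n: "n > 0"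
  have "cmod z \<le> (1 + 1 / \<epsilon>) * exp (\<epsilon> * cmod z ^ n)" for z :: complex
  proof (cases "cmod z \<ge> 1")
    case True
    have "\<epsilon> * cmod z \<le> \<epsilon> * cmod z ^ n" using True n e by (intro mult_left_mono self_le_power) auto
    also have "\<dots> \<le> exp (\<epsilon> * cmod z ^ n)" by (rule less_imp_le[OF less_exp])
    finally have "cmod z \<le> (1 / \<epsilon>) * exp (\<epsilon> * cmod z ^ n)" using e by (simp add: field_simps)
    then show ?thesis by (simp add: distrib_right add_increasing)
  next
    case False
    have "1 * 1 \<le> (1 + 1 / \<epsilon>) * exp (\<epsilon> * cmod z ^ n)" using e by (intro mult_mono) auto
    then show ?thesis using False by linarith
  qed
  then show "\<exists>C. \<forall>z::complex. cmod z \<le> C * exp (\<epsilon> * cmod z ^ n)" by blast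
qed

lemma min_type_power: "min_type n F \<Longrightarrow> min_type n (\<lambda>z. F z ^ k)"
  by (induction k) (auto intro: min_type_mult min_type_const)

lemma one_add_power_le: "(1 + x) ^ n \<le> 2 ^ n * (1 + x ^ n)" if "x \<ge> 0" for x :: real
proof -
  have "(1 + x) ^ n \<le> (2 * max 1 x) ^ n" using that by (intro power_mono) auto
  also have "\<dots> = 2 ^ n * (max 1 x) ^ n" by (simp only: power_mult_distrib)
  also have "(max 1 x) ^ n \<le> 1 + x ^ n" using that by (auto simp: max_def)
  finally show ?thesis by simp
qed

lemma min_type_deriv:
  assumes hol: "F holomorphic_on UNIV" and F: "min_type n F"
  shows "min_type n (deriv F)"
  unfolding min_type_def
proof (intro allI impI)
  fix \<epsilon> :: real assume e: "\<epsilon> > 0"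
  define \<epsilon>' where "\<epsilon>' = \<epsilon> / 2 ^ n"
  have "\<epsilon>' > 0" using e by (simp add: \<epsilon>'_def)
  then obtain C where C: "\<And>z. cmod (F z) \<le> C * exp (\<epsilon>' * cmod z ^ n)"
    using F unfolding min_type_def by meson
  have C0: "C \<ge> 0" using order_trans[OF norm_ge_zero C[of 0]] by (simp add: zero_le_mult_iff)
  have "cmod (deriv F z) \<le> C * exp \<epsilon> * exp (\<epsilon> * cmod z ^ n)" for z
  proof (rule cmod_deriv_le)
    fix w assume "cmod (w - z) \<le> 1"
    then have "cmod w \<le> 1 + cmod z" using norm_triangle_ineq2[of w z] by linarith
    then have "cmod w ^ n \<le> (1 + cmod z) ^ n" by (intro power_mono) auto
    also have "\<dots> \<le> 2 ^ n * (1 + cmod z ^ n)" by (intro one_add_power_le) auto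
    finally have "\<epsilon>' * cmod w ^ n \<le> \<epsilon> * (1 + cmod z ^ n)"
      using mult_left_mono[of "cmod w ^ n" "2 ^ n * (1 + cmod z ^ n)" \<epsilon>'] e by (simp add: \<epsilon>'_def)
    then have "exp (\<epsilon>' * cmod w ^ n) \<le> exp (\<epsilon> * (1 + cmod z ^ n))" by simp
    then have "C * exp (\<epsilon>' * cmod w ^ n) \<le> C * exp (\<epsilon> * (1 + cmod z ^ n))" using C0 by (intro mult_left_mono)
    then show "cmod (F w) \<le> C * exp \<epsilon> * exp (\<epsilon> * cmod z ^ n)"
      using C[of w] by (simp add: distrib_left exp_add mult.assoc)
  qed (rule holomorphic_on_subset[OF hol], simp)
  then show "\<exists>C. \<forall>z. cmod (deriv F z) \<le> C * exp (\<epsilon> * cmod z ^ n)" by blast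
qed

lemma powr_mult_less_power:
  assumes "\<beta> < real n" "\<epsilon> > 0" "n > 0"
  shows "\<forall>\<^sub>F r in at_top. D + C * r powr \<beta> \<le> \<epsilon> * r ^ n"
proof -
  define C' where "C' = \<bar>C\<bar> + 1"
  have "\<epsilon> / 2 / C' > 0" using assms by (simp add: C'_def)
  from powr_less_power[OF assms(1) this]
  have ev: "\<forall>\<^sub>F r in at_top. r powr \<beta> \<le> \<epsilon> * r ^ n / (2 * C')" by (simp add: field_simps)
  have "\<epsilon> / 2 > 0" using assms by simp
  from const_le_power[OF assms(3) this, of D] ev show ?thesis
  proof eventually_elim
    case (elim r)
    note r = elim(2) elim(1)
    have "C * r powr \<beta> \<le> C' * r powr \<beta>" by (intro mult_right_mono) (auto simp: C'_def)
    also have "\<dots> \<le> C' * (\<epsilon> * r ^ n / (2 * C'))" using r(1) by (intro mult_left_mono) (auto simp: C'_def)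
    also have "\<dots> = \<epsilon> * r ^ n / 2"
    proof -
      have "C' \<noteq> 0" by (simp add: C'_def)
      then show ?thesis by simp
    qed
    finally show ?case using r(2) by linarith
  qed
qed

lemma min_type_powr:
  assumes hol: "F holomorphic_on UNIV" and n: "n > 0" and "\<alpha> < real n"
    and F: "\<And>z. cmod z \<ge> r0 \<Longrightarrow> cmod (F z) \<le> exp (cmod z powr \<alpha>)"
  shows "min_type n F"
  unfolding min_type_def
proof (intro allI impI)
  fix \<epsilon> :: real assume e: "\<epsilon> > 0"
  obtain r1 where r1: "\<And>r. r \<ge> r1 \<Longrightarrow> r powr \<alpha> \<le> \<epsilon> * r ^ n"
    using powr_less_power[OF assms(3) e] by (auto simp: eventually_at_top_linorder)
  obtain C where C: "\<And>z. cmod z \<le> max r0 r1 \<Longrightarrow> cmod (F z) \<le> C"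
    using entire_bounded_cball[OF hol, of 0 "max r0 r1"] by auto
  have "cmod (F z) \<le> max 1 C * exp (\<epsilon> * cmod z ^ n)" for z
  proof (cases "cmod z \<le> max r0 r1")
    case True
    have "max 1 C * 1 \<le> max 1 C * exp (\<epsilon> * cmod z ^ n)" using e by (intro mult_left_mono) auto
    moreover have "cmod (F z) \<le> C" using C True by blast
    ultimately show ?thesis by linarith
  next
    case False
    have "cmod (F z) \<le> exp (\<epsilon> * cmod z ^ n)"
      using F[of z] r1[of "cmod z"] False by (meson exp_le_cancel_iff le_max_iff_disj linear order_trans)
    also have "\<dots> \<le> max 1 C * exp (\<epsilon> * cmod z ^ n)" using mult_right_mono[of 1 "max 1 C" "exp (\<epsilon> * cmod z ^ n)"] by simp
    finally show ?thesis .
  qed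
  then show "\<exists>C. \<forall>z. cmod (F z) \<le> C * exp (\<epsilon> * cmod z ^ n)" by blast
qed

lemma min_type_eventually:
  assumes "min_type n F" "n > 0" "\<epsilon> > 0"
  shows "\<forall>\<^sub>F r in at_top. \<forall>z. cmod z = r \<longrightarrow> cmod (F z) \<le> exp (\<epsilon> * r ^ n)"
proof -
  have "\<epsilon> / 2 > 0" using assms by simp
  then obtain C where C: "\<And>z. cmod (F z) \<le> C * exp (\<epsilon> / 2 * cmod z ^ n)"
    using assms(1) unfolding min_type_def by meson
  from const_le_power[OF assms(2) \<open>\<epsilon> / 2 > 0\<close>, of "\<bar>C\<bar>"] show ?thesis
  proof eventually_elim
    case (elim r)
    show ?case
    proof (intro allI impI)
      fix z :: complex assume z: "cmod z = r"
      have "C \<le> exp (\<epsilon> / 2 * r ^ n)" using elim less_exp[of "\<epsilon> / 2 * r ^ n"] by linarith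
      then have "C * exp (\<epsilon> / 2 * r ^ n) \<le> exp (\<epsilon> / 2 * r ^ n) * exp (\<epsilon> / 2 * r ^ n)" by (intro mult_right_mono) auto
      also have "\<dots> = exp (\<epsilon> * r ^ n)" by (simp flip: exp_add distrib_right)
      finally show "cmod (F z) \<le> exp (\<epsilon> * r ^ n)" using C[of z] z by simp
    qed
  qed
qed

lemma poly_le_power:
  fixes c d :: real
  shows "\<exists>N'. \<forall>R\<ge>1. c + d * (2 + R) ^ N \<le> (2 + R) ^ N'"
proof -
  obtain p where p: "max 0 c + max 0 d < 2 ^ p" using real_arch_pow[of 2 "max 0 c + max 0 d"] by auto
  have "c + d * (2 + R) ^ N \<le> (2 + R) ^ (p + N)" if "R \<ge> 1" for R
  proof -
    have 1: "1 \<le> (2 + R) ^ N" using that by (intro one_le_power) auto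
    have "c \<le> max 0 c * (2 + R) ^ N" using mult_left_mono[OF 1, of "max 0 c"] by simp
    moreover have "d * (2 + R) ^ N \<le> max 0 d * (2 + R) ^ N" using 1 by (intro mult_right_mono) auto
    ultimately have "c + d * (2 + R) ^ N \<le> (max 0 c + max 0 d) * (2 + R) ^ N" by (simp add: distrib_right)
    also have "\<dots> \<le> (2 + R) ^ p * (2 + R) ^ N"
      using p power_mono[of 2 "2 + R" p] that by (intro mult_right_mono) auto
    finally show ?thesis by (simp add: power_add)
  qed
  then show ?thesis by blast
qed

lemma poly_le_exp:
  fixes \<epsilon> :: real
  assumes "n > 0" "\<epsilon> > 0"
  shows "\<forall>\<^sub>F R in at_top. (2 + R) ^ N \<le> exp (\<epsilon> * R ^ n)"
proof -
  have "((\<lambda>R::real. (2 + R) ^ N / exp (\<epsilon> * R)) \<longlongrightarrow> 0) at_top"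
    using assms by real_asymp
  then have "\<forall>\<^sub>F R in at_top. (2 + R) ^ N / exp (\<epsilon> * R) < 1" by (rule order_tendstoD) auto
  then show ?thesis using eventually_ge_at_top[of 1]
  proof eventually_elim
    case (elim R)
    have "(2 + R) ^ N \<le> exp (\<epsilon> * R)" using elim(1) by (simp add: divide_simps)
    also have "\<dots> \<le> exp (\<epsilon> * R ^ n)" using elim(2) assms by (auto intro!: self_le_power)
    finally show ?case .
  qed
qed

text \<open>A logarithmic derivative estimate with the denominator multiplied out, so that it also
  makes sense for g = 0; the flag records whether nonvanishing is claimed. \<open>Q\<close> bounds
  both the number of moduli to be avoided and the error term.\<close>

definition controlled :: "bool \<Rightarrow> real \<Rightarrow> real \<Rightarrow> (complex \<Rightarrow> complex) \<Rightarrow> real list \<Rightarrow> bool" where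
  "controlled b R Q g xs \<longleftrightarrow> real (length xs) \<le> Q \<and> (\<forall>K r z. away R xs K r \<longrightarrow> cmod z = r \<longrightarrow>
     (b \<longrightarrow> g z \<noteq> 0) \<and> cmod (deriv g z) \<le> (2 * (real K + 1)\<^sup>2 + Q) * cmod (g z))"

text \<open>The multiplier u R changes with the radius, but its value at 0 does not. The lower
  normalization in \<open>good_circle\<close> is thus the same for all radii, and the bounds depend
  on R only through a power of 2 + R.\<close>

lemma good_family:
  assumes g: "g holomorphic_on UNIV" and c0: "c0 \<noteq> 0"
    and u: "\<And>R. R \<ge> 1 \<Longrightarrow> u R holomorphic_on ball 0 (14 * R)"
       "\<And>R. R \<ge> 1 \<Longrightarrow> u R 0 = c0"
    and bd: "\<And>R z. R \<ge> 1 \<Longrightarrow> z \<in> ball 0 (14 * R) \<Longrightarrow> cmod (g z * u R z) \<le> exp ((2 + R) ^ N)"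
  shows "\<exists>N'. \<forall>R\<ge>1. \<exists>xs. controlled (\<exists>z. g z \<noteq> 0) R ((2 + R) ^ N') (\<lambda>z. g z * u R z) xs"
proof (cases "\<exists>z. g z \<noteq> 0")
  case False
  then have "g z = 0" for z by blast
  then show ?thesis by (intro exI[of _ 0] allI impI exI[of _ "[]"]) (auto simp: controlled_def)
next
  case True
  obtain m g1 where g1: "g1 holomorphic_on UNIV" "g1 0 \<noteq> 0" "\<And>z. g z = z ^ m * g1 z"
    using entire_factor_zero[OF g True] by blast
  define c where "c = 1 - ln (cmod (g1 0 * c0))"
  obtain N' where N': "\<And>R. R \<ge> 1 \<Longrightarrow> (real m + \<bar>6 * c\<bar>) + 6 * (2 + R) ^ N \<le> (2 + R) ^ N'"
    using poly_le_power by blast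
  show ?thesis
  proof (intro exI[of _ N'] allI impI)
    fix R :: real assume R: "R \<ge> 1"
    define M where "M = c + (2 + R) ^ N"
    have N0: "(2 + R) ^ N \<ge> 0" using R by simp
    have "2 * c \<le> real m + \<bar>6 * c\<bar>" by (cases "c \<ge> 0") auto
    moreover have "6 * c \<le> \<bar>6 * c\<bar>" by (rule abs_ge_self)
    moreover have "X \<ge> 0 \<Longrightarrow> t + 6 * X \<le> Y \<Longrightarrow> 2 * c \<le> t \<Longrightarrow> 2 * (c + X) \<le> Y" for t X Y :: real by simp
    moreover have "k + a + 6 * X \<le> Y \<Longrightarrow> 6 * c \<le> a \<Longrightarrow> k + 6 * (c + X) \<le> Y" for k a X Y :: real by simp
    ultimately have MN1: "2 * M \<le> (2 + R) ^ N'" and MN2: "real m + 6 * M \<le> (2 + R) ^ N'"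
      using N'[OF R] N0 unfolding M_def by blast+
    obtain xs :: "real list" where xs: "real (length xs) \<le> 2 * M"
    "\<And>K r z. away R xs K r \<Longrightarrow> cmod z = r \<Longrightarrow>
      g z * u R z \<noteq> 0 \<and> cmod (deriv (\<lambda>z. g z * u R z) z / (g z * u R z)) \<le> real m + 2 * (real K + 1)\<^sup>2 + 6 * M"
    proof (rule good_circle[where G = "\<lambda>z. g1 z * u R z" and F = "\<lambda>z. g z * u R z" and m = m and R = R and L = "(2 + R) ^ N" and M = M])
      show "(\<lambda>z. g1 z * u R z) holomorphic_on ball 0 (14 * R)"
        by (intro holomorphic_intros holomorphic_on_subset[OF g1(1)] u R) auto
      show "g1 0 * u R 0 \<noteq> 0" using g1(2) c0 u(2)[OF R] by simp
      show "(2 + R) ^ N - ln (cmod (g1 0 * u R 0)) < M" using u(2)[OF R] by (simp add: M_def c_def)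
    qed (use R bd g1(3) in \<open>auto simp: mult.assoc\<close>)
    show "\<exists>xs. controlled (\<exists>z. g z \<noteq> 0) R ((2 + R) ^ N') (\<lambda>z. g z * u R z) xs"
      unfolding controlled_def
    proof (intro exI[of _ xs] conjI allI impI)
      show "real (length xs) \<le> (2 + R) ^ N'" using xs(1) MN1 by linarith
      fix K r z assume a: "away R xs K r" "cmod z = r"
      have *: "g z * u R z \<noteq> 0 \<and> cmod (deriv (\<lambda>z. g z * u R z) z / (g z * u R z)) \<le> real m + 2 * (real K + 1)\<^sup>2 + 6 * M"
        by (rule xs(2)[OF a])
      then show "g z * u R z \<noteq> 0" by blast
      have "cmod (deriv (\<lambda>z. g z * u R z) z) / cmod (g z * u R z) \<le> 2 * (real K + 1)\<^sup>2 + (2 + R) ^ N'"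
        using * MN2 unfolding norm_divide by linarith
      then show "cmod (deriv (\<lambda>z. g z * u R z) z) \<le> (2 * (real K + 1)\<^sup>2 + (2 + R) ^ N') * cmod (g z * u R z)"
        using * by (simp only: pos_divide_le_eq zero_less_norm_iff simp_thms)
    qed
  qed
qed

text \<open>For \<open>H\<close> the polynomial count of \<open>good_family\<close> is too weak,
  since H must also be bounded from below by exp (- \<epsilon> r^n). The number of zeros here is of
  order R^\<alpha>, so the product (8 (K + 1))^length costs only R^\<alpha> times a logarithm in the
  exponent, as long as \<open>K\<close> is polynomial in R.\<close>

lemma small_order_circle:
  assumes H: "H holomorphic_on UNIV" "\<exists>z. H z \<noteq> 0" and alpha: "\<alpha> > 0"
    and bd: "\<And>z. cmod z \<ge> r0 \<Longrightarrow> cmod (H z) \<le> exp (cmod z powr \<alpha>)"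
  shows "\<exists>C\<ge>0. \<forall>R\<ge>1. \<exists>xs. controlled True R (C * R powr \<alpha>) H xs \<and> (\<forall>K r z. away R xs K r \<longrightarrow> cmod z = r \<longrightarrow>
      1 \<le> cmod (H z) * (exp (C * R powr \<alpha>) * (8 * (real K + 1)) ^ length xs))"
proof -
  obtain m g1 where g1: "g1 holomorphic_on UNIV" "g1 0 \<noteq> 0" "\<And>z. H z = z ^ m * g1 z"
    using entire_factor_zero[OF H] by blast
  obtain D where D: "\<And>z. cmod z \<le> r0 \<Longrightarrow> cmod (H z) \<le> D"
    using entire_bounded_cball[OF H(1), of 0 r0] by auto
  define l where "l = \<bar>ln (cmod (g1 0))\<bar>"
  define C where "C = real m + 6 * (\<bar>D\<bar> + 14 powr \<alpha> + l + 1) + l"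
  have C0: "C \<ge> 0" by (auto simp: C_def l_def intro!: add_nonneg_nonneg mult_nonneg_nonneg)
  have main: "\<exists>xs. controlled True R (C * R powr \<alpha>) H xs \<and> (\<forall>K r z. away R xs K r \<longrightarrow> cmod z = r \<longrightarrow>
      1 \<le> cmod (H z) * (exp (C * R powr \<alpha>) * (8 * (real K + 1)) ^ length xs))" if R: "R \<ge> 1" for R
  proof -
    define L where "L = \<bar>D\<bar> + (14 * R) powr \<alpha>"
    define M where "M = L + l + 1"
    have R1: "R powr \<alpha> \<ge> 1" using R alpha by (simp add: ge_one_powr_ge_zero)
    have L_eq: "L = \<bar>D\<bar> + 14 powr \<alpha> * R powr \<alpha>" using R by (simp add: L_def powr_mult)
    have CM: "real m + 6 * M + l \<le> C * R powr \<alpha>"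
    proof -
      define E where "E = real m + 6 * (\<bar>D\<bar> + l + 1) + l"
      have "E \<ge> 0" by (auto simp: E_def l_def intro!: add_nonneg_nonneg mult_nonneg_nonneg)
      then have "E \<le> E * R powr \<alpha>" using R1 mult_left_mono[of 1 "R powr \<alpha>" E] by simp
      moreover have "real m + 6 * M + l = E + 6 * (14 powr \<alpha> * R powr \<alpha>)" unfolding M_def L_eq E_def by simp
      moreover have "C * R powr \<alpha> = E * R powr \<alpha> + 6 * (14 powr \<alpha> * R powr \<alpha>)" unfolding C_def E_def by (simp add: algebra_simps)
      ultimately show ?thesis by linarith
    qed
    have l0: "l \<ge> 0" by (simp add: l_def)
    have L0: "L \<ge> 0" by (auto simp: L_def intro!: add_nonneg_nonneg)
    obtain xs :: "real list" where xs: "real (length xs) \<le> 2 * M"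
    "\<And>K r z. away R xs K r \<Longrightarrow> cmod z = r \<Longrightarrow>
      H z \<noteq> 0 \<and> cmod (deriv H z / H z) \<le> real m + 2 * (real K + 1)\<^sup>2 + 6 * M \<and>
      cmod (g1 0) * exp (- 6 * M) \<le> cmod (H z) * (8 * (real K + 1)) ^ length xs"
    proof (rule good_circle[where G = g1 and F = H and m = m and R = R and L = L and M = M])
      show "g1 holomorphic_on ball 0 (14 * R)" by (rule holomorphic_on_subset[OF g1(1)]) auto
      show "L - ln (cmod (g1 0)) < M" by (simp add: M_def l_def)
      fix z :: complex assume z: "z \<in> ball 0 (14 * R)"
      show "cmod (H z) \<le> exp L"
      proof (cases "cmod z \<le> r0")
        case True
        then have "cmod (H z) \<le> D" by (rule D)
        also have "\<dots> \<le> L" using powr_ge_zero[of "14 * R" \<alpha>] abs_ge_self[of D] unfolding L_def by linarith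
        also have "\<dots> \<le> exp L" by (rule less_imp_le[OF less_exp])
        finally show ?thesis .
      next
        case False
        then have "cmod (H z) \<le> exp (cmod z powr \<alpha>)" by (intro bd) auto
        also have "\<dots> \<le> exp L" using z alpha by (auto simp: L_def intro!: add_increasing powr_mono2)
        finally show ?thesis .
      qed
    qed (use R g1 in auto)
    show ?thesis
      unfolding controlled_def
    proof (intro exI[of _ xs] conjI allI impI)
      show "real (length xs) \<le> C * R powr \<alpha>" using xs(1) CM l0 L0 unfolding M_def by linarith
      fix K r z assume a: "away R xs K r" "cmod z = r"
      note * = xs(2)[OF a]
      show "H z \<noteq> 0" using * by blast
      have "cmod (deriv H z) / cmod (H z) \<le> 2 * (real K + 1)\<^sup>2 + C * R powr \<alpha>"
        using * CM l0 unfolding norm_divide by linarith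
      then show "cmod (deriv H z) \<le> (2 * (real K + 1)\<^sup>2 + C * R powr \<alpha>) * cmod (H z)"
        using * by (simp only: pos_divide_le_eq zero_less_norm_iff simp_thms)
    next
      fix K r z assume a: "away R xs K r" "cmod z = r"
      note * = xs(2)[OF a]
      have "exp (- l) \<le> cmod (g1 0)"
        using g1(2) by (subst ln_ge_iff[symmetric]) (auto simp: l_def)
      then have "exp (- l) * exp (- 6 * M) \<le> cmod (g1 0) * exp (- 6 * M)" by (intro mult_right_mono) auto
      from order_trans[OF this *[THEN conjunct2, THEN conjunct2]]
      have "exp (- l) * exp (- 6 * M) \<le> cmod (H z) * (8 * (real K + 1)) ^ length xs" .
      then have "exp (- l - 6 * M) * exp (l + 6 * M) \<le> cmod (H z) * (8 * (real K + 1)) ^ length xs * exp (l + 6 * M)"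
        by (intro mult_right_mono) (auto simp: exp_diff exp_minus field_simps)
      then have "1 \<le> cmod (H z) * (8 * (real K + 1)) ^ length xs * exp (l + 6 * M)"
        by (simp flip: exp_add)
      also have "\<dots> \<le> cmod (H z) * (8 * (real K + 1)) ^ length xs * exp (C * R powr \<alpha>)"
        using CM by (intro mult_left_mono) auto
      finally show "1 \<le> cmod (H z) * (exp (C * R powr \<alpha>) * (8 * (real K + 1)) ^ length xs)" by (simp add: mult_ac)
    qed
  qed
  show ?thesis using C0 main by blast
qed

abbreviation fam_growth :: "(real \<times> complex \<Rightarrow> complex) \<Rightarrow> bool" where
  "fam_growth \<equiv> exp_poly_bounded fst {p. fst p \<ge> 1 \<and> snd p \<in> ball 0 (14 * fst p)}"

lemma fam_growth_def:
  "fam_growth G \<longleftrightarrow> (\<exists>N. \<forall>R\<ge>1. \<forall>z\<in>ball 0 (14 * R). cmod (G (R, z)) \<le> exp ((2 + R) ^ N))"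
  by (simp add: exp_poly_bounded_def Ball_def imp_conjL)

lemma fam_growth_entire: "fin_growth g \<Longrightarrow> fam_growth (\<lambda>p. g (snd p))"
  unfolding fin_growth_def fam_growth_def snd_conv
proof (elim exE)
  fix N assume N: "\<forall>z. cmod (g z) \<le> exp ((2 + cmod z) ^ N)"
  have "cmod (g z) \<le> exp ((2 + R) ^ (4 * N))" if R: "R \<ge> 1" and z: "z \<in> ball 0 (14 * R)" for R z
  proof -
    have "2 + cmod z \<le> 27 * (2 + R)" using R z by simp
    also have "\<dots> \<le> (2 + R) ^ 3 * (2 + R)"
      using R power_mono[of 3 "2 + R" 3] by (intro mult_right_mono) auto
    finally have "2 + cmod z \<le> (2 + R) ^ 4" by (simp add: power_Suc2[symmetric] numeral_eq_Suc)
    then have "(2 + cmod z) ^ N \<le> (2 + R) ^ (4 * N)"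
      unfolding power_mult by (intro power_mono) auto
    then show ?thesis using N by (meson exp_le_cancel_iff order_trans)
  qed
  then show "\<exists>N. \<forall>R\<ge>1. \<forall>z\<in>ball 0 (14 * R). cmod (g z) \<le> exp ((2 + R) ^ N)" by blast
qed

section \<open>The setting of the theorem and the choice of circles\<close>

locale bank_laine = ray_bounded n \<alpha> \<zeta> B for n \<alpha> \<zeta> B +
  fixes A H T f f1 :: "complex \<Rightarrow> complex" and s :: real and m :: nat
  assumes A_def: "A z = T z + B z"
    and T_def: "T z = H z * exp (\<zeta> * z ^ n)"
    and holH: "H holomorphic_on UNIV" and Hnz: "\<exists>z. H z \<noteq> 0" and alpha0: "\<alpha> > 0"
    and H_growth: "\<exists>r0. \<forall>z. cmod z \<ge> r0 \<longrightarrow> cmod (H z) \<le> exp (cmod z powr \<alpha>)"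
    and sol: "entire_solution A f" and fnz: "\<exists>z. f z \<noteq> 0"
    and f1: "f1 holomorphic_on UNIV" "f1 0 \<noteq> 0" "f z = z ^ m * f1 z"
    and s: "0 < s" "s < real n"
    and sm: "(\<lambda>a. cmod a powr (- s)) summable_on {z. z \<noteq> 0 \<and> f z = 0}"
begin

text \<open>Numerators of \<open>\<tau> = Dh/H\<close>, \<open>\<tau>' = E1/H\<^sup>2\<close> and \<open>Y = NY/(f H)\<^sup>2\<close>.\<close>

definition Dh :: "complex \<Rightarrow> complex" where "Dh z = deriv H z + of_nat n * \<zeta> * z ^ (n - 1) * H z"
definition E1 :: "complex \<Rightarrow> complex" where "E1 z = deriv Dh z * H z - Dh z * deriv H z"
definition NY :: "complex \<Rightarrow> complex" where
  "NY z = - (deriv f z * deriv f z * H z * H z + f z * deriv f z * Dh z * H z / 2 + f z * f z * Dh z * Dh z / 8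
    + f z * f z * H z * H z * A z - f z * f z * E1 z / 4)"

lemma holf: "f holomorphic_on UNIV" using sol by (simp add: entire_solution_def)

lemma ode: "deriv (deriv f) z = - A z * f z"
  using sol by (simp add: entire_solution_def eq_neg_iff_add_eq_0)

lemma holT: "T holomorphic_on UNIV"
  unfolding T_def[abs_def] by (intro holomorphic_intros holH)

lemma holA: "A holomorphic_on UNIV"
  unfolding A_def[abs_def] by (intro holomorphic_intros holT holB)

lemma holDh: "Dh holomorphic_on UNIV"
  unfolding Dh_def[abs_def] by (intro holomorphic_intros holH entire_deriv)

lemma holE1: "E1 holomorphic_on UNIV"
  unfolding E1_def[abs_def] by (intro holomorphic_intros holH holDh entire_deriv)

lemma holNY: "NY holomorphic_on UNIV"
  unfolding NY_def[abs_def] by (intro holomorphic_intros holH holDh holf holA holE1 entire_deriv) auto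

lemma finH: "fin_growth H"
proof -
  obtain r0 where r0: "\<And>z. cmod z \<ge> r0 \<Longrightarrow> cmod (H z) \<le> exp (cmod z powr \<alpha>)" using H_growth by blast
  show ?thesis
  proof (rule fin_growthI[OF holH, where K = 1 and N = n and r = "max r0 1"])
    fix z assume z: "max r0 1 \<le> cmod z"
    have "cmod z powr \<alpha> \<le> cmod z powr real n" using z alpha by (intro powr_mono) auto
    also have "\<dots> = cmod z ^ n" using z by (subst powr_realpow) auto
    also have "\<dots> \<le> 1 * (1 + cmod z) ^ n" by (auto intro!: power_mono)
    finally show "cmod (H z) \<le> exp (1 * (1 + cmod z) ^ n)" using r0[of z] z by (meson exp_le_cancel_iff max.boundedE order_trans)
  qed
qed

lemma finT: "fin_growth T"
  unfolding T_def[abs_def] by (intro exp_poly_bounded_mult finH fin_growth_exp_power)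

lemma finA: "fin_growth A"
  unfolding A_def[abs_def] by (intro exp_poly_bounded_add finT finB)

lemma finDh: "fin_growth Dh"
  unfolding Dh_def[abs_def]
  by (intro exp_poly_bounded_intros fin_growth_deriv holH finH fin_growth_ident)

lemma finE1: "fin_growth E1"
  unfolding E1_def[abs_def]
  by (intro exp_poly_bounded_diff exp_poly_bounded_mult fin_growth_deriv holH finH finDh holDh)

lemma mtH: "min_type n H"
  using H_growth min_type_powr[OF holH n alpha] by blast

lemma mtDh: "min_type n Dh"
  unfolding Dh_def[abs_def]
  by (intro min_type_add min_type_mult min_type_deriv holH mtH min_type_power min_type_ident n min_type_const)

lemma min_type_diff: "min_type k F \<Longrightarrow> min_type k G \<Longrightarrow> min_type k (\<lambda>z. F z - G z)"
  using min_type_add[of k F "\<lambda>z. (- 1) * G z"] min_type_mult[of k "\<lambda>_. - 1" G] min_type_const[of k "- 1"] by simp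

lemma mtE1: "min_type n E1"
  unfolding E1_def[abs_def]
  by (intro min_type_diff min_type_mult min_type_deriv holH holDh mtH mtDh)

lemma mtE1': "min_type n (deriv E1)"
  by (intro min_type_deriv holE1 mtE1)

text \<open>Nothing is asked of \<open>f\<close>, \<open>f'\<close> or \<open>NY\<close> alone,
  because these may have infinite order; only the products with \<open>u\<close> (or its square) are
  controlled. The functions \<open>B\<close>, \<open>H\<close>, \<open>Dh\<close>, \<open>E1\<close>
  are tame without it.\<close>

definition tame_circle :: "real \<Rightarrow> real \<Rightarrow> real \<Rightarrow> (complex \<Rightarrow> complex) \<Rightarrow> bool" where
  "tame_circle \<epsilon> R r u \<longleftrightarrow> R \<le> r \<and> r \<le> 2 * R \<and> u holomorphic_on ball 0 (14 * R) \<and>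
    (\<forall>z\<in>ball 0 (14 * R). u z \<noteq> 0) \<and> u 0 = 1 / f1 0 \<and>
    (\<forall>z. cmod z = r \<longrightarrow> f z \<noteq> 0 \<and> H z \<noteq> 0 \<and>
      cmod (f z * u z) \<le> exp (\<epsilon> * r ^ n) \<and>
      cmod (deriv (\<lambda>z. f z * u z) z) \<le> exp (\<epsilon> * r ^ n) * cmod (f z * u z) \<and>
      cmod (deriv (\<lambda>z. deriv f z * u z) z) \<le> exp (\<epsilon> * r ^ n) * cmod (deriv f z * u z) \<and>
      cmod (deriv (\<lambda>z. NY z * (u z * u z)) z) \<le> exp (\<epsilon> * r ^ n) * cmod (NY z * (u z * u z)) \<and>
      cmod (deriv B z) \<le> exp (\<epsilon> * r ^ n) * cmod (B z) \<and>
      cmod (deriv H z) \<le> exp (\<epsilon> * r ^ n) * cmod (H z) \<and>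
      1 \<le> exp (\<epsilon> * r ^ n) * cmod (H z) \<and>
      cmod (H z) \<le> exp (\<epsilon> * r ^ n) \<and> cmod (Dh z) \<le> exp (\<epsilon> * r ^ n) \<and>
      cmod (E1 z) \<le> exp (\<epsilon> * r ^ n) \<and> cmod (deriv E1 z) \<le> exp (\<epsilon> * r ^ n))"

text \<open>One radius has to serve f u, f' u, NY u^2, B and H simultaneously. Each contributes a
  list of moduli, and only the total length, polynomial in R, affects the separation.\<close>

lemma good_circles:
  assumes e: "\<epsilon> > 0"
  shows "\<exists>R0. \<forall>R\<ge>R0. \<exists>r u. tame_circle \<epsilon> R r u"
proof -
  define c0 where "c0 = 1 / f1 0"
  have c0: "c0 \<noteq> 0" using f1(2) by (simp add: c0_def)
  obtain Nu C where C: "C \<ge> 0" and ex_u: "\<forall>R\<ge>1. \<exists>u. u holomorphic_on ball 0 (14 * R) \<and> (\<forall>z\<in>ball 0 (14 * R). u z \<noteq> 0) \<and>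
     u 0 = 1 / f1 0 \<and>
     (\<forall>z\<in>ball 0 (14 * R). cmod (f z * u z) \<le> (15 * R) ^ m * exp (C * R powr s) \<and>
        cmod (deriv f z * u z) \<le> exp ((2 + R) ^ Nu))"
    using solution_unit[OF sol holA finA fnz f1 sm s(1)] by blast
  then have "\<forall>R. \<exists>u. 1 \<le> R \<longrightarrow> u holomorphic_on ball 0 (14 * R) \<and> (\<forall>z\<in>ball 0 (14 * R). u z \<noteq> 0) \<and>
     u 0 = 1 / f1 0 \<and>
     (\<forall>z\<in>ball 0 (14 * R). cmod (f z * u z) \<le> (15 * R) ^ m * exp (C * R powr s) \<and>
        cmod (deriv f z * u z) \<le> exp ((2 + R) ^ Nu))" by blast
  from choice[OF this] obtain u where u0: "\<forall>R. 1 \<le> R \<longrightarrow> u R holomorphic_on ball 0 (14 * R) \<and> (\<forall>z\<in>ball 0 (14 * R). u R z \<noteq> 0) \<and>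
     u R 0 = 1 / f1 0 \<and>
     (\<forall>z\<in>ball 0 (14 * R). cmod (f z * u R z) \<le> (15 * R) ^ m * exp (C * R powr s) \<and>
        cmod (deriv f z * u R z) \<le> exp ((2 + R) ^ Nu))" by blast
  have u: "\<And>R. R \<ge> 1 \<Longrightarrow> u R holomorphic_on ball 0 (14 * R)"
     "\<And>R z. R \<ge> 1 \<Longrightarrow> z \<in> ball 0 (14 * R) \<Longrightarrow> u R z \<noteq> 0" "\<And>R. R \<ge> 1 \<Longrightarrow> u R 0 = c0"
     "\<And>R z. R \<ge> 1 \<Longrightarrow> z \<in> ball 0 (14 * R) \<Longrightarrow> cmod (f z * u R z) \<le> (15 * R) ^ m * exp (C * R powr s)"
     "\<And>R z. R \<ge> 1 \<Longrightarrow> z \<in> ball 0 (14 * R) \<Longrightarrow> cmod (deriv f z * u R z) \<le> exp ((2 + R) ^ Nu)"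
    using u0 unfolding c0_def by blast+
  have fgp: "fam_growth (\<lambda>p. deriv f (snd p) * u (fst p) (snd p))" using u(5) unfolding fam_growth_def fst_conv snd_conv by blast
  have fgD: "fam_growth (\<lambda>p. f (snd p) * u (fst p) (snd p))"
  proof -
    have "rgrowth (\<lambda>R. (15 * R) ^ m * exp (C * R powr s))" by (intro rgrowth_intros)
    then obtain N where "\<forall>R\<ge>1. \<bar>(15 * R) ^ m * exp (C * R powr s)\<bar> \<le> exp ((2 + R) ^ N)"
      unfolding rgrowth_def by blast
    then have "cmod (f z * u R z) \<le> exp ((2 + R) ^ N)" if "R \<ge> 1" "z \<in> ball 0 (14 * R)" for R z
      using u(4)[OF that] that(1) by (meson abs_ge_self order_trans)
    then show ?thesis unfolding fam_growth_def fst_conv snd_conv by blast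
  qed
  \<comment> \<open>\<open>NY\<close> is homogeneous of degree two in \<open>f\<close> and
    \<open>f'\<close>, so NY u^2 is a polynomial in f u, f' u and functions of finite order.\<close>
  have fgY: "fam_growth (\<lambda>p. NY (snd p) * (u (fst p) (snd p) * u (fst p) (snd p)))"
  proof -
    note fg = fam_growth_entire[OF finH] fam_growth_entire[OF finDh] fam_growth_entire[OF finA] fam_growth_entire[OF finE1]
      exp_poly_bounded_const
    have "fam_growth (\<lambda>p. (- 1) * ((deriv f (snd p) * v p) * (deriv f (snd p) * v p) * H (snd p) * H (snd p)
      + (1/2) * ((f (snd p) * v p) * (deriv f (snd p) * v p) * Dh (snd p) * H (snd p))
      + (1/8) * ((f (snd p) * v p) * (f (snd p) * v p) * Dh (snd p) * Dh (snd p))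
      + (f (snd p) * v p) * (f (snd p) * v p) * H (snd p) * H (snd p) * A (snd p)
      + (-1/4) * ((f (snd p) * v p) * (f (snd p) * v p) * E1 (snd p))))"
      if "v = (\<lambda>p. u (fst p) (snd p))" for v
      unfolding that by (intro exp_poly_bounded_mult exp_poly_bounded_add fgp fgD fg)
    moreover have "(- 1) * ((deriv f z * v) * (deriv f z * v) * H z * H z
      + (1/2) * ((f z * v) * (deriv f z * v) * Dh z * H z) + (1/8) * ((f z * v) * (f z * v) * Dh z * Dh z)
      + (f z * v) * (f z * v) * H z * H z * A z + (-1/4) * ((f z * v) * (f z * v) * E1 z)) = NY z * (v * v)" for z v
      unfolding NY_def by (simp add: algebra_simps)
    ultimately show ?thesis by simp
  qed
  obtain N1 where N1: "\<And>R z. R \<ge> 1 \<Longrightarrow> z \<in> ball 0 (14 * R) \<Longrightarrow> cmod (f z * u R z) \<le> exp ((2 + R) ^ N1)"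
    using fgD unfolding fam_growth_def fst_conv snd_conv by blast
  obtain N2 where N2: "\<And>R z. R \<ge> 1 \<Longrightarrow> z \<in> ball 0 (14 * R) \<Longrightarrow> cmod (NY z * (u R z * u R z)) \<le> exp ((2 + R) ^ N2)"
    using fgY unfolding fam_growth_def fst_conv snd_conv by blast
  obtain N3 where "\<forall>R\<ge>1. \<forall>z\<in>ball 0 (14 * R). cmod (B z) \<le> exp ((2 + R) ^ N3)"
    using fam_growth_entire[OF finB] unfolding fam_growth_def snd_conv by blast
  then have N3: "cmod (B z * 1) \<le> exp ((2 + R) ^ N3)" if "R \<ge> 1" "z \<in> ball 0 (14 * R)" for R z
    using that by simp
  obtain M1 where M1: "\<And>R. R \<ge> 1 \<Longrightarrow> \<exists>xs. controlled (\<exists>z. f z \<noteq> 0) R ((2 + R) ^ M1) (\<lambda>z. f z * u R z) xs"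
    using good_family[OF holf c0 u(1) u(3) N1] by blast
  obtain M2 where M2: "\<And>R. R \<ge> 1 \<Longrightarrow> \<exists>xs. controlled (\<exists>z. deriv f z \<noteq> 0) R ((2 + R) ^ M2) (\<lambda>z. deriv f z * u R z) xs"
    using good_family[OF entire_deriv[OF holf] c0 u(1) u(3) u(5)] by blast
  have uu: "(\<lambda>z. u R z * u R z) holomorphic_on ball 0 (14 * R)" "u R 0 * u R 0 = c0 * c0" if "R \<ge> 1" for R
    using u(1,3)[OF that] by (auto intro!: holomorphic_intros)
  have c00: "c0 * c0 \<noteq> 0" using c0 by simp
  obtain M3 where M3: "\<And>R. R \<ge> 1 \<Longrightarrow> \<exists>xs. controlled (\<exists>z. NY z \<noteq> 0) R ((2 + R) ^ M3) (\<lambda>z. NY z * (u R z * u R z)) xs"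
    using good_family[OF holNY c00, where u = "\<lambda>R z. u R z * u R z", OF uu N2] by blast
  obtain M4 where M4: "\<And>R. R \<ge> 1 \<Longrightarrow> \<exists>xs. controlled (\<exists>z. B z \<noteq> 0) R ((2 + R) ^ M4) (\<lambda>z. B z * 1) xs"
    using good_family[OF holB one_neq_zero, where u = "\<lambda>R z. 1", OF holomorphic_on_const refl N3] by blast
  obtain r0 where r0: "\<And>z. cmod z \<ge> r0 \<Longrightarrow> cmod (H z) \<le> exp (cmod z powr \<alpha>)" using H_growth by blast
  obtain C5 where C5: "C5 \<ge> 0" and M5: "\<And>R. R \<ge> 1 \<Longrightarrow> \<exists>xs. controlled True R (C5 * R powr \<alpha>) H xs \<and>
    (\<forall>K r z. away R xs K r \<longrightarrow> cmod z = r \<longrightarrow>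
      1 \<le> cmod (H z) * (exp (C5 * R powr \<alpha>) * (8 * (real K + 1)) ^ length xs))"
    using small_order_circle[OF holH Hnz alpha0 r0] by blast
  define Mm where "Mm = max (max (max M1 M2) (max M3 M4)) (nat \<lceil>\<alpha>\<rceil>)"
  obtain NK where NK: "\<And>R. R \<ge> 1 \<Longrightarrow> 1 + (4 + C5) * (2 + R) ^ Mm \<le> (2 + R) ^ NK"
    using poly_le_power by blast
  obtain NQ where NQ: "\<And>R. R \<ge> 1 \<Longrightarrow> 0 + (3 + C5) * (2 + R) ^ (2 * NK + Mm) \<le> (2 + R) ^ NQ"
    using poly_le_power by blast
  \<comment> \<open>The logarithm in the lower bound for |H| is absorbed in R^\<delta>, and \<alpha>
    + \<delta> is still below n.\<close>
  define \<delta> where "\<delta> = (real n - \<alpha>) / 2"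
  have d: "\<delta> > 0" using alpha by (simp add: \<delta>_def)
  define C6 where "C6 = C5 + C5 * real (NK + 2) * (3 powr \<delta> / \<delta>)"
  have e1: "\<forall>\<^sub>F R in at_top. (2 + R) ^ NQ \<le> exp (\<epsilon> * R ^ n)" by (rule poly_le_exp[OF n e])
  have e2: "\<forall>\<^sub>F R in at_top. 0 + C6 * R powr (\<alpha> + \<delta>) \<le> \<epsilon> * R ^ n"
    using alpha e n by (intro powr_mult_less_power) (auto simp: \<delta>_def field_simps)
  have eh: "\<epsilon> / 2 > 0" using e by simp
  have e3: "\<forall>\<^sub>F R in at_top. (2 + R) ^ (4 * m) \<le> exp (\<epsilon> / 2 * R ^ n)" by (rule poly_le_exp[OF n eh])
  have e4: "\<forall>\<^sub>F R in at_top. 0 + C * R powr s \<le> \<epsilon> / 2 * R ^ n"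
    using s eh n by (intro powr_mult_less_power) auto
  have "\<forall>\<^sub>F R in at_top. R \<ge> 1 \<and> (2 + R) ^ NQ \<le> exp (\<epsilon> * R ^ n) \<and> 0 + C6 * R powr (\<alpha> + \<delta>) \<le> \<epsilon> * R ^ n \<and>
     (2 + R) ^ (4 * m) \<le> exp (\<epsilon> / 2 * R ^ n) \<and> 0 + C * R powr s \<le> \<epsilon> / 2 * R ^ n \<and>
     (\<forall>z. cmod z = R \<longrightarrow> cmod (H z) \<le> exp (\<epsilon> * R ^ n)) \<and> (\<forall>z. cmod z = R \<longrightarrow> cmod (Dh z) \<le> exp (\<epsilon> * R ^ n)) \<and>
     (\<forall>z. cmod z = R \<longrightarrow> cmod (E1 z) \<le> exp (\<epsilon> * R ^ n)) \<and> (\<forall>z. cmod z = R \<longrightarrow> cmod (deriv E1 z) \<le> exp (\<epsilon> * R ^ n))"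
    by (intro eventually_conj eventually_ge_at_top e1 e2 e3 e4 min_type_eventually mtH mtDh mtE1 mtE1' n e)
  then obtain R0 where R0: "\<And>R. R \<ge> R0 \<Longrightarrow> R \<ge> 1 \<and> (2 + R) ^ NQ \<le> exp (\<epsilon> * R ^ n) \<and> 0 + C6 * R powr (\<alpha> + \<delta>) \<le> \<epsilon> * R ^ n \<and>
     (2 + R) ^ (4 * m) \<le> exp (\<epsilon> / 2 * R ^ n) \<and> 0 + C * R powr s \<le> \<epsilon> / 2 * R ^ n \<and>
     (\<forall>z. cmod z = R \<longrightarrow> cmod (H z) \<le> exp (\<epsilon> * R ^ n)) \<and> (\<forall>z. cmod z = R \<longrightarrow> cmod (Dh z) \<le> exp (\<epsilon> * R ^ n)) \<and>
     (\<forall>z. cmod z = R \<longrightarrow> cmod (E1 z) \<le> exp (\<epsilon> * R ^ n)) \<and> (\<forall>z. cmod z = R \<longrightarrow> cmod (deriv E1 z) \<le> exp (\<epsilon> * R ^ n))"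
    unfolding eventually_at_top_linorder by blast
  show ?thesis
  proof (rule exI[of _ R0], intro allI impI)
    fix R assume "R \<ge> R0"
    note RR = R0[OF this]
    have R: "R \<ge> 1" using RR by blast
    obtain x1 where x1: "controlled (\<exists>z. f z \<noteq> 0) R ((2 + R) ^ M1) (\<lambda>z. f z * u R z) x1" using M1[OF R] by blast
    obtain x2 where x2: "controlled (\<exists>z. deriv f z \<noteq> 0) R ((2 + R) ^ M2) (\<lambda>z. deriv f z * u R z) x2" using M2[OF R] by blast
    obtain x3 where x3: "controlled (\<exists>z. NY z \<noteq> 0) R ((2 + R) ^ M3) (\<lambda>z. NY z * (u R z * u R z)) x3" using M3[OF R] by blast
    obtain x4 where x4: "controlled (\<exists>z. B z \<noteq> 0) R ((2 + R) ^ M4) (\<lambda>z. B z * 1) x4" using M4[OF R] by blast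
    obtain x5 where x5: "controlled True R (C5 * R powr \<alpha>) H x5" and x5': "\<And>K r z. away R x5 K r \<Longrightarrow> cmod z = r \<Longrightarrow>
      1 \<le> cmod (H z) * (exp (C5 * R powr \<alpha>) * (8 * (real K + 1)) ^ length x5)" using M5[OF R] by blast
    note xc = x1 x2 x3 x4 x5
    note lens = xc[unfolded controlled_def, THEN conjunct1]
    note ctrl = xc[unfolded controlled_def, THEN conjunct2, rule_format]
    \<comment> \<open>A radius that avoids the concatenation avoids each list with the same
      \<open>K\<close>; this is why \<open>away\<close> permits \<open>K\<close> to be larger than
      the list.\<close>
    define xs where "xs = x1 @ x2 @ x3 @ x4 @ x5"
    define K where "K = length xs"
    have "R > 0" using R by simp
    then obtain r where r: "R \<le> r" "r \<le> 2 * R" "\<And>x. x \<in> set xs \<Longrightarrow> R / (2 * (real K + 1)) \<le> \<bar>r - x\<bar>"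
      using good_radius[of R xs] unfolding K_def by blast
    have "away R xs K r" using r by (simp add: away_def K_def)
    then have aw: "away R x1 K r" "away R x2 K r" "away R x3 K r" "away R x4 K r" "away R x5 K r"
      by (auto elim!: away_subset simp: xs_def)
    have pm: "(2 + R) ^ k \<le> (2 + R) ^ Mm" if "k \<le> Mm" for k using R that by (intro power_increasing) auto
    have Mle: "M1 \<le> Mm" "M2 \<le> Mm" "M3 \<le> Mm" "M4 \<le> Mm" "nat \<lceil>\<alpha>\<rceil> \<le> Mm" by (auto simp: Mm_def)
    have C5R: "C5 * R powr \<alpha> \<le> C5 * (2 + R) ^ Mm"
      using powr_le_power_ceiling[OF R, of \<alpha>] pm[OF Mle(5)] C5 by (intro mult_left_mono) auto
    have "real K = real (length x1) + real (length x2) + real (length x3) + real (length x4) + real (length x5)"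
      by (simp add: K_def xs_def)
    also have "\<dots> \<le> (4 + C5) * (2 + R) ^ Mm"
      using lens pm[OF Mle(1)] pm[OF Mle(2)] pm[OF Mle(3)] pm[OF Mle(4)] C5R
      by (simp add: distrib_right)
    finally have K1: "real K + 1 \<le> (2 + R) ^ NK" using NK[OF R] by linarith
    define Q where "Q = 2 * (real K + 1)\<^sup>2 + (1 + C5) * (2 + R) ^ Mm"
    have "Q \<le> (2 + R) ^ NQ"
    proof -
      have g1: "1 \<le> (2 + R) ^ k" for k using R by (intro one_le_power) auto
      have "(real K + 1)\<^sup>2 \<le> ((2 + R) ^ NK)\<^sup>2" using K1 by (intro power_mono) auto
      also have "\<dots> = (2 + R) ^ (2 * NK)" by (simp add: power_mult[symmetric] mult.commute)
      also have "\<dots> \<le> (2 + R) ^ (2 * NK + Mm)" using R by (intro power_increasing) auto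
      finally have 1: "(real K + 1)\<^sup>2 \<le> (2 + R) ^ (2 * NK + Mm)" .
      have "(2 + R) ^ Mm \<le> (2 + R) ^ (2 * NK + Mm)" using R by (intro power_increasing) auto
      then have "(1 + C5) * (2 + R) ^ Mm \<le> (1 + C5) * (2 + R) ^ (2 * NK + Mm)" using C5 by (intro mult_left_mono) auto
      moreover have "0 + (3 + C5) * (2 + R) ^ (2 * NK + Mm) = 2 * (2 + R) ^ (2 * NK + Mm) + (1 + C5) * (2 + R) ^ (2 * NK + Mm)"
        by (simp add: algebra_simps)
      ultimately show ?thesis using NQ[OF R] 1 unfolding Q_def by linarith
    qed
    moreover have Xr: "exp (\<epsilon> * R ^ n) \<le> exp (\<epsilon> * r ^ n)" using r R e by (auto intro!: mult_left_mono power_mono)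
    ultimately have QX: "Q \<le> exp (\<epsilon> * r ^ n)" using RR by linarith
    have Qi: "2 * (real K + 1)\<^sup>2 + (2 + R) ^ k \<le> Q" if "k \<le> Mm" for k
    proof -
      have "0 \<le> C5 * (2 + R) ^ Mm" using C5 R by simp
      then show ?thesis using pm[OF that] unfolding Q_def by (simp add: distrib_right)
    qed
    have Qi5: "2 * (real K + 1)\<^sup>2 + C5 * R powr \<alpha> \<le> Q"
    proof -
      have "0 \<le> (2 + R) ^ Mm" using R by simp
      then show ?thesis using C5R unfolding Q_def by (simp add: distrib_right)
    qed
    have up: "a \<le> exp (\<epsilon> * r ^ n) * b" if "a \<le> q * b" "q \<le> Q" "0 \<le> b" for a b q
      using that QX mult_right_mono[of q "exp (\<epsilon> * r ^ n)" b] by linarith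
    \<comment> \<open>The base 8 (K + 1) is at most a power of 2 + R, while the length is at most C5
      R^\<alpha>; the exponent is then a multiple of R^\<alpha> ln (2 + R).\<close>
    have H_inv: "exp (C5 * R powr \<alpha>) * (8 * (real K + 1)) ^ length x5 \<le> exp (\<epsilon> * r ^ n)"
    proof -
      have "8 * (real K + 1) \<le> (2 + R) ^ 2 * (2 + R) ^ NK"
        using K1 R power_mono[of 3 "2 + R" 2] by (intro mult_mono) auto
      also have "\<dots> = (2 + R) ^ (NK + 2)" by (simp only: power_add mult.commute)
      also have "\<dots> = exp (real (NK + 2) * ln (2 + R))" using R by (subst exp_of_nat_mult) simp
      finally have "(8 * (real K + 1)) ^ length x5 \<le> exp (real (NK + 2) * ln (2 + R)) ^ length x5"
        by (intro power_mono) auto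
      also have "\<dots> = exp (real (length x5) * (real (NK + 2) * ln (2 + R)))" by (rule exp_of_nat_mult[symmetric])
      also have "\<dots> \<le> exp (C5 * R powr \<alpha> * (real (NK + 2) * ((3 powr \<delta> / \<delta>) * R powr \<delta>)))"
      proof -
        have "ln (2 + R) \<le> ln (3 * R)" using R by (subst ln_le_cancel_iff) auto
        also have "\<dots> \<le> (3 * R) powr \<delta> / \<delta>" using R d by (intro ln_powr_bound) auto
        also have "\<dots> = (3 powr \<delta> / \<delta>) * R powr \<delta>" using R by (simp add: powr_mult)
        finally have "ln (2 + R) \<le> (3 powr \<delta> / \<delta>) * R powr \<delta>" .
        moreover have "ln (2 + R) \<ge> 0" using R by simp
        ultimately show ?thesis using lens(5) by (intro iffD2[OF exp_le_cancel_iff] mult_mono) auto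
      qed
      finally have "exp (C5 * R powr \<alpha>) * (8 * (real K + 1)) ^ length x5
         \<le> exp (C5 * R powr \<alpha>) * exp (C5 * R powr \<alpha> * (real (NK + 2) * ((3 powr \<delta> / \<delta>) * R powr \<delta>)))"
        by (intro mult_left_mono) auto
      also have "\<dots> = exp (C5 * R powr \<alpha> + C5 * R powr \<alpha> * (real (NK + 2) * ((3 powr \<delta> / \<delta>) * R powr \<delta>)))"
        by (simp only: exp_add)
      also have "\<dots> \<le> exp (0 + C6 * R powr (\<alpha> + \<delta>))"
      proof -
        have "R powr \<alpha> \<le> R powr (\<alpha> + \<delta>)" using R d by (intro powr_mono) auto
        then have "C5 * R powr \<alpha> \<le> C5 * R powr (\<alpha> + \<delta>)" using C5 by (intro mult_left_mono)
        moreover have "C5 * R powr \<alpha> * (real (NK + 2) * ((3 powr \<delta> / \<delta>) * R powr \<delta>)) = C5 * real (NK + 2) * (3 powr \<delta> / \<delta>) * R powr (\<alpha> + \<delta>)"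
          by (simp only: powr_add mult_ac)
        ultimately show ?thesis unfolding C6_def by (simp only: exp_le_cancel_iff distrib_right add_0_left)
      qed
      also have "\<dots> \<le> exp (\<epsilon> * R ^ n)" using RR by (simp only: exp_le_cancel_iff)
      finally show ?thesis using Xr by linarith
    qed
    have fu: "cmod (f z * u R z) \<le> exp (\<epsilon> * r ^ n)" if z: "cmod z = r" for z
    proof -
      have "cmod (f z * u R z) \<le> (15 * R) ^ m * exp (C * R powr s)" using z r R by (intro u(4)) auto
      also have "\<dots> \<le> exp (\<epsilon> / 2 * R ^ n) * exp (\<epsilon> / 2 * R ^ n)"
      proof (rule mult_mono)
        have "15 * R \<le> 27 * (2 + R)" using R by simp
        also have "\<dots> \<le> (2 + R) ^ 3 * (2 + R)"
          using R power_mono[of 3 "2 + R" 3] by (intro mult_right_mono) auto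
        finally have "15 * R \<le> (2 + R) ^ 4" by (simp add: power_Suc2[symmetric] numeral_eq_Suc)
        then have "(15 * R) ^ m \<le> (2 + R) ^ (4 * m)" using R unfolding power_mult by (intro power_mono) auto
        then show "(15 * R) ^ m \<le> exp (\<epsilon> / 2 * R ^ n)" using RR by linarith
        show "exp (C * R powr s) \<le> exp (\<epsilon> / 2 * R ^ n)" using RR by simp
      qed auto
      also have "\<dots> = exp (\<epsilon> * R ^ n)" by (simp flip: exp_add)
      finally show ?thesis using Xr by linarith
    qed
    have rR: "r \<ge> R0" using r(1) \<open>R \<ge> R0\<close> by linarith
    show "\<exists>r u. tame_circle \<epsilon> R r u"
      unfolding tame_circle_def
    proof (intro exI[of _ r] exI[of _ "u R"] conjI ballI allI impI)
      show "u R z \<noteq> 0" if "z \<in> ball 0 (14 * R)" for z using u(2)[OF R that] .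
      show "u R 0 = 1 / f1 0" using u(3)[OF R] by (simp add: c0_def)
      fix z assume z: "cmod z = r"
      note y1 = ctrl(1)[OF aw(1) z] and y2 = ctrl(2)[OF aw(2) z] and y3 = ctrl(3)[OF aw(3) z]
        and y4 = ctrl(4)[OF aw(4) z] and y5 = ctrl(5)[OF aw(5) z]
      show "f z \<noteq> 0" using y1 fnz by auto
      show "H z \<noteq> 0" using y5 by blast
      show "cmod (f z * u R z) \<le> exp (\<epsilon> * r ^ n)" by (rule fu[OF z])
      show "cmod (deriv (\<lambda>z. f z * u R z) z) \<le> exp (\<epsilon> * r ^ n) * cmod (f z * u R z)"
        by (rule up[OF y1[THEN conjunct2] Qi[OF Mle(1)]]) simp
      show "cmod (deriv (\<lambda>z. deriv f z * u R z) z) \<le> exp (\<epsilon> * r ^ n) * cmod (deriv f z * u R z)"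
        by (rule up[OF y2[THEN conjunct2] Qi[OF Mle(2)]]) simp
      show "cmod (deriv (\<lambda>z. NY z * (u R z * u R z)) z) \<le> exp (\<epsilon> * r ^ n) * cmod (NY z * (u R z * u R z))"
        by (rule up[OF y3[THEN conjunct2] Qi[OF Mle(3)]]) simp
      have "cmod (deriv (\<lambda>z. B z * 1) z) \<le> exp (\<epsilon> * r ^ n) * cmod (B z * 1)"
        by (rule up[OF y4[THEN conjunct2] Qi[OF Mle(4)]]) simp
      then show "cmod (deriv B z) \<le> exp (\<epsilon> * r ^ n) * cmod (B z)" by simp
      show "cmod (deriv H z) \<le> exp (\<epsilon> * r ^ n) * cmod (H z)"
        by (rule up[OF y5[THEN conjunct2] Qi5]) simp
      have "cmod (H z) * (exp (C5 * R powr \<alpha>) * (8 * (real K + 1)) ^ length x5) \<le> cmod (H z) * exp (\<epsilon> * r ^ n)"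
        by (intro mult_left_mono H_inv) auto
      with x5'[OF aw(5) z] have "1 \<le> cmod (H z) * exp (\<epsilon> * r ^ n)" by (rule order_trans)
      then show "1 \<le> exp (\<epsilon> * r ^ n) * cmod (H z)" by (simp only: mult.commute)
      show "cmod (H z) \<le> exp (\<epsilon> * r ^ n)" "cmod (Dh z) \<le> exp (\<epsilon> * r ^ n)"
        "cmod (E1 z) \<le> exp (\<epsilon> * r ^ n)" "cmod (deriv E1 z) \<le> exp (\<epsilon> * r ^ n)"
        using R0[OF rR] z by blast+
    qed (rule r u(1)[OF R])+
  qed
qed

end

subsection \<open>The Riccati equation\<close>

context bank_laine
begin

definition ww :: "complex \<Rightarrow> complex" where "ww z = deriv f z / f z"
definition tau :: "complex \<Rightarrow> complex" where "tau z = Dh z / H z"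
text \<open>The names ending in 1 and 2 are explicit formulas for successive derivatives of \<tau>,
  \<open>C\<close> and \<open>Y\<close>. They are total through division by zero; the derivative
  lemmas below validate them away from the zeros of \<open>H\<close> and, for \<open>Y\<close>, also
  of \<open>f\<close>.\<close>

definition tau1 :: "complex \<Rightarrow> complex" where "tau1 z = E1 z / (H z * H z)"
definition tau2 :: "complex \<Rightarrow> complex" where "tau2 z = deriv E1 z / (H z * H z) - 2 * tau1 z * (deriv H z / H z)"
definition UU :: "complex \<Rightarrow> complex" where "UU z = ww z + tau z / 4"
definition CC :: "complex \<Rightarrow> complex" where "CC z = B z + tau z * tau z / 16 - tau1 z / 4"
definition CC1 :: "complex \<Rightarrow> complex" where "CC1 z = deriv B z + tau z * tau1 z / 8 - tau2 z / 4"
definition YY :: "complex \<Rightarrow> complex" where "YY z = NY z / (f z * f z * H z * H z)"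
definition YY1 :: "complex \<Rightarrow> complex" where "YY1 z = tau z * CC z - CC1 z - YY z * (2 * ww z - tau z / 2)"

lemmas d_f = entire_has_derivative[OF holf]
lemmas d_H = entire_has_derivative[OF holH]

lemma d_T: "(T has_field_derivative Dh z * exp (\<zeta> * z ^ n)) (at z)"
proof -
  have "((\<lambda>z. H z * exp (\<zeta> * z ^ n)) has_field_derivative
     deriv H z * exp (\<zeta> * z ^ n) + exp (\<zeta> * z ^ n) * (\<zeta> * (of_nat n * z ^ (n - 1))) * H z) (at z)"
    by (intro DERIV_mult d_H) (auto intro!: derivative_eq_intros)
  moreover have "(\<lambda>z. H z * exp (\<zeta> * z ^ n)) = T" by (rule ext) (simp add: T_def)
  ultimately show ?thesis by (simp add: Dh_def algebra_simps)
qed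

lemma d_ww: "f z \<noteq> 0 \<Longrightarrow> (ww has_field_derivative - A z - ww z * ww z) (at z)"
proof -
  assume z: "f z \<noteq> 0"
  have "((\<lambda>z. deriv f z / f z) has_field_derivative
     (deriv (deriv f) z * f z - deriv f z * deriv f z) / (f z * f z)) (at z)"
    by (intro DERIV_divide d_f z entire_has_derivative[OF entire_deriv[OF holf]])
  moreover have "(deriv (deriv f) z * f z - deriv f z * deriv f z) / (f z * f z) = - A z - ww z * ww z"
    using z unfolding ode ww_def by (simp add: field_simps)
  ultimately show ?thesis unfolding ww_def[abs_def] by simp
qed

lemma d_tau: "H z \<noteq> 0 \<Longrightarrow> (tau has_field_derivative tau1 z) (at z)"
proof -
  assume z: "H z \<noteq> 0"
  have "((\<lambda>z. Dh z / H z) has_field_derivative (deriv Dh z * H z - Dh z * deriv H z) / (H z * H z)) (at z)"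
    by (intro DERIV_divide d_H z entire_has_derivative[OF holDh])
  then show ?thesis unfolding tau_def[abs_def] tau1_def E1_def by simp
qed

lemma d_tau1: "H z \<noteq> 0 \<Longrightarrow> (tau1 has_field_derivative tau2 z) (at z)"
proof -
  assume z: "H z \<noteq> 0"
  have "((\<lambda>z. E1 z / (H z * H z)) has_field_derivative
      (deriv E1 z * (H z * H z) - E1 z * (deriv H z * H z + deriv H z * H z)) / ((H z * H z) * (H z * H z))) (at z)"
    using z by (intro DERIV_divide DERIV_mult d_H entire_has_derivative[OF holE1]) auto
  moreover have "(deriv E1 z * (H z * H z) - E1 z * (deriv H z * H z + deriv H z * H z)) / ((H z * H z) * (H z * H z)) = tau2 z"
    using z unfolding tau2_def tau1_def by (simp add: field_simps)
  ultimately show ?thesis unfolding tau1_def[abs_def] by simp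
qed

lemma YY_eq: "f z \<noteq> 0 \<Longrightarrow> H z \<noteq> 0 \<Longrightarrow> YY z = - (UU z * UU z + T z + CC z)"
  unfolding YY_def NY_def UU_def CC_def ww_def tau_def tau1_def A_def
  by (simp add: field_simps)

lemma d_UU: "f z \<noteq> 0 \<Longrightarrow> H z \<noteq> 0 \<Longrightarrow> (UU has_field_derivative YY z + tau z * UU z / 2) (at z)"
proof -
  assume z: "f z \<noteq> 0" "H z \<noteq> 0"
  have "((\<lambda>z. ww z + tau z / 4) has_field_derivative (- A z - ww z * ww z) + tau1 z / 4) (at z)"
    by (intro DERIV_add DERIV_cdivide d_ww d_tau z)
  moreover have "(- A z - ww z * ww z) + tau1 z / 4 = YY z + tau z * UU z / 2"
    unfolding YY_eq[OF z] UU_def CC_def A_def by (simp add: algebra_simps)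
  ultimately show ?thesis unfolding UU_def[abs_def] by simp
qed

lemma d_CC: "H z \<noteq> 0 \<Longrightarrow> (CC has_field_derivative CC1 z) (at z)"
proof -
  assume z: "H z \<noteq> 0"
  have "((\<lambda>z. B z + tau z * tau z / 16 - tau1 z / 4) has_field_derivative
     deriv B z + (tau1 z * tau z + tau1 z * tau z) / 16 - tau2 z / 4) (at z)"
    by (intro DERIV_add DERIV_diff DERIV_cdivide DERIV_mult d_tau d_tau1 z entire_has_derivative[OF holB])
  moreover have "deriv B z + (tau1 z * tau z + tau1 z * tau z) / 16 - tau2 z / 4 = CC1 z"
    by (simp add: CC1_def)
  ultimately show ?thesis unfolding CC_def[abs_def] by simp
qed

lemma open_nz: "open {z. f z \<noteq> 0 \<and> H z \<noteq> 0}"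
proof -
  have "continuous_on UNIV f" "continuous_on UNIV H"
    using holf holH holomorphic_on_imp_continuous_on by auto
  then have "open {z. f z \<noteq> 0}" "open {z. H z \<noteq> 0}"
    by (auto intro!: open_Collect_neq continuous_on_const)
  then show ?thesis by (rule open_Collect_conj)
qed

text \<open>Differentiating -(U^2 + T + C) and replacing U^2 by -Y - T - C makes \<open>T\<close>
  disappear, because T' = \<tau> T. What remains on the right is Y, which carries the unknown, and
  \<tau> C - C', which is only as large as \<open>B\<close>.\<close>

lemma d_YY:
  assumes z: "f z \<noteq> 0" "H z \<noteq> 0"
  shows "(YY has_field_derivative YY1 z) (at z)"
proof -
  have "Dh z * exp (\<zeta> * z ^ n) = tau z * T z" using z by (simp add: tau_def T_def)
  then have dT: "(T has_field_derivative tau z * T z) (at z)" using d_T[of z] by simp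
  have "((\<lambda>z. - (UU z * UU z + T z + CC z)) has_field_derivative
     - ((YY z + tau z * UU z / 2) * UU z + (YY z + tau z * UU z / 2) * UU z + tau z * T z + CC1 z)) (at z)"
    by (intro DERIV_minus DERIV_add DERIV_mult d_UU d_CC z dT)
  then have "(YY has_field_derivative
     - ((YY z + tau z * UU z / 2) * UU z + (YY z + tau z * UU z / 2) * UU z + tau z * T z + CC1 z)) (at z)"
    by (rule has_field_derivative_transform_within_open[OF _ open_nz]) (use z YY_eq in auto)
  moreover have "- ((YY z + tau z * UU z / 2) * UU z + (YY z + tau z * UU z / 2) * UU z + tau z * T z + CC1 z) = YY1 z"
  proof -
    have "UU z * UU z = - YY z - T z - CC z" unfolding YY_eq[OF z] by simp
    then have 1: "tau z * UU z * UU z = tau z * (- YY z - T z - CC z)" by (simp add: mult.assoc)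
    have 2: "2 * ww z - tau z / 2 = 2 * UU z - tau z" by (simp add: UU_def)
    have "- ((YY z + tau z * UU z / 2) * UU z + (YY z + tau z * UU z / 2) * UU z + tau z * T z + CC1 z)
        = - 2 * YY z * UU z - tau z * UU z * UU z - tau z * T z - CC1 z" by (simp add: algebra_simps)
    then show ?thesis unfolding YY1_def 2 1 by (simp add: algebra_simps)
  qed
  ultimately show ?thesis by simp
qed

text \<open>With v = u'/u the hypotheses bound f'/f + v, f''/f' + v and NY'/NY + 2 v. The targets
  are combinations without v: w' = (f''/f' - f'/f) w, and Y'/Y = NY'/NY - 2 f'/f - 2 H'/H. No bound
  for v itself is available or used.\<close>

lemma circle_bounds:
  assumes z: "f z \<noteq> 0" "H z \<noteq> 0" and X: "X \<ge> 1"
    and u: "u holomorphic_on ball 0 \<rho>" "z \<in> ball 0 \<rho>" "u z \<noteq> 0"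
    and b: "cmod (deriv (\<lambda>z. f z * u z) z) \<le> X * cmod (f z * u z)"
      "cmod (deriv (\<lambda>z. deriv f z * u z) z) \<le> X * cmod (deriv f z * u z)"
      "cmod (deriv (\<lambda>z. NY z * (u z * u z)) z) \<le> X * cmod (NY z * (u z * u z))"
      "cmod (deriv H z) \<le> X * cmod (H z)" "1 \<le> X * cmod (H z)"
      "cmod (Dh z) \<le> X" "cmod (E1 z) \<le> X" "cmod (deriv E1 z) \<le> X"
  shows "cmod (- A z - ww z * ww z) \<le> 5 * X ^ 4 * cmod (ww z)"
    "cmod (YY1 z) \<le> 5 * X ^ 4 * cmod (YY z)"
    "cmod (tau z) \<le> 5 * X ^ 4" "cmod (tau1 z) \<le> 5 * X ^ 4" "cmod (tau2 z) \<le> 5 * X ^ 4"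
proof -
  \<comment> \<open>The common bound 5 X^4 takes its factor 5 from the terms of Y'/Y and its
    exponent from \<open>tau2\<close>, where X^3 meets H'/H.\<close>
  have XX: "X \<le> X ^ 4" "X ^ 2 \<le> X ^ 4" "X ^ 3 \<le> X ^ 4" "1 \<le> X ^ 4"
    using X power_increasing[of 1 4 X] power_increasing[of 2 4 X] power_increasing[of 3 4 X] one_le_power[of X 4] by auto
  have X4: "c * X \<le> 5 * X ^ 4" if "0 \<le> c" "c \<le> 5" for c
    using that XX X by (intro mult_mono) auto
  define v where "v = deriv u z / u z"
  have du: "(u has_field_derivative v * u z) (at z)"
    using holomorphic_derivI[OF u(1) open_ball u(2)] u(3) by (simp add: v_def)
  have l1: "cmod (ww z + v) \<le> X"
  proof -
    have "deriv (\<lambda>z. f z * u z) z = (ww z + v) * (f z * u z)"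
      unfolding DERIV_imp_deriv[OF DERIV_mult[OF d_f du]] using z by (simp add: ww_def field_simps)
    then have "cmod (ww z + v) * cmod (f z * u z) \<le> X * cmod (f z * u z)" using b(1) by (simp add: norm_mult)
    then show ?thesis using z u(3) by (simp add: norm_mult)
  qed
  have hh: "cmod (deriv H z / H z) \<le> X" using b(4) z by (simp add: norm_divide pos_divide_le_eq)
  have ih: "cmod (1 / H z) \<le> X" using b(5) z by (simp add: norm_divide pos_divide_le_eq)
  show "cmod (- A z - ww z * ww z) \<le> 5 * X ^ 4 * cmod (ww z)"
  proof (cases "deriv f z = 0")
    case True
    then have w0: "ww z = 0" by (simp add: ww_def)
    have "deriv (\<lambda>z. deriv f z * u z) z = - A z * f z * u z"
      using DERIV_imp_deriv[OF DERIV_mult[OF entire_has_derivative[OF entire_deriv[OF holf]] du]] True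
      by (simp add: ode)
    then have "A z * f z * u z = 0" using b(2) True by simp
    then show ?thesis using w0 z u(3) by simp
  next
    case False
    \<comment> \<open>This is f''/f', by the differential equation.\<close>
    define q where "q = - A z / ww z"
    have wn: "ww z \<noteq> 0" using False z by (simp add: ww_def)
    have e: "deriv (\<lambda>z. deriv f z * u z) z = (- A z * f z) * u z + v * u z * deriv f z"
      using DERIV_imp_deriv[OF DERIV_mult[OF entire_has_derivative[OF entire_deriv[OF holf]] du]]
      by (simp only: ode)
    have "deriv (\<lambda>z. deriv f z * u z) z = (q + v) * (deriv f z * u z)"
      unfolding e q_def ww_def using False z by (simp add: field_simps)
    then have "cmod (q + v) * cmod (deriv f z * u z) \<le> X * cmod (deriv f z * u z)" using b(2) by (simp add: norm_mult)
    then have l2: "cmod (q + v) \<le> X" using False u(3) by (simp add: norm_mult)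
    have "- A z - ww z * ww z = ((q + v) - (ww z + v)) * ww z" using wn by (simp add: q_def field_simps)
    moreover have "cmod ((q + v) - (ww z + v)) \<le> 2 * X" using norm_triangle_ineq4[of "q + v" "ww z + v"] l1 l2 by linarith
    ultimately have "cmod (- A z - ww z * ww z) \<le> 2 * X * cmod (ww z)"
      by (simp only: norm_mult) (intro mult_right_mono, auto)
    also have "\<dots> \<le> 5 * X ^ 4 * cmod (ww z)" by (intro mult_right_mono X4) auto
    finally show ?thesis .
  qed
  show "cmod (YY1 z) \<le> 5 * X ^ 4 * cmod (YY z)"
  proof (cases "NY z = 0")
    case True
    have dN: "((\<lambda>z. NY z * (u z * u z)) has_field_derivative
       deriv NY z * (u z * u z) + (v * u z * u z + v * u z * u z) * NY z) (at z)"
      by (intro DERIV_mult du entire_has_derivative[OF holNY])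
    have dY: "((\<lambda>z. NY z / (f z * f z * H z * H z)) has_field_derivative
       (deriv NY z * (f z * f z * H z * H z) - NY z * deriv (\<lambda>z. f z * f z * H z * H z) z) / ((f z * f z * H z * H z) * (f z * f z * H z * H z))) (at z)"
      by (intro DERIV_divide entire_has_derivative[OF holNY] entire_has_derivative holomorphic_intros holf holH) (use z in auto)
    \<comment> \<open>At a zero of \<open>NY\<close> the multiplied-out bound forces the derivative
      to vanish too, so Y' is zero there as well.\<close>
    have "deriv NY z = 0" using b(3) True DERIV_imp_deriv[OF dN] u(3) by simp
    then have "((\<lambda>z. NY z / (f z * f z * H z * H z)) has_field_derivative 0) (at z)" using dY True by simp
    then have "YY1 z = 0" using d_YY[OF z] unfolding YY_def[abs_def] by (rule DERIV_unique[symmetric])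
    then show ?thesis using X by simp
  next
    case False
    define q where "q = deriv NY z / NY z"
    have dN: "((\<lambda>z. NY z * (u z * u z)) has_field_derivative
       deriv NY z * (u z * u z) + (v * u z * u z + v * u z * u z) * NY z) (at z)"
      by (intro DERIV_mult du entire_has_derivative[OF holNY])
    have "deriv (\<lambda>z. NY z * (u z * u z)) z = (q + 2 * v) * (NY z * (u z * u z))"
      unfolding DERIV_imp_deriv[OF dN] using False by (simp add: q_def field_simps)
    then have "cmod (q + 2 * v) * cmod (NY z * (u z * u z)) \<le> X * cmod (NY z * (u z * u z))" using b(3) by (simp add: norm_mult)
    then have l3: "cmod (q + 2 * v) \<le> X" using False u(3) by (simp add: norm_mult)
    have "((\<lambda>z. f z * f z * H z * H z) has_field_derivative
       ((deriv f z * f z + deriv f z * f z) * H z + deriv H z * (f z * f z)) * H z + deriv H z * (f z * f z * H z)) (at z)"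
      by (intro DERIV_mult d_f d_H)
    from DERIV_divide[OF entire_has_derivative[OF holNY] this]
    have "(YY has_field_derivative (deriv NY z * (f z * f z * H z * H z) - NY z *
        (((deriv f z * f z + deriv f z * f z) * H z + deriv H z * (f z * f z)) * H z + deriv H z * (f z * f z * H z)))
        / ((f z * f z * H z * H z) * (f z * f z * H z * H z))) (at z)"
      unfolding YY_def[abs_def] using z by simp
    note e = DERIV_unique[OF d_YY[OF z] this]
    have "YY1 z = (q - 2 * ww z - 2 * (deriv H z / H z)) * YY z"
      unfolding e using z False by (simp add: q_def ww_def YY_def field_simps)
    also have "q - 2 * ww z - 2 * (deriv H z / H z) = (q + 2 * v) - 2 * (ww z + v) - 2 * (deriv H z / H z)" by simp
    finally have Y1: "cmod (YY1 z) = cmod ((q + 2 * v) - 2 * (ww z + v) - 2 * (deriv H z / H z)) * cmod (YY z)"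
      by (simp only: norm_mult)
    have "cmod ((q + 2 * v) - 2 * (ww z + v) - 2 * (deriv H z / H z)) \<le> cmod (q + 2 * v) + cmod (2 * (ww z + v)) + cmod (2 * (deriv H z / H z))"
      by (intro order_trans[OF norm_triangle_ineq4] add_mono norm_triangle_ineq4 order_refl)
    also have "\<dots> \<le> X + 2 * X + 2 * X"
    proof (intro add_mono l3)
      show "cmod (2 * (ww z + v)) \<le> 2 * X" using l1 norm_mult[of 2 "ww z + v"] by simp
      show "cmod (2 * (deriv H z / H z)) \<le> 2 * X" using hh norm_mult[of 2 "deriv H z / H z"] by simp
    qed
    also have "\<dots> \<le> 5 * X ^ 4" using X4[of 5] by simp
    finally show ?thesis unfolding Y1 by (intro mult_right_mono) auto
  qed
  have t0: "cmod (tau z) \<le> X * X"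
  proof -
    have "cmod (tau z) = cmod (Dh z) * cmod (1 / H z)" by (simp add: tau_def norm_divide)
    also have "\<dots> \<le> X * X" using b(6) ih X by (intro mult_mono) auto
    finally show ?thesis .
  qed
  then show "cmod (tau z) \<le> 5 * X ^ 4" using XX by (simp add: power2_eq_square)
  have ih2: "cmod (1 / H z) * cmod (1 / H z) \<le> X * X" using ih X by (intro mult_mono) auto
  have t1: "cmod (tau1 z) \<le> X ^ 3"
  proof -
    have "cmod (tau1 z) = cmod (E1 z) * (cmod (1 / H z) * cmod (1 / H z))" by (simp add: tau1_def norm_divide norm_mult)
    also have "\<dots> \<le> X * (X * X)" by (rule mult_mono[OF b(7) ih2]) (use X in auto)
    finally show ?thesis by (simp add: power3_eq_cube)
  qed
  then show "cmod (tau1 z) \<le> 5 * X ^ 4" using XX by linarith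
  have "cmod (deriv E1 z / (H z * H z)) \<le> X ^ 3"
  proof -
    have "cmod (deriv E1 z / (H z * H z)) = cmod (deriv E1 z) * (cmod (1 / H z) * cmod (1 / H z))" by (simp add: norm_divide norm_mult)
    also have "\<dots> \<le> X * (X * X)" by (rule mult_mono[OF b(8) ih2]) (use X in auto)
    finally show ?thesis by (simp add: power3_eq_cube)
  qed
  moreover have "cmod (2 * tau1 z * (deriv H z / H z)) \<le> 2 * X ^ 4"
  proof -
    have "cmod (tau1 z) * cmod (deriv H z / H z) \<le> X ^ 3 * X" using t1 hh X by (intro mult_mono) auto
    moreover have "X ^ 3 * X = X ^ 4" by (simp add: eval_nat_numeral)
    moreover have "cmod (2 * tau1 z * (deriv H z / H z)) = 2 * (cmod (tau1 z) * cmod (deriv H z / H z))"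
      by (simp only: norm_mult norm_numeral mult.assoc)
    ultimately show ?thesis by simp
  qed
  ultimately show "cmod (tau2 z) \<le> 5 * X ^ 4"
    unfolding tau2_def using norm_triangle_ineq4[of "deriv E1 z / (H z * H z)" "2 * tau1 z * (deriv H z / H z)"] XX by linarith
qed

text \<open>For regions where \<open>T\<close> is not large. From w^2 = -A - w' and |w'| \<le> G |w|
  follows |w| \<le> 1 + G + |T| + |B|, and then Y = w' + \<tau>'/4 - \<tau> U/2 is estimated
  termwise.\<close>

lemma YY_crude:
  assumes z: "f z \<noteq> 0" "H z \<noteq> 0" and G: "G \<ge> 1"
    and b: "cmod (- A z - ww z * ww z) \<le> G * cmod (ww z)" "cmod (tau z) \<le> G" "cmod (tau1 z) \<le> G"
  shows "cmod (YY z) \<le> 6 * G\<^sup>2 * (1 + cmod (T z) + cmod (B z))"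
proof -
  define w where "w = cmod (ww z)"
  define S where "S = cmod (T z) + cmod (B z)"
  have S0: "S \<ge> 0" by (simp add: S_def)
  have w0: "w \<ge> 0" by (simp add: w_def)
  have "cmod (ww z * ww z) \<le> cmod (- A z - ww z * ww z) + cmod (A z)"
    using norm_triangle_ineq4[of "- A z" "- A z - ww z * ww z"] by simp
  then have "w * w \<le> G * w + S"
    using b(1) norm_triangle_ineq[of "T z" "B z"] by (simp add: w_def S_def A_def norm_mult)
  then have w_le: "w \<le> 1 + G + S"
  proof -
    have False if "w > 1 + G + S"
    proof -
      have "w * w \<le> G * w + S * w" using \<open>w * w \<le> G * w + S\<close> S0 that G mult_left_mono[of 1 w S] by simp
      then have "w * w \<le> (G + S) * w" by (simp add: distrib_right)
      then show False using that G S0 by (simp add: mult_le_cancel_right)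
    qed
    then show ?thesis by (meson not_le)
  qed
  have "YY z = (- A z - ww z * ww z) + tau1 z / 4 - tau z * UU z / 2"
    unfolding YY_eq[OF z] UU_def CC_def A_def by (simp add: algebra_simps)
  also have "cmod \<dots> \<le> cmod (- A z - ww z * ww z) + cmod (tau1 z / 4) + cmod (tau z * UU z / 2)"
    by (intro order_trans[OF norm_triangle_ineq4] add_mono norm_triangle_ineq order_refl)
  also have "\<dots> \<le> G * w + G + G * (w + G)"
  proof (intro add_mono)
    have "cmod (UU z) \<le> w + cmod (tau z) / 4" unfolding UU_def w_def using norm_triangle_ineq[of "ww z" "tau z / 4"] by (simp add: norm_divide)
    then have "cmod (UU z) \<le> w + G" using b(2) G by simp
    then have "cmod (tau z) * cmod (UU z) \<le> G * (w + G)" using b(2) G by (intro mult_mono) auto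
    moreover have "0 \<le> cmod (tau z) * cmod (UU z)" by simp
    ultimately show "cmod (tau z * UU z / 2) \<le> G * (w + G)" unfolding norm_divide norm_mult norm_numeral by linarith
  qed (use b G in \<open>auto simp: w_def norm_divide\<close>)
  also have "\<dots> = 2 * (G * w) + G + G * G" by (simp add: algebra_simps)
  also have "\<dots> \<le> 2 * (G * (1 + G + S)) + G * G + G * G"
    using w_le G mult_left_mono[of 1 G G] by (intro add_mono mult_left_mono) auto
  also have "\<dots> = 2 * G + 4 * (G * G) + 2 * (G * S)" by (simp add: algebra_simps)
  also have "\<dots> \<le> 2 * (G * G) + 4 * (G * G) + 6 * (G * G * S)"
  proof -
    have "G \<le> G * G" using G mult_left_mono[of 1 G G] by simp
    moreover have "G * S \<le> G * G * S" using \<open>G \<le> G * G\<close> S0 by (intro mult_right_mono)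
    moreover have "0 \<le> G * G * S" using G S0 by simp
    ultimately show ?thesis by linarith
  qed
  also have "\<dots> = 6 * G\<^sup>2 * (1 + S)" by (simp add: power2_eq_square algebra_simps)
  finally show ?thesis by (simp add: S_def add.assoc)
qed

text \<open>The number \<open>t\<close> is a lower bound for the square root of |T|. Large
  \<open>T\<close> forces w to be at least t/2; in Y (2 w - \<tau>/2) + Y' = \<tau> C - C' the
  factor of Y then has size about t, which dominates |Y'| \<le> G |Y|. The gain over the crude bound
  is the division by t.\<close>

lemma YY_fine:
  assumes z: "f z \<noteq> 0" "H z \<noteq> 0" and G: "G \<ge> 1"
    and b: "cmod (- A z - ww z * ww z) \<le> G * cmod (ww z)" "cmod (tau z) \<le> G" "cmod (tau1 z) \<le> G"
      "cmod (tau2 z) \<le> G" "cmod (YY1 z) \<le> G * cmod (YY z)" "cmod (deriv B z) \<le> G * cmod (B z)"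
    and t: "t \<ge> 8 * G" "t\<^sup>2 \<le> cmod (T z)" "cmod (B z) \<le> t\<^sup>2 / 4"
  shows "cmod (YY z) \<le> 4 * G ^ 3 * (cmod (B z) + 1) / t"
proof -
  define w where "w = cmod (ww z)"
  define b0 where "b0 = cmod (B z)"
  have w0: "w \<ge> 0" "b0 \<ge> 0" by (simp_all add: w_def b0_def)
  \<comment> \<open>Otherwise T = -w' - w^2 - B would have modulus at most t^2 (1/16 + 1/4 + 1/4) =
    9/16 t^2.\<close>
  have w_ge: "w \<ge> t / 2"
  proof (rule ccontr)
    assume "\<not> w \<ge> t / 2"
    then have wt: "w \<le> t / 2" by simp
    have "T z = - (- A z - ww z * ww z) - ww z * ww z - B z" by (simp add: A_def)
    also have "cmod \<dots> \<le> cmod (- A z - ww z * ww z) + cmod (ww z * ww z) + cmod (B z)"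
      by (metis (no_types, lifting) norm_triangle_ineq4 norm_minus_cancel add_right_mono order_trans)
    also have "\<dots> \<le> G * w + w * w + t\<^sup>2 / 4" using b(1) t(3) by (simp add: w_def norm_mult)
    also have "\<dots> \<le> (t / 8) * (t / 2) + (t / 2) * (t / 2) + t\<^sup>2 / 4"
      using wt w0 t(1) G by (intro add_mono mult_mono) auto
    also have "\<dots> = 9/16 * t\<^sup>2" by (simp add: power2_eq_square)
    also have "\<dots> < t\<^sup>2" using t(1) G by simp
    finally show False using t(2) by simp
  qed
  have CC_le: "cmod (CC z) \<le> b0 + G * G"
  proof -
    have "cmod (CC z) \<le> b0 + cmod (tau z * tau z / 16) + cmod (tau1 z / 4)"
      unfolding CC_def b0_def by (intro order_trans[OF norm_triangle_ineq4] add_mono norm_triangle_ineq order_refl)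
    moreover have "cmod (tau z * tau z / 16) \<le> G * G / 16" using b(2) G by (simp add: norm_divide norm_mult mult_mono)
    moreover have "cmod (tau1 z / 4) \<le> G / 4" using b(3) by (simp add: norm_divide)
    moreover have "G \<le> G * G" using G mult_left_mono[of 1 G G] by simp
    ultimately show ?thesis using G by linarith
  qed
  have CC1_le: "cmod (CC1 z) \<le> G * b0 + G * G"
  proof -
    have "cmod (CC1 z) \<le> cmod (deriv B z) + cmod (tau z * tau1 z / 8) + cmod (tau2 z / 4)"
      unfolding CC1_def by (intro order_trans[OF norm_triangle_ineq4] add_mono norm_triangle_ineq order_refl)
    moreover have "cmod (tau z * tau1 z / 8) \<le> G * G / 8" using b(2,3) G by (simp add: norm_divide norm_mult mult_mono)
    moreover have "cmod (tau2 z / 4) \<le> G / 4" using b(4) by (simp add: norm_divide)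
    moreover have "G \<le> G * G" using G mult_left_mono[of 1 G G] by simp
    ultimately show ?thesis using G b(6) unfolding b0_def by linarith
  qed
  have num: "cmod (tau z * CC z - CC1 z) \<le> 2 * (G ^ 3 * (b0 + 1))"
  proof -
    have "cmod (tau z * CC z - CC1 z) \<le> G * (b0 + G * G) + (G * b0 + G * G)"
      using norm_triangle_ineq4[of "tau z * CC z" "CC1 z"] CC1_le mult_mono[OF b(2) CC_le] G by (simp add: norm_mult)
    also have "\<dots> = 2 * (G * b0) + G * G * G + G * G" by (simp add: algebra_simps)
    also have "\<dots> \<le> 2 * (G * G * G * b0) + G * G * G + G * G * G"
    proof -
      have "1 \<le> G * G" using mult_mono[of 1 G 1 G] G by simp
      then have "1 * (G * b0) \<le> (G * G) * (G * b0)" using G w0 by (intro mult_right_mono) auto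
      moreover have "G * G * 1 \<le> G * G * G" using G by (intro mult_left_mono) auto
      ultimately show ?thesis by (simp add: mult_ac)
    qed
    also have "\<dots> = 2 * (G ^ 3 * (b0 + 1))" by (simp add: power3_eq_cube algebra_simps)
    finally show ?thesis .
  qed
  have "YY z * (2 * ww z - tau z / 2) = (tau z * CC z - CC1 z) - YY1 z" by (simp add: YY1_def)
  then have "cmod (YY z) * cmod (2 * ww z - tau z / 2) \<le> 2 * (G ^ 3 * (b0 + 1)) + G * cmod (YY z)"
    using norm_triangle_ineq4[of "tau z * CC z - CC1 z" "YY1 z"] num b(5) by (simp flip: norm_mult)
  moreover have "cmod (YY z) * (t - G / 2) \<le> cmod (YY z) * cmod (2 * ww z - tau z / 2)"
  proof (rule mult_left_mono)
    have "2 * w - cmod (tau z) / 2 \<le> cmod (2 * ww z - tau z / 2)"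
      using norm_triangle_ineq2[of "2 * ww z" "tau z / 2"] by (simp add: w_def norm_mult norm_divide)
    then show "t - G / 2 \<le> cmod (2 * ww z - tau z / 2)" using w_ge b(2) by linarith
  qed simp
  ultimately have "cmod (YY z) * (t - G / 2 - G) \<le> 2 * (G ^ 3 * (b0 + 1))" by (simp add: algebra_simps)
  moreover have "cmod (YY z) * (t / 2) \<le> cmod (YY z) * (t - G / 2 - G)" using t(1) G by (intro mult_left_mono) auto
  ultimately have "cmod (YY z) * t \<le> 4 * G ^ 3 * (b0 + 1)" by (simp add: algebra_simps)
  then show ?thesis using t(1) G by (simp add: b0_def pos_le_divide_eq)
qed

end

text \<open>The residue of F'/F at a, in the form of a limit that also covers points where F does
  not vanish.\<close>

lemma entire_local_order:
  assumes hol: "F holomorphic_on UNIV" and nz: "\<exists>z. F z \<noteq> 0"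
  shows "\<exists>k::nat. ((\<lambda>z. (z - a) * (deriv F z / F z)) \<longlongrightarrow> of_nat k) (at a) \<and> (F a = 0 \<longrightarrow> k > 0) \<and>
    (\<forall>\<^sub>F z in at a. F z \<noteq> 0)"
proof -
  have hol_s: "(\<lambda>x. F (a + x)) holomorphic_on UNIV"
    by (rule holomorphic_on_compose_gen[OF _ hol, unfolded comp_def]) (auto intro!: holomorphic_intros)
  have nz_s: "\<exists>x. F (a + x) \<noteq> 0" using nz by (metis add.commute diff_add_cancel)
  obtain k g where g: "g holomorphic_on UNIV" "g 0 \<noteq> 0" "\<And>x. F (a + x) = x ^ k * g x"
    using entire_factor_zero[OF hol_s nz_s] by blast
  define G where "G = (\<lambda>z. g (z - a))"
  have holG: "G holomorphic_on UNIV" unfolding G_def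
    by (rule holomorphic_on_compose_gen[OF _ g(1), unfolded comp_def]) (auto intro!: holomorphic_intros)
  have Ga: "G a \<noteq> 0" using g(2) by (simp add: G_def)
  have FG: "F z = (z - a) ^ k * G z" for z using g(3)[of "z - a"] by (simp add: G_def)
  have cont: "isCont G a" "isCont (deriv G) a"
    using DERIV_isCont[OF entire_has_derivative[OF holG]] DERIV_isCont[OF entire_has_derivative[OF entire_deriv[OF holG]]] by auto
  have evG: "\<forall>\<^sub>F z in at a. G z \<noteq> 0"
    using cont(1) Ga by (auto simp: isCont_def intro: tendsto_imp_eventually_ne)
  have evn: "\<forall>\<^sub>F z in at a. z \<noteq> a" by (simp add: eventually_at_filter)
  have evF: "\<forall>\<^sub>F z in at a. F z \<noteq> 0" using evG evn by eventually_elim (simp add: FG)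
  have "((\<lambda>z. of_nat k + (z - a) * (deriv G z / G z)) \<longlongrightarrow> of_nat k + (a - a) * (deriv G a / G a)) (at a)"
    using cont Ga by (intro tendsto_intros) (auto simp: isCont_def)
  then have "((\<lambda>z. of_nat k + (z - a) * (deriv G z / G z)) \<longlongrightarrow> of_nat k) (at a)" by simp
  then have lim: "((\<lambda>z. (z - a) * (deriv F z / F z)) \<longlongrightarrow> of_nat k) (at a)"
  proof (rule Lim_transform_eventually)
    show "\<forall>\<^sub>F z in at a. of_nat k + (z - a) * (deriv G z / G z) = (z - a) * (deriv F z / F z)"
      using evG evn
    proof eventually_elim
      case (elim z)
      have "((\<lambda>z. (z - a) ^ k * G z) has_field_derivative of_nat k * (z - a) ^ (k - 1) * G z + deriv G z * (z - a) ^ k) (at z)"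
        by (auto intro!: derivative_eq_intros entire_has_derivative[OF holG])
      moreover have "(\<lambda>z. (z - a) ^ k * G z) = F" by (rule ext) (simp add: FG)
      ultimately have dF: "deriv F z = of_nat k * (z - a) ^ (k - 1) * G z + deriv G z * (z - a) ^ k"
        by (intro DERIV_imp_deriv) simp
      show ?case unfolding dF FG[of z] using elim by (cases k) (simp_all add: field_simps)
    qed
  qed
  have "k > 0" if "F a = 0" using that FG[of a] Ga by (cases k) auto
  then show ?thesis using lim evF by blast
qed

text \<open>The k directions obtained from t by steps of 2 \<pi>/k come within \<pi>/k of any
  target. Rounding finds the nearest multiple \<open>q\<close> of the step, and its remainder modulo
  k names the rotation.\<close>

lemma rotate_into_sector:
  assumes k: "k > 0" "pi / real k \<le> \<eta>"
  shows "\<exists>j<k. \<exists>t'. \<bar>t' - \<theta>\<bar> \<le> \<eta> \<and> cis t * cis (2 * pi * real j / real k) = cis t'"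
proof -
  define y where "y = (\<theta> - t) * real k / (2 * pi)"
  define q where "q = round y"
  define j where "j = nat (q mod int k)"
  define t' where "t' = t + 2 * pi * of_int q / real k"
  have jk: "j < k" and ji: "int j = q mod int k" using k by (auto simp: j_def nat_less_iff)
  have "t' - \<theta> = (2 * pi / real k) * (of_int q - y)" using k by (simp add: t'_def y_def field_simps)
  then have "\<bar>t' - \<theta>\<bar> = (2 * pi / real k) * \<bar>of_int q - y\<bar>" by (simp add: abs_mult)
  also have "\<dots> \<le> (2 * pi / real k) * (1/2)" using of_int_round_abs_le[of y] unfolding q_def by (intro mult_left_mono) auto
  also have "\<dots> \<le> \<eta>" using k by simp
  finally have 1: "\<bar>t' - \<theta>\<bar> \<le> \<eta>" .
  have "of_int q = real k * of_int (q div int k) + real j"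
  proof -
    have "q = int k * (q div int k) + int j" unfolding ji by simp
    then have "(of_int q :: real) = of_int (int k * (q div int k) + int j)" by simp
    then show ?thesis by simp
  qed
  then have "t' = t + 2 * pi * real j / real k + 2 * pi * of_int (q div int k)"
    using k unfolding t'_def by (simp add: field_simps)
  then have "cis t' = cis t * cis (2 * pi * real j / real k) * cis (2 * pi * of_int (q div int k))"
    by (simp only: cis_mult)
  also have "cis (2 * pi * of_int (q div int k)) = 1" by (rule cis_multiple_2pi) simp
  finally have "cis t * cis (2 * pi * real j / real k) = cis t'" by simp
  with 1 jk show ?thesis by blast
qed

lemma five_le_exp_2: "5 \<le> exp (2::real)"
proof -
  have "(1 + 2 / real 4) ^ 4 \<le> exp (2::real)" by (rule exp_ge_one_plus_x_over_n_power_n) auto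
  then show ?thesis by (simp add: eval_nat_numeral)
qed

section \<open>The size of \<open>Y\<close> on the chosen circles\<close>

context bank_laine
begin

lemma T_bounds:
  assumes "1 \<le> X * cmod (H z)" "cmod (H z) \<le> X" "X \<ge> 1"
  shows "cmod (T z) \<le> X * exp (Re (\<zeta> * z ^ n))" "exp (Re (\<zeta> * z ^ n)) \<le> X * cmod (T z)"
  using mult_right_mono[OF assms(1), of "exp (Re (\<zeta> * z ^ n))"] mult_right_mono[OF assms(2), of "exp (Re (\<zeta> * z ^ n))"]
  by (simp_all add: T_def norm_mult mult.assoc)

text \<open>Here \<open>e\<close> stands for \<open>\<epsilon> * r ^ n\<close>, and \<open>G\<close> is the bound of \<open>circle_bounds\<close> with \<open>X = exp e\<close>.\<close>

lemma YY_uniform: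
  assumes z: "f z \<noteq> 0" "H z \<noteq> 0" and e: "e \<ge> 2" and G: "G = 5 * exp (4 * e)"
    and b: "cmod (- A z - ww z * ww z) \<le> G * cmod (ww z)" "cmod (tau z) \<le> G" "cmod (tau1 z) \<le> G"
      "cmod (tau2 z) \<le> G" "cmod (YY1 z) \<le> G * cmod (YY z)" "cmod (deriv B z) \<le> G * cmod (B z)"
    and HX: "1 \<le> exp e * cmod (H z)" "cmod (H z) \<le> exp e"
    and a: "a = Re (\<zeta> * z ^ n)" and Bz: "cmod (B z) \<le> exp (max a 0 / 2 + e)"
  shows "cmod (YY z) \<le> exp (60 * e)"
    and "40 * e \<le> a \<Longrightarrow> cmod (B z) \<le> exp (a / 2 - d) \<Longrightarrow> d \<ge> 0 \<Longrightarrow> d \<le> a \<Longrightarrow> cmod (YY z) \<le> exp (21 * e - d / 2)"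
proof -
  have ex: "5 \<le> exp (2::real)" by (rule five_le_exp_2)
  have five: "5 \<le> exp e" using ex e by (meson exp_le_cancel_iff order_trans)
  have eight: "8 \<le> exp (2 * e)"
  proof -
    have "exp (2 * e) = exp e * exp e" by (simp flip: exp_add)
    then show ?thesis using mult_mono[OF five five] by simp
  qed
  have G1: "G \<ge> 1" unfolding G using e one_le_exp_iff[of "4 * e"] by linarith
  have G5: "G \<le> exp (5 * e)"
  proof -
    have "G \<le> exp e * exp (4 * e)" unfolding G using five by (intro mult_right_mono) auto
    then show ?thesis by (simp flip: exp_add)
  qed
  have G2: "G ^ 2 \<le> exp (10 * e)" using power_mono[OF G5, of 2] G1 by (simp flip: exp_of_nat_mult)
  have G3: "G ^ 3 \<le> exp (15 * e)" using power_mono[OF G5, of 3] G1 by (simp flip: exp_of_nat_mult)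
  have X1: "exp e \<ge> 1" using e by simp
  have T1: "cmod (T z) \<le> exp e * exp a" and T2: "exp a \<le> exp e * cmod (T z)"
    using T_bounds[OF HX X1] unfolding a by auto
  \<comment> \<open>Here t = exp ((a - e)/2), since |T| is at least exp (a - e). The threshold 40 e
    is generous: 8 G \<le> exp (7 e) \<le> t requires 15 e, and 4 |B| \<le> t^2 requires 8
    e.\<close>
  have big: "cmod (YY z) \<le> 4 * G ^ 3 * (cmod (B z) + 1) / exp (a / 2 - e / 2)" if a40: "40 * e \<le> a"
  proof (rule YY_fine[OF z G1 b])
    have "8 * G \<le> exp (2 * e) * exp (5 * e)" using eight G5 G1 by (intro mult_mono) auto
    also have "\<dots> \<le> exp (a / 2 - e / 2)" using a40 e by (simp flip: exp_add)
    finally show "8 * G \<le> exp (a / 2 - e / 2)" .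
    have sq: "(exp (a / 2 - e / 2))\<^sup>2 = exp (a - e)" by (simp add: field_simps flip: exp_of_nat_mult)
    have "exp (a - e) * exp e \<le> cmod (T z) * exp e" using T2 by (simp add: mult.commute flip: exp_add)
    then show "(exp (a / 2 - e / 2))\<^sup>2 \<le> cmod (T z)" unfolding sq by simp
    have "4 * cmod (B z) \<le> exp (2 * e) * exp (a / 2 + e)"
      using Bz eight a40 e by (intro mult_mono) (auto simp: max_def)
    also have "\<dots> \<le> exp (a - e)" using a40 e by (simp flip: exp_add)
    finally show "cmod (B z) \<le> (exp (a / 2 - e / 2))\<^sup>2 / 4" unfolding sq by simp
  qed
  have big2: "cmod (YY z) \<le> exp (17 * e) * (cmod (B z) + 1) * exp (e / 2 - a / 2)" if a40: "40 * e \<le> a"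
  proof -
    have "4 * G ^ 3 \<le> exp (2 * e) * exp (15 * e)" using eight G3 G1 by (intro mult_mono) auto
    then have "4 * G ^ 3 \<le> exp (17 * e)" by (simp flip: exp_add)
    then have "4 * G ^ 3 * (cmod (B z) + 1) / exp (a / 2 - e / 2) \<le> exp (17 * e) * (cmod (B z) + 1) / exp (a / 2 - e / 2)"
      by (intro divide_right_mono mult_right_mono) auto
    also have "\<dots> = exp (17 * e) * (cmod (B z) + 1) * exp (e / 2 - a / 2)"
    proof -
      have "exp (e / 2 - a / 2) = inverse (exp (a / 2 - e / 2))" by (simp flip: exp_minus)
      then show ?thesis by (simp only: divide_inverse)
    qed
    finally show ?thesis using big[OF a40] by linarith
  qed
  \<comment> \<open>For a \<ge> 40 e the growth exp (a/2) of \<open>B\<close> cancels against 1/t.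
    Below this threshold \<open>T\<close> and \<open>B\<close> are at most exp (41 e), and the crude
    bound adds up to exp (55 e).\<close>
  show "cmod (YY z) \<le> exp (60 * e)"
  proof (cases "40 * e \<le> a")
    case True
    have "1 \<le> exp (a / 2 + e)" using True e by simp
    moreover have "cmod (B z) \<le> exp (a / 2 + e)" using Bz True e by (simp add: max_def)
    ultimately have "cmod (B z) + 1 \<le> 2 * exp (a / 2 + e)" by linarith
    also have "\<dots> \<le> exp (2 * e) * exp (a / 2 + e)" using eight by (intro mult_right_mono) auto
    finally have "cmod (B z) + 1 \<le> exp (a / 2 + 3 * e)" by (simp add: add.commute flip: exp_add)
    then have "exp (17 * e) * (cmod (B z) + 1) * exp (e / 2 - a / 2) \<le> exp (17 * e) * exp (a / 2 + 3 * e) * exp (e / 2 - a / 2)"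
      by (intro mult_right_mono mult_left_mono) auto
    also have "\<dots> = exp (17 * e + (a / 2 + 3 * e) + (e / 2 - a / 2))" by (simp only: exp_add)
    also have "\<dots> \<le> exp (60 * e)" using e by simp
    finally show ?thesis using big2[OF True] by linarith
  next
    case False
    define p where "p = max a 0"
    have p: "0 \<le> p" "p \<le> 40 * e" using False e by (auto simp: p_def)
    have "cmod (YY z) \<le> 6 * G\<^sup>2 * (1 + cmod (T z) + cmod (B z))" by (rule YY_crude[OF z G1 b(1-3)])
    also have "\<dots> \<le> exp (2 * e) * exp (10 * e) * (exp (2 * e) * exp (p + e))"
    proof (intro mult_mono)
      have "1 \<le> exp (p + e)" using p e by simp
      moreover have "cmod (T z) \<le> exp (p + e)"
        using T1 by (rule order_trans) (simp add: p_def flip: exp_add)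
      moreover have "cmod (B z) \<le> exp (p + e)" using Bz by (rule order_trans) (simp add: p_def)
      ultimately have "1 + cmod (T z) + cmod (B z) \<le> 3 * exp (p + e)" by linarith
      also have "\<dots> \<le> exp (2 * e) * exp (p + e)" using eight by (intro mult_right_mono) auto
      finally show "1 + cmod (T z) + cmod (B z) \<le> exp (2 * e) * exp (p + e)" .
    qed (use eight G2 in \<open>auto intro!: add_nonneg_nonneg\<close>)
    also have "\<dots> = exp (2 * e + 10 * e + (2 * e + (p + e)))" by (simp only: exp_add)
    also have "\<dots> \<le> exp (60 * e)" using p e by simp
    finally show ?thesis .
  qed
  \<comment> \<open>Same cancellation, but now \<open>B\<close> is smaller than exp (a/2) by a
    factor exp (-d); d/2 is given away so that the summand 1 beside |B| is covered as well, using d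
    \<le> a.\<close>
  show "cmod (YY z) \<le> exp (21 * e - d / 2)"
    if a40: "40 * e \<le> a" and Bd: "cmod (B z) \<le> exp (a / 2 - d)" and d: "d \<ge> 0" "d \<le> a"
  proof -
    have "cmod (B z) \<le> exp (a / 2 - d / 2)" using Bd by (rule order_trans) (use d in simp)
    moreover have "1 \<le> exp (a / 2 - d / 2)" using d by simp
    ultimately have "cmod (B z) + 1 \<le> 2 * exp (a / 2 - d / 2)" by linarith
    also have "\<dots> \<le> exp (2 * e) * exp (a / 2 - d / 2)" using eight by (intro mult_right_mono) auto
    finally have "exp (17 * e) * (cmod (B z) + 1) * exp (e / 2 - a / 2) \<le> exp (17 * e) * (exp (2 * e) * exp (a / 2 - d / 2)) * exp (e / 2 - a / 2)"
      by (intro mult_right_mono mult_left_mono) auto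
    also have "\<dots> = exp (17 * e + (2 * e + (a / 2 - d / 2)) + (e / 2 - a / 2))" by (simp only: exp_add)
    also have "\<dots> \<le> exp (21 * e - d / 2)" using e by simp
    finally show ?thesis using big2[OF a40] by linarith
  qed
qed

text \<open>Formulated for NY u^2 instead of \<open>Y\<close>, because the maximum principle needs a
  function without poles in the disc. The fixed value of \<open>u\<close> at 0 makes different radii
  comparable. The last clause is reserved for the proof that \<open>C\<close> vanishes.\<close>

definition estimates :: "real \<Rightarrow> real \<Rightarrow> real \<Rightarrow> real \<Rightarrow> real \<Rightarrow> bool" where
  "estimates \<theta>0 \<delta> \<eta> \<epsilon> R \<longleftrightarrow>
     (\<exists>r u. R \<le> r \<and> r \<le> 2 * R \<and> u holomorphic_on ball 0 (14 * R) \<and>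
       u 0 = 1 / f1 0 \<and>
       (\<forall>z. cmod z = r \<longrightarrow> cmod (NY z * (u z * u z)) \<le> exp (64 * (\<epsilon> * r ^ n))) \<and>
       (\<forall>t. \<bar>t - \<theta>0\<bar> \<le> \<eta> \<longrightarrow>
         cmod (NY (of_real r * cis t) * (u (of_real r * cis t) * u (of_real r * cis t))) \<le> exp (25 * (\<epsilon> * r ^ n) - \<delta> / 2 * r ^ n)) \<and>
       (\<exists>z. cmod z = r \<and> H z \<noteq> 0 \<and> cmod (CC z) \<le> exp (12 * (\<epsilon> * r ^ n) - \<delta> / 2 * r ^ n) * cmod (T z)))"

text \<open>NY u^2 equals Y (f u)^2 H^2, so passing from \<open>Y\<close> costs four factors exp
  (\<epsilon> r^n): 60 becomes 64 and 21 becomes 25. The condition 40 \<epsilon> \<le> \<delta>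
  places the whole sector in the range where the fine bound applies.\<close>

lemma circle_estimates:
  "\<exists>\<theta>0 \<delta> \<eta>. \<delta> > 0 \<and> \<eta> > 0 \<and>
    (\<forall>\<epsilon>>0. 40 * \<epsilon> \<le> \<delta> \<longrightarrow> (\<exists>R0. \<forall>R\<ge>R0. estimates \<theta>0 \<delta> \<eta> \<epsilon> R))"
proof -
  obtain \<theta>0 \<delta> \<eta> r0 where d: "\<delta> > 0" and eta: "\<eta> > 0" and dec: "\<And>\<rho> t. \<rho> \<ge> r0 \<Longrightarrow> \<bar>t - \<theta>0\<bar> \<le> \<eta> \<Longrightarrow>
     \<delta> \<le> cc t \<and> cmod (B (of_real \<rho> * cis t)) \<le> exp ((cc t / 2 - \<delta>) * \<rho> ^ n)"
    using decay_bound by blast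
  show ?thesis
  proof (rule exI[of _ \<theta>0], rule exI[of _ \<delta>], rule exI[of _ \<eta>], intro conjI d eta allI impI)
    fix \<epsilon> :: real assume e: "\<epsilon> > 0" "40 * \<epsilon> \<le> \<delta>"
    obtain r1 where r1: "\<And>z. cmod z \<ge> r1 \<Longrightarrow> cmod (B z) \<le> exp (max (Re (\<zeta> * z ^ n)) 0 / 2 + \<epsilon> * cmod z ^ n)"
      using uniform_bound[OF e(1)] by blast
    obtain r2 where r2: "\<And>r. r \<ge> r2 \<Longrightarrow> 2 \<le> \<epsilon> * r ^ n"
      using const_le_power[OF n e(1), of 2] by (auto simp: eventually_at_top_linorder)
    obtain R0 where R0: "\<forall>R\<ge>R0. \<exists>r u. tame_circle \<epsilon> R r u"
      using good_circles[OF e(1)] by blast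
    show "\<exists>R0. \<forall>R\<ge>R0. estimates \<theta>0 \<delta> \<eta> \<epsilon> R"
    proof (rule exI[of _ "max (max R0 1) (max r0 (max r1 r2))"], intro allI impI)
      fix R assume Rm: "max (max R0 1) (max r0 (max r1 r2)) \<le> R"
      then have "R \<ge> R0" "R \<ge> 1" by auto
      obtain r u where r: "R \<le> r" "r \<le> 2 * R" and u: "u holomorphic_on ball 0 (14 * R)" "\<And>z. z \<in> ball 0 (14 * R) \<Longrightarrow> u z \<noteq> 0"
        "u 0 = 1 / f1 0" and all: "\<And>z. cmod z = r \<Longrightarrow> f z \<noteq> 0 \<and> H z \<noteq> 0 \<and>
      cmod (f z * u z) \<le> exp (\<epsilon> * r ^ n) \<and>
      cmod (deriv (\<lambda>z. f z * u z) z) \<le> exp (\<epsilon> * r ^ n) * cmod (f z * u z) \<and>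
      cmod (deriv (\<lambda>z. deriv f z * u z) z) \<le> exp (\<epsilon> * r ^ n) * cmod (deriv f z * u z) \<and>
      cmod (deriv (\<lambda>z. NY z * (u z * u z)) z) \<le> exp (\<epsilon> * r ^ n) * cmod (NY z * (u z * u z)) \<and>
      cmod (deriv B z) \<le> exp (\<epsilon> * r ^ n) * cmod (B z) \<and>
      cmod (deriv H z) \<le> exp (\<epsilon> * r ^ n) * cmod (H z) \<and>
      1 \<le> exp (\<epsilon> * r ^ n) * cmod (H z) \<and>
      cmod (H z) \<le> exp (\<epsilon> * r ^ n) \<and> cmod (Dh z) \<le> exp (\<epsilon> * r ^ n) \<and>
      cmod (E1 z) \<le> exp (\<epsilon> * r ^ n) \<and> cmod (deriv E1 z) \<le> exp (\<epsilon> * r ^ n)"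
        using R0[rule_format, OF \<open>R \<ge> R0\<close>] unfolding tame_circle_def by blast
      define x where "x = \<epsilon> * r ^ n"
      have x2: "x \<ge> 2" unfolding x_def using Rm r by (intro r2) auto
      define G where "G = 5 * exp (4 * x)"
      have r_ge: "r \<ge> r0" "r \<ge> r1" "r \<ge> 1" using Rm r by auto
      have dx: "40 * x \<le> \<delta> * r ^ n" unfolding x_def using mult_right_mono[OF e(2), of "r ^ n"] r_ge by (simp add: mult.assoc)
      have X1: "exp x \<ge> 1" using x2 by simp
      have X4: "5 * exp x ^ 4 = G" by (simp add: G_def flip: exp_of_nat_mult)
      have bounds: "cmod (- A z - ww z * ww z) \<le> G * cmod (ww z)" "cmod (tau z) \<le> G" "cmod (tau1 z) \<le> G"
        "cmod (tau2 z) \<le> G" "cmod (YY1 z) \<le> G * cmod (YY z)" "cmod (deriv B z) \<le> G * cmod (B z)"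
        if z: "cmod z = r" for z
      proof -
        have zB: "z \<in> ball 0 (14 * R)" using z r \<open>R \<ge> 1\<close> by simp
        note a = all[OF z, folded x_def]
        note cb = circle_bounds[where z = z and X = "exp x" and u = u and \<rho> = "14 * R", unfolded X4]
        show "cmod (- A z - ww z * ww z) \<le> G * cmod (ww z)" "cmod (tau z) \<le> G" "cmod (tau1 z) \<le> G"
          "cmod (tau2 z) \<le> G" "cmod (YY1 z) \<le> G * cmod (YY z)"
          using a X1 zB by (intro cb u; simp)+
        have "exp x \<le> G"
        proof -
          have "exp x \<le> exp (4 * x)" using x2 by simp
          then show ?thesis unfolding G_def using exp_ge_zero[of "4 * x"] by linarith
        qed
        then have "exp x * cmod (B z) \<le> G * cmod (B z)" by (intro mult_right_mono) auto
        then show "cmod (deriv B z) \<le> G * cmod (B z)" using a by linarith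
      qed
      have NYu: "cmod (NY z * (u z * u z)) \<le> cmod (YY z) * exp (4 * x)" if z: "cmod z = r" for z
      proof -
        note a = all[OF z, folded x_def]
        have "NY z = YY z * (f z * f z * H z * H z)" using a by (simp add: YY_def)
        then have "NY z * (u z * u z) = YY z * ((f z * u z) * (f z * u z) * (H z * H z))" by (simp add: mult_ac)
        then have "cmod (NY z * (u z * u z)) = cmod (YY z) * (cmod (f z * u z) * cmod (f z * u z) * (cmod (H z) * cmod (H z)))"
          by (simp only: norm_mult)
        also have "\<dots> \<le> cmod (YY z) * (exp x * exp x * (exp x * exp x))"
          using a by (intro mult_left_mono mult_mono) auto
        also have "exp x * exp x * (exp x * exp x) = exp (4 * x)" by (simp flip: exp_add)
        finally show ?thesis .
      qed
      have Yu: "cmod (YY z) \<le> exp (60 * x)" if z: "cmod z = r" for z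
      proof (rule YY_uniform(1)[OF _ _ x2 G_def bounds[OF z] _ _ refl])
        show "cmod (B z) \<le> exp (max (Re (\<zeta> * z ^ n)) 0 / 2 + x)" using r1[of z] z r_ge by (simp add: x_def)
      qed (use all[OF z, folded x_def] in auto)
      have sector: "Re (\<zeta> * (of_real r * cis t) ^ n) = cc t * r ^ n" "\<delta> * r ^ n \<le> cc t * r ^ n"
         "cmod (B (of_real r * cis t)) \<le> exp (cc t * r ^ n / 2 - \<delta> * r ^ n)" if t: "\<bar>t - \<theta>0\<bar> \<le> \<eta>" for t
      proof -
        show "Re (\<zeta> * (of_real r * cis t) ^ n) = cc t * r ^ n" by (rule Re_cc)
        show "\<delta> * r ^ n \<le> cc t * r ^ n" using dec[OF r_ge(1) t] r_ge by (intro mult_right_mono) auto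
        show "cmod (B (of_real r * cis t)) \<le> exp (cc t * r ^ n / 2 - \<delta> * r ^ n)"
          using dec[OF r_ge(1) t] by (simp add: left_diff_distrib)
      qed
      have on: "cmod (of_real r * cis t) = r" for t using r_ge by (simp add: norm_mult)
      show "estimates \<theta>0 \<delta> \<eta> \<epsilon> R"
        unfolding estimates_def
      proof (rule exI[of _ r], rule exI[of _ u], intro conjI allI impI)
        show "R \<le> r" "r \<le> 2 * R" by (fact r)+
        show "u holomorphic_on ball 0 (14 * R)" "u 0 = 1 / f1 0" by (fact u)+
        show "cmod (NY z * (u z * u z)) \<le> exp (64 * (\<epsilon> * r ^ n))" if z: "cmod z = r" for z
        proof -
          have "cmod (YY z) * exp (4 * x) \<le> exp (60 * x) * exp (4 * x)" using Yu[OF z] by (intro mult_right_mono) auto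
          also have "\<dots> = exp (64 * x)" by (simp flip: exp_add)
          finally show ?thesis using NYu[OF z] by (simp add: x_def)
        qed
        show "cmod (NY (of_real r * cis t) * (u (of_real r * cis t) * u (of_real r * cis t))) \<le> exp (25 * (\<epsilon> * r ^ n) - \<delta> / 2 * r ^ n)"
          if t: "\<bar>t - \<theta>0\<bar> \<le> \<eta>" for t
        proof -
          let ?z = "of_real r * cis t"
          have "cmod (YY ?z) \<le> exp (21 * x - \<delta> * r ^ n / 2)"
          proof (rule YY_uniform(2)[OF _ _ x2 G_def bounds[OF on] _ _ sector(1)[OF t, symmetric]])
            show "cmod (B ?z) \<le> exp (max (cc t * r ^ n) 0 / 2 + x)" using r1[of ?z] r_ge unfolding on Re_cc by (simp add: x_def)
            show "40 * x \<le> cc t * r ^ n" using sector(2)[OF t] dx by linarith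
            show "0 \<le> \<delta> * r ^ n" using d r_ge by simp
          qed (use all[OF on, folded x_def] sector[OF t] in auto)
          then have "cmod (YY ?z) * exp (4 * x) \<le> exp (21 * x - \<delta> * r ^ n / 2) * exp (4 * x)" by (intro mult_right_mono) auto
          also have "\<dots> = exp (25 * x - \<delta> / 2 * r ^ n)" by (simp flip: exp_add)
          finally show ?thesis using NYu[OF on, of t] by (simp add: x_def)
        qed
        show "\<exists>z. cmod z = r \<and> H z \<noteq> 0 \<and> cmod (CC z) \<le> exp (12 * (\<epsilon> * r ^ n) - \<delta> / 2 * r ^ n) * cmod (T z)"
        proof (intro exI[of _ "of_real r * cis \<theta>0"] conjI on)
          let ?z = "of_real r * cis \<theta>0"
          have t: "\<bar>\<theta>0 - \<theta>0\<bar> \<le> \<eta>" using eta by simp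
          note al = all[OF on[of \<theta>0], folded x_def]
          show "H ?z \<noteq> 0" using al by blast
          define a where "a = cc \<theta>0 * r ^ n"
          define D where "D = \<delta> * r ^ n"
          have aD: "D \<le> a" "D \<ge> 0" using sector(2)[OF t] d r_ge by (simp_all add: a_def D_def)
          have T2: "exp a \<le> exp x * cmod (T ?z)" using T_bounds(2)[OF _ _ X1, of ?z] al unfolding Re_cc a_def by auto
          have G5: "G * G \<le> exp (10 * x)"
          proof -
            have "exp (2::real) \<le> exp x" using x2 by simp
            moreover have "5 \<le> exp (2::real)" by (rule five_le_exp_2)
            ultimately have "5 \<le> exp x" by (rule order_trans[rotated])
            then have "G \<le> exp x * exp (4 * x)" unfolding G_def by (intro mult_right_mono) auto
            then have "G \<le> exp (5 * x)" by (simp flip: exp_add)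
            then have "G * G \<le> exp (5 * x) * exp (5 * x)" by (intro mult_mono) (auto simp: G_def)
            then show ?thesis by (simp flip: exp_add)
          qed
          have G1: "G \<ge> 1" unfolding G_def using x2 one_le_exp_iff[of "4 * x"] by linarith
          have "cmod (CC ?z) \<le> cmod (B ?z) + cmod (tau ?z * tau ?z / 16) + cmod (tau1 ?z / 4)"
            unfolding CC_def by (intro order_trans[OF norm_triangle_ineq4] add_mono norm_triangle_ineq order_refl)
          moreover have "cmod (tau ?z * tau ?z / 16) \<le> G * G / 16"
            using bounds(2)[OF on, of \<theta>0] G1 by (simp add: norm_divide norm_mult mult_mono)
          moreover have "cmod (tau1 ?z / 4) \<le> G / 4" using bounds(3)[OF on, of \<theta>0] by (simp add: norm_divide)
          moreover have "G \<le> G * G" using G1 mult_left_mono[of 1 G G] by simp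
          ultimately have "cmod (CC ?z) \<le> cmod (B ?z) + G * G" using G1 by linarith
          \<comment> \<open>The 12 collects 10 from G^2, one for the factor 2, and one for the
            comparison of exp a with |T|.\<close>
          also have "\<dots> \<le> exp (a / 2 - D) + exp (10 * x)" using sector(3)[OF t] G5 by (simp add: a_def D_def)
          also have "\<dots> \<le> exp (10 * x + (a - D / 2)) + exp (10 * x + (a - D / 2))"
            using aD x2 by (intro add_mono) auto
          also have "\<dots> = 2 * exp (10 * x + (a - D / 2))" by simp
          also have "\<dots> \<le> exp x * exp (10 * x + (a - D / 2))"
          proof (intro mult_right_mono)
            show "2 \<le> exp x" using x2 exp_ge_add_one_self[of x] by linarith
          qed simp
          also have "\<dots> = exp (11 * x - D / 2) * exp a" by (simp flip: exp_add)
          also have "\<dots> \<le> exp (11 * x - D / 2) * (exp x * cmod (T ?z))" using T2 by (intro mult_left_mono) auto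
          also have "\<dots> = exp (12 * x - D / 2) * cmod (T ?z)" by (simp add: mult.assoc[symmetric] flip: exp_add)
          finally show "cmod (CC ?z) \<le> exp (12 * (\<epsilon> * r ^ n) - \<delta> / 2 * r ^ n) * cmod (T ?z)" by (simp add: x_def D_def)
        qed
      qed
    qed
  qed
qed

subsection \<open>Vanishing of \<open>Y\<close> and its consequences\<close>

text \<open>Multiplying rotated copies spreads the smallness in one sector over the whole circle.\<close>

lemma NY_zero: "NY z = 0"
proof (rule ccontr)
  assume "NY z \<noteq> 0"
  then have "\<exists>z. NY z \<noteq> 0" by blast
  then obtain \<mu> N1 where N1: "N1 holomorphic_on UNIV" "N1 0 \<noteq> 0" "\<And>z. NY z = z ^ \<mu> * N1 z"
    using entire_factor_zero[OF holNY] by metis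
  obtain \<theta>0 \<delta> \<eta> where d: "\<delta> > 0" and eta: "\<eta> > 0" and est:
    "\<forall>\<epsilon>>0. 40 * \<epsilon> \<le> \<delta> \<longrightarrow> (\<exists>R0. \<forall>R\<ge>R0. estimates \<theta>0 \<delta> \<eta> \<epsilon> R)"
    using circle_estimates by blast
  obtain k :: nat where k: "pi / \<eta> < real k" using reals_Archimedean2 by blast
  have k0: "k > 0" using k eta pi_gt_zero by (intro Nat.gr0I) (auto simp: field_simps)
  have keta: "pi / real k \<le> \<eta>" using k k0 eta by (simp add: field_simps)
  \<comment> \<open>The other k - 1 factors cost at most 64 \<epsilon> k = \<delta>/4 and the good
    one 25 \<epsilon> < \<delta>/8, so that of the gain \<delta>/2 at least \<delta>/8
    survives.\<close>
  define \<epsilon> where "\<epsilon> = \<delta> / (256 * real k)"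
  have e: "\<epsilon> > 0" using d k0 by (simp add: \<epsilon>_def)
  have ek: "256 * (\<epsilon> * real k) = \<delta>" using k0 by (simp add: \<epsilon>_def)
  have e1: "\<epsilon> \<le> \<epsilon> * real k" using e k0 by simp
  have e40: "40 * \<epsilon> \<le> \<delta>" using ek e1 e by linarith
  obtain R0 where R0: "\<And>R. R \<ge> R0 \<Longrightarrow> estimates \<theta>0 \<delta> \<eta> \<epsilon> R"
    using est[rule_format, OF e e40] by blast
  define c where "c = cmod (N1 0 / (f1 0 * f1 0)) ^ k"
  have c: "c > 0" using N1(2) f1(2) by (simp add: c_def)
  have "\<forall>\<^sub>F r in at_top. - ln c + 1 \<le> \<delta> / 8 * r ^ n" using d by (intro const_le_power n) auto
  then obtain r1 where r1: "\<And>r. r \<ge> r1 \<Longrightarrow> - ln c + 1 \<le> \<delta> / 8 * r ^ n" by (auto simp: eventually_at_top_linorder)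
  define R where "R = max (max R0 1) r1"
  have R: "R \<ge> R0" "R \<ge> 1" "R \<ge> r1" by (auto simp: R_def)
  obtain r u where r: "R \<le> r" "r \<le> 2 * R" and u: "u holomorphic_on ball 0 (14 * R)" "u 0 = 1 / f1 0"
    and all: "\<And>z. cmod z = r \<Longrightarrow> cmod (NY z * (u z * u z)) \<le> exp (64 * (\<epsilon> * r ^ n))"
    and sec: "\<And>t. \<bar>t - \<theta>0\<bar> \<le> \<eta> \<Longrightarrow>
        cmod (NY (of_real r * cis t) * (u (of_real r * cis t) * u (of_real r * cis t))) \<le> exp (25 * (\<epsilon> * r ^ n) - \<delta> / 2 * r ^ n)"
    using R0[OF R(1)] unfolding estimates_def by blast
  define x where "x = r ^ n"
  have x: "x \<ge> 0" using r R by (simp add: x_def)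
  \<comment> \<open>Division by z^\<mu> makes the value at the origin nonzero and only lowers the
    modulus on circles of radius at least 1.\<close>
  define P where "P = (\<lambda>z. N1 z * (u z * u z))"
  have P_le: "cmod (P z) \<le> cmod (NY z * (u z * u z))" if z: "cmod z = r" for z
  proof -
    have "1 * cmod (P z) \<le> cmod z ^ \<mu> * cmod (P z)" using z r R by (intro mult_right_mono one_le_power) auto
    also have "\<dots> = cmod (NY z * (u z * u z))" by (simp add: P_def N1(3) norm_mult norm_power mult_ac)
    finally show ?thesis by simp
  qed
  define \<omega> where "\<omega> = (\<lambda>j::nat. cis (2 * pi * real j / real k))"
  \<comment> \<open>On the circle at least one of the k factors is evaluated in the sector of
    decay.\<close>
  define Q where "Q = (\<lambda>z. \<Prod>j<k. P (z * \<omega> j))"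
  have holP: "P holomorphic_on ball 0 (14 * R)"
    unfolding P_def by (intro holomorphic_intros u holomorphic_on_subset[OF N1(1)]) auto
  have holQ: "Q holomorphic_on ball 0 (14 * R)"
    unfolding Q_def
    by (intro holomorphic_on_prod holomorphic_on_compose_gen[OF _ holP, unfolded comp_def])
      (auto intro!: holomorphic_intros simp: norm_mult \<omega>_def)
  have sub: "cball 0 r \<subseteq> ball (0::complex) (14 * R)" using r R by auto
  have "cmod (Q 0) \<le> exp (- (\<delta> / 8 * x))"
  proof (rule maximum_modulus_frontier[where S = "cball 0 r" and f = Q])
    show "Q holomorphic_on interior (cball 0 r)"
      using holomorphic_on_subset[OF holQ] sub interior_subset by blast
    show "continuous_on (closure (cball 0 r)) Q"
      using holomorphic_on_subset[OF holQ sub] by (simp add: holomorphic_on_imp_continuous_on)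
    fix z :: complex assume "z \<in> frontier (cball 0 r)"
    then have z: "cmod z = r" using r R by auto
    have zt: "z = of_real r * cis (Arg z)" using rcis_cmod_Arg[of z] z by (simp add: rcis_def)
    obtain j t' where j: "j < k" "\<bar>t' - \<theta>0\<bar> \<le> \<eta>" "cis (Arg z) * \<omega> j = cis t'"
      using rotate_into_sector[OF k0 keta, of \<theta>0 "Arg z"] unfolding \<omega>_def by blast
    have zj: "z * \<omega> j = of_real r * cis t'" using zt j(3) by (metis mult.assoc)
    have n\<omega>: "cmod (z * \<omega> i) = r" for i using z by (simp add: norm_mult \<omega>_def)
    have "cmod (Q z) = (\<Prod>i<k. cmod (P (z * \<omega> i)))" by (simp add: Q_def prod_norm)
    also have "\<dots> = cmod (P (z * \<omega> j)) * (\<Prod>i\<in>{..<k} - {j}. cmod (P (z * \<omega> i)))"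
      using j(1) by (intro prod.remove) auto
    also have "\<dots> \<le> exp (25 * (\<epsilon> * x) - \<delta> / 2 * x) * (\<Prod>i\<in>{..<k} - {j}. exp (64 * (\<epsilon> * x)))"
    proof (intro mult_mono prod_mono conjI)
      show "cmod (P (z * \<omega> j)) \<le> exp (25 * (\<epsilon> * x) - \<delta> / 2 * x)"
        using order_trans[OF P_le[OF n\<omega>[of j]]] sec[OF j(2)] unfolding zj x_def by blast
      show "cmod (P (z * \<omega> i)) \<le> exp (64 * (\<epsilon> * x))" for i
        using order_trans[OF P_le[OF n\<omega>[of i]] all[OF n\<omega>[of i]]] unfolding x_def .
    qed (auto intro: prod_nonneg)
    also have "(\<Prod>i\<in>{..<k} - {j}. exp (64 * (\<epsilon> * x))) = exp (64 * (\<epsilon> * x)) ^ (k - 1)"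
      using j(1) by simp
    also have "exp (64 * (\<epsilon> * x)) ^ (k - 1) = exp (real (k - 1) * (64 * (\<epsilon> * x)))"
      by (rule exp_of_nat_mult[symmetric])
    also have "exp (25 * (\<epsilon> * x) - \<delta> / 2 * x) * exp (real (k - 1) * (64 * (\<epsilon> * x))) =
        exp (25 * (\<epsilon> * x) - \<delta> / 2 * x + real (k - 1) * (64 * (\<epsilon> * x)))"
      by (rule exp_add[symmetric])
    also have "\<dots> \<le> exp (- (\<delta> / 8 * x))"
    proof -
      have "real (k - 1) * (64 * (\<epsilon> * x)) \<le> real k * (64 * (\<epsilon> * x))" using e x by (intro mult_right_mono) auto
      also have "\<dots> = 64 * (\<epsilon> * real k) * x" by simp
      also have "64 * (\<epsilon> * real k) = \<delta> / 4" using ek by simp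
      finally have 1: "real (k - 1) * (64 * (\<epsilon> * x)) \<le> \<delta> / 4 * x" .
      have "\<epsilon> * x \<le> \<delta> / 256 * x" using e1 ek x by (intro mult_right_mono) auto
      moreover have "0 \<le> \<delta> * x" using d x by simp
      ultimately show ?thesis using 1 by simp
    qed
    finally show "cmod (Q z) \<le> exp (- (\<delta> / 8 * x))" .
  qed (use r R in auto)
  \<comment> \<open>The value at 0 is independent of the radius because \<open>u 0\<close> is,
    whereas the bound just obtained tends to 0.\<close>
  moreover have "cmod (Q 0) = c"
    by (simp add: Q_def P_def u(2) c_def norm_power norm_mult norm_divide)
  ultimately have "ln c \<le> - (\<delta> / 8 * x)" using c by (metis ln_exp ln_le_cancel_iff exp_gt_zero)
  then show False using r1[of r] r R unfolding x_def by linarith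
qed

text \<open>With Y = 0 the differentiated equation reduces to C' = \<tau> C, which is also the
  equation of \<open>T\<close>. Hence C is a constant multiple of T, but on arbitrarily large
  circles it is exponentially smaller at some point.\<close>

lemma CC_zero: "H z \<noteq> 0 \<Longrightarrow> CC z = 0"
proof -
  \<comment> \<open>C times H^2, with denominators cleared, so that proportionality on a small ball
    extends to the plane by the identity theorem.\<close>
  define CH where "CH = (\<lambda>z. B z * (H z * H z) + Dh z * Dh z / 16 - E1 z / 4)"
  have holCH: "CH holomorphic_on UNIV"
    unfolding CH_def by (intro holomorphic_intros holB holH holDh holE1) auto
  have CH: "CH z = CC z * (H z * H z)" if "H z \<noteq> 0" for z
    using that by (simp add: CH_def CC_def tau_def tau1_def field_simps)
  have Tnz: "T z \<noteq> 0" if "H z \<noteq> 0" for z using that by (simp add: T_def)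
  have YY0: "YY z = 0" for z by (simp add: YY_def NY_zero)
  have C1: "CC1 z = tau z * CC z" if z: "f z \<noteq> 0" "H z \<noteq> 0" for z
  proof -
    have "(YY has_field_derivative 0) (at z)"
    proof -
      have "YY = (\<lambda>_. 0)" using YY0 by auto
      then show ?thesis by simp
    qed
    then have "YY1 z = 0" using d_YY[OF z] DERIV_unique by blast
    then show ?thesis by (simp add: YY1_def YY0)
  qed
  obtain z0 where z0: "f z0 \<noteq> 0" "H z0 \<noteq> 0"
  proof -
    have "\<forall>\<^sub>F z in at 0. f z \<noteq> 0" "\<forall>\<^sub>F z in at 0. H z \<noteq> 0"
      using entire_local_order[OF holf fnz, of 0] entire_local_order[OF holH Hnz, of 0] by blast+
    then have "\<forall>\<^sub>F z in at 0. f z \<noteq> 0 \<and> H z \<noteq> 0" by eventually_elim blast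
    from eventually_happens'[OF at_neq_bot this] that show ?thesis by blast
  qed
  obtain \<rho> where rho: "\<rho> > 0" "ball z0 \<rho> \<subseteq> {z. f z \<noteq> 0 \<and> H z \<noteq> 0}"
    using open_contains_ball_eq[OF open_nz] z0 by blast
  define \<kappa> where "\<kappa> = CC z0 / T z0"
  have const: "CC z / T z = \<kappa>" if z: "z \<in> ball z0 \<rho>" for z
  proof -
    have "\<exists>c. \<forall>z\<in>ball z0 \<rho>. CC z / T z = c"
    proof (rule has_field_derivative_zero_constant[OF convex_ball])
      fix z assume "z \<in> ball z0 \<rho>"
      then have nz: "f z \<noteq> 0" "H z \<noteq> 0" using rho by auto
      have dT: "(T has_field_derivative tau z * T z) (at z)" using d_T[of z] nz by (simp add: tau_def T_def)
      have "((\<lambda>z. CC z / T z) has_field_derivative (CC1 z * T z - CC z * (tau z * T z)) / (T z * T z)) (at z)"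
        by (intro DERIV_divide d_CC dT nz Tnz)
      then show "((\<lambda>z. CC z / T z) has_field_derivative 0) (at z within ball z0 \<rho>)"
        by (simp add: C1[OF nz] has_field_derivative_at_within)
    qed
    then show ?thesis using z rho by (metis \<kappa>_def centre_in_ball)
  qed
  have CT: "CH z = \<kappa> * (T z * (H z * H z))" for z
  proof (rule analytic_continuation_open[of "ball z0 \<rho>" UNIV CH "\<lambda>z. \<kappa> * (T z * (H z * H z))"])
    show "(\<lambda>z. \<kappa> * (T z * (H z * H z))) holomorphic_on UNIV" by (intro holomorphic_intros holT holH)
    fix z assume z: "z \<in> ball z0 \<rho>"
    then have nz: "f z \<noteq> 0" "H z \<noteq> 0" using rho by auto
    have "CC z = \<kappa> * T z" using const[OF z] Tnz[OF nz(2)] by (simp add: field_simps)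
    then show "CH z = \<kappa> * (T z * (H z * H z))" using CH[OF nz(2)] by simp
  qed (use rho holCH in auto)
  have CCT: "CC z = \<kappa> * T z" if "H z \<noteq> 0" for z
    using CT[of z] CH[OF that] that by simp
  have "\<kappa> = 0"
  proof (rule ccontr)
    assume k: "\<kappa> \<noteq> 0"
    obtain \<theta>0 \<delta> \<eta> where d: "\<delta> > 0" and est:
    "\<forall>\<epsilon>>0. 40 * \<epsilon> \<le> \<delta> \<longrightarrow> (\<exists>R0. \<forall>R\<ge>R0. estimates \<theta>0 \<delta> \<eta> \<epsilon> R)"
      using circle_estimates by blast
    \<comment> \<open>Then 12 \<epsilon> = \<delta>/4, half of the available decay
      \<delta>/2.\<close>
    define \<epsilon> where "\<epsilon> = \<delta> / 48"
    have e: "\<epsilon> > 0" "40 * \<epsilon> \<le> \<delta>" using d by (auto simp: \<epsilon>_def)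
    obtain R0 where R0: "\<And>R. R \<ge> R0 \<Longrightarrow> estimates \<theta>0 \<delta> \<eta> \<epsilon> R"
      using est[rule_format, OF e] by blast
    have "\<forall>\<^sub>F r in at_top. - ln (cmod \<kappa>) + 1 \<le> \<delta> / 4 * r ^ n" using d by (intro const_le_power n) auto
    then obtain r1 where r1: "\<And>r. r \<ge> r1 \<Longrightarrow> - ln (cmod \<kappa>) + 1 \<le> \<delta> / 4 * r ^ n" by (auto simp: eventually_at_top_linorder)
    obtain r z where rz: "max R0 r1 \<le> r" "cmod z = r" "H z \<noteq> 0"
      "cmod (CC z) \<le> exp (12 * (\<epsilon> * r ^ n) - \<delta> / 2 * r ^ n) * cmod (T z)"
      using R0[of "max R0 r1"] unfolding estimates_def by auto
    have "12 * (\<epsilon> * r ^ n) - \<delta> / 2 * r ^ n = - (\<delta> / 4 * r ^ n)" by (simp add: \<epsilon>_def)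
    then have "cmod \<kappa> * cmod (T z) \<le> exp (- (\<delta> / 4 * r ^ n)) * cmod (T z)"
      using rz(4) CCT[OF rz(3)] by (simp add: norm_mult)
    then have "cmod \<kappa> \<le> exp (- (\<delta> / 4 * r ^ n))" using Tnz[OF rz(3)] by simp
    then have "ln (cmod \<kappa>) \<le> - (\<delta> / 4 * r ^ n)" using k by (metis ln_exp ln_le_cancel_iff exp_gt_zero zero_less_norm_iff)
    then show False using r1[of r] rz(1) by simp
  qed
  then show "H z \<noteq> 0 \<Longrightarrow> CC z = 0" using CCT by simp
qed

section \<open>The identity U^2 = -T: zeros, the formula for \<open>B\<close>, the second
  solution\<close>

lemma UU_sq: "f z \<noteq> 0 \<Longrightarrow> H z \<noteq> 0 \<Longrightarrow> UU z * UU z = - T z"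
  using YY_eq[of z] CC_zero[of z] by (simp add: YY_def NY_zero eq_neg_iff_add_eq_0 neg_eq_iff_add_eq_0)

text \<open>\<open>UU\<close> is bounded near \<open>z0\<close> because its square is \<open>- T\<close>, while \<open>f'/f + T'/(4 T)\<close> has a nonnegative residue
  there, which vanishes only if neither \<open>f\<close> nor \<open>T\<close> has a zero at \<open>z0\<close>.\<close>

lemma f_H_nonzero: "f z0 \<noteq> 0 \<and> H z0 \<noteq> 0"
proof -
  have Tnz: "\<exists>z. T z \<noteq> 0" using Hnz by (auto simp: T_def)
  obtain k where k: "((\<lambda>z. (z - z0) * (deriv f z / f z)) \<longlongrightarrow> of_nat k) (at z0)" "f z0 = 0 \<longrightarrow> k > 0"
    "\<forall>\<^sub>F z in at z0. f z \<noteq> 0"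
    using entire_local_order[OF holf fnz] by blast
  obtain l where l: "((\<lambda>z. (z - z0) * (deriv T z / T z)) \<longlongrightarrow> of_nat l) (at z0)" "T z0 = 0 \<longrightarrow> l > 0"
    "\<forall>\<^sub>F z in at z0. T z \<noteq> 0"
    using entire_local_order[OF holT Tnz] by blast
  have evH: "\<forall>\<^sub>F z in at z0. H z \<noteq> 0" using l(3) by eventually_elim (auto simp: T_def)
  have "((\<lambda>z. ((z - z0) * (deriv f z / f z) + (z - z0) * (deriv T z / T z) / 4)\<^sup>2) \<longlongrightarrow> (of_nat k + of_nat l / 4)\<^sup>2) (at z0)"
    by (intro tendsto_intros k(1) l(1)) auto
  moreover have "((\<lambda>z. ((z - z0) * (deriv f z / f z) + (z - z0) * (deriv T z / T z) / 4)\<^sup>2) \<longlongrightarrow> 0) (at z0)"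
  proof (rule Lim_transform_eventually)
    have "isCont T z0" using DERIV_isCont[OF entire_has_derivative[OF holT]] .
    then have "((\<lambda>z. (z - z0)\<^sup>2 * (- T z)) \<longlongrightarrow> (z0 - z0)\<^sup>2 * (- T z0)) (at z0)"
      by (intro tendsto_intros) (auto simp: isCont_def)
    then show "((\<lambda>z. (z - z0)\<^sup>2 * (- T z)) \<longlongrightarrow> 0) (at z0)" by simp
    show "\<forall>\<^sub>F z in at z0. (z - z0)\<^sup>2 * (- T z) = ((z - z0) * (deriv f z / f z) + (z - z0) * (deriv T z / T z) / 4)\<^sup>2"
      using k(3) evH
    proof eventually_elim
      case (elim z)
      have "deriv T z / T z = tau z"
        using DERIV_imp_deriv[OF d_T, of z] elim by (simp add: tau_def T_def)
      then have "(z - z0) * (deriv f z / f z) + (z - z0) * (deriv T z / T z) / 4 = (z - z0) * UU z"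
        by (simp add: UU_def ww_def distrib_left)
      then have "((z - z0) * (deriv f z / f z) + (z - z0) * (deriv T z / T z) / 4)\<^sup>2 = (z - z0)\<^sup>2 * (UU z * UU z)"
        by (simp only: power2_eq_square mult_ac)
      then show ?case unfolding UU_sq[OF elim] by simp
    qed
  qed
  ultimately have "(of_nat k + of_nat l / 4 :: complex)\<^sup>2 = 0"
    using tendsto_unique[OF at_neq_bot] by blast
  then have "(of_nat k + of_nat l / 4 :: complex) = 0" by simp
  then have "Re (of_nat k + of_nat l / 4 :: complex) = 0" by simp
  then have "k = 0 \<and> l = 0" by simp
  then show ?thesis using k(2) l(2) by (auto simp: T_def)
qed

lemma B_formula: "B z = - (1/16) * (deriv T z / T z)\<^sup>2 + (1/4) * deriv (\<lambda>w. deriv T w / T w) z"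
proof -
  have tau: "deriv T w / T w = tau w" for w
    using DERIV_imp_deriv[OF d_T, of w] f_H_nonzero[of w] by (simp add: tau_def T_def)
  have "(\<lambda>w. deriv T w / T w) = tau" using tau by auto
  then have "deriv (\<lambda>w. deriv T w / T w) z = tau1 z" using DERIV_imp_deriv[OF d_tau] f_H_nonzero[of z] by simp
  then show ?thesis using CC_zero[of z] f_H_nonzero[of z] unfolding tau CC_def
    by (simp add: power2_eq_square algebra_simps add_eq_0_iff)
qed

text \<open>The logarithmic derivative of \<open>f\<close> is U - \<tau>/4, and the conjugate choice
  -U - \<tau>/4 solves the same Riccati equation. Since U'/U = \<tau>/2, it equals -w - U'/U, the
  logarithmic derivative of 1/(f U). The two logarithmic derivatives differ by 2 U, which has no
  zeros; this gives linear independence.\<close>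

lemma second_solution:
  "\<exists>f2. entire_solution A f2 \<and> lin_indep f f2 \<and> zero_free f2"
proof -
  note nz = f_H_nonzero
  have Tnz: "T z \<noteq> 0" for z using nz by (simp add: T_def)
  have sq: "UU z * UU z = - T z" for z using UU_sq nz by blast
  have Unz: "UU z \<noteq> 0" for z using sq[of z] Tnz[of z] by auto
  have dU: "(UU has_field_derivative tau z * UU z / 2) (at z)" for z
    using d_UU[of z] nz by (simp add: YY_def NY_zero)
  define f2 where "f2 = (\<lambda>z. 1 / (f z * UU z))"
  have fU: "f z * UU z \<noteq> 0" for z using nz Unz by simp
  have d1: "(f2 has_field_derivative - f2 z * (ww z + tau z / 2)) (at z)" for z
  proof -
    have "((\<lambda>z. f z * UU z) has_field_derivative (deriv f z * UU z + tau z * UU z / 2 * f z)) (at z)"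
      by (intro DERIV_mult d_f dU)
    from DERIV_inverse_fun[OF this fU]
    have "(f2 has_field_derivative - (inverse (f z * UU z) * (deriv f z * UU z + tau z * UU z / 2 * f z) * inverse (f z * UU z))) (at z)"
      by (simp add: f2_def inverse_eq_divide)
    moreover have "- (inverse (f z * UU z) * (deriv f z * UU z + tau z * UU z / 2 * f z) * inverse (f z * UU z)) = - f2 z * (ww z + tau z / 2)"
      using nz[of z] Unz[of z] by (simp add: f2_def ww_def field_simps)
    ultimately show ?thesis by simp
  qed
  have hol2: "f2 holomorphic_on UNIV"
    using d1 by (auto simp: holomorphic_on_def field_differentiable_def)
  have der1: "deriv f2 = (\<lambda>z. - f2 z * (ww z + tau z / 2))" using DERIV_imp_deriv[OF d1] by auto
  have "deriv (deriv f2) z + A z * f2 z = 0" for z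
  proof -
    have "((\<lambda>z. - f2 z * (ww z + tau z / 2)) has_field_derivative
       - (- f2 z * (ww z + tau z / 2)) * (ww z + tau z / 2) + ((- A z - ww z * ww z) + tau1 z / 2) * - f2 z) (at z)"
      using nz[of z] by (intro DERIV_mult DERIV_minus d1 DERIV_add DERIV_cdivide d_ww d_tau) auto
    then have dd: "deriv (deriv f2) z = - (- f2 z * (ww z + tau z / 2)) * (ww z + tau z / 2) + ((- A z - ww z * ww z) + tau1 z / 2) * - f2 z"
      unfolding der1 by (rule DERIV_imp_deriv)
    have "deriv (deriv f2) z + A z * f2 z = 2 * f2 z * (UU z * UU z + T z + CC z)"
      unfolding dd UU_def CC_def A_def by (simp add: field_simps)
    also have "\<dots> = 0" using sq[of z] CC_zero[of z] nz[of z] by simp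
    finally show ?thesis .
  qed
  then have sol2: "entire_solution A f2" using hol2 by (simp add: entire_solution_def)
  have zf2: "zero_free f2" using fU by (simp add: zero_free_def f2_def)
  have "lin_indep f f2"
    unfolding lin_indep_def
  proof (intro allI impI)
    fix a b assume ab: "\<forall>z. a * f z + b * f2 z = 0"
    have "((\<lambda>z. a * f z + b * f2 z) has_field_derivative a * deriv f 0 + b * (- f2 0 * (ww 0 + tau 0 / 2))) (at 0)"
      by (intro DERIV_add DERIV_cmult d_f d1)
    moreover have "(\<lambda>z. a * f z + b * f2 z) = (\<lambda>_. 0)" using ab by auto
    ultimately have D: "a * deriv f 0 + b * (- f2 0 * (ww 0 + tau 0 / 2)) = 0"
      by (metis DERIV_const DERIV_unique)
    have af: "a * f 0 = - (b * f2 0)" using ab by (simp add: eq_neg_iff_add_eq_0)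
    have "deriv f 0 = f 0 * ww 0" using nz[of 0] by (simp add: ww_def)
    then have "a * deriv f 0 = (a * f 0) * ww 0" by simp
    then have "- (b * f2 0) * (ww 0 + (ww 0 + tau 0 / 2)) = 0" using D unfolding af by (simp add: algebra_simps)
    moreover have "ww 0 + (ww 0 + tau 0 / 2) = 2 * UU 0" by (simp add: UU_def)
    moreover have "f2 0 \<noteq> 0" using zf2 by (simp add: zero_free_def)
    ultimately have "b = 0" using Unz[of 0] by simp
    then show "a = 0 \<and> b = 0" using af nz[of 0] by simp
  qed
  then show ?thesis using sol2 zf2 by blast
qed

end

theorem theorem10:
  fixes n :: nat and \<alpha> :: real and \<zeta> :: complex
    and A B H T f :: "complex \<Rightarrow> complex"
  assumes "n > 0" and "\<alpha> < real n" and "\<zeta> \<noteq> 0"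
    and A_def: "\<And>z. A z = T z + B z"
    and T_def: "\<And>z. T z = H z * exp (\<zeta> * z ^ n)"
    and "H holomorphic_on UNIV" and "\<exists>z. H z \<noteq> 0" and "growth_order H < ereal \<alpha>"
    and "B holomorphic_on UNIV" and "growth_order B < \<infinity>"
    and "\<And>\<theta>. \<theta> \<in> {-pi..<pi} \<Longrightarrow>
           \<exists>s<1/2. \<forall>\<^sub>F r in at_top.
             log_plus (norm (B (of_real r * cis \<theta>)))
               \<le> s * max (Re (\<zeta> * cis (real n * \<theta>))) 0 * r ^ n + r powr \<alpha>"
    and "entire_solution A f" and "\<exists>z. f z \<noteq> 0" and "zeros_exponent f < ereal \<alpha>"
  shows "zero_free f \<and> zero_free H \<and>
         (\<forall>z. B z = - (1/16) * (deriv T z / T z)\<^sup>2 + (1/4) * deriv (\<lambda>w. deriv T w / T w) z) \<and>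
         (\<exists>f1 f2. entire_solution A f1 \<and> entire_solution A f2 \<and> lin_indep f1 f2 \<and>
                  zero_free f1 \<and> zero_free f2)"
proof -
  have holf: "f holomorphic_on UNIV" using assms(12) by (simp add: entire_solution_def)
  \<comment> \<open>The infimum is over positive exponents, so its being below \<alpha> also yields
    \<alpha> > 0, on which the treatment of \<open>H\<close> relies.\<close>
  obtain s where s: "s > 0" "s < \<alpha>"
    and zs: "(\<lambda>z. real_of_int (zorder f z) * norm z powr (- s)) summable_on {z. z \<noteq> 0 \<and> f z = 0}"
    using assms(14) unfolding zeros_exponent_def Inf_less_iff by auto
  have sm: "(\<lambda>z. norm z powr (- s)) summable_on {z. z \<noteq> 0 \<and> f z = 0}"
  proof (rule summable_on_comparison_test[OF zs])
    fix z assume z: "z \<in> {z. z \<noteq> 0 \<and> f z = 0}"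
    have "\<exists>w\<in>UNIV. f w \<noteq> 0" using assms(13) by blast
    from zorder_exist_zero[OF holf open_UNIV connected_UNIV UNIV_I this, of z] z
    have "zorder f z > 0" by simp
    then have "1 * norm z powr (- s) \<le> real_of_int (zorder f z) * norm z powr (- s)"
      by (intro mult_right_mono) auto
    then show "norm z powr (- s) \<le> real_of_int (zorder f z) * norm z powr (- s)" by simp
  qed simp
  obtain m f1 where f1: "f1 holomorphic_on UNIV" "f1 0 \<noteq> 0" "\<And>z. f z = z ^ m * f1 z"
    using entire_factor_zero[OF holf assms(13)] by blast
  interpret bank_laine n \<alpha> \<zeta> B A H T f f1 s m
  proof
    show "fin_growth B" by (rule fin_growth_growth_order[OF assms(9,10)])
    show "\<exists>r0. \<forall>z. cmod z \<ge> r0 \<longrightarrow> cmod (H z) \<le> exp (cmod z powr \<alpha>)"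
      by (rule growth_order_less_imp[OF assms(6,8)])
    show "0 < \<alpha>" "s < real n" using s assms(2) by auto
  qed (fact assms s f1 sm)+
  have "zero_free f" "zero_free H" using f_H_nonzero by (auto simp: zero_free_def)
  then show ?thesis using B_formula second_solution sol by blast
qed

end
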